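(* Let $(Q,\alpha)$ be a strongly connected, prime quiver setting with $\alpha=(1,\dots,1)$ that is a complete intersection, and suppose that none of the reduction steps RI, RII, RIII, RIV can be applied to it. Then $Q$ consists of a single vertex with no loops.
   Context: $\mathbb{C}$ denotes an algebraically closed field of characteristic zero. A quiver $Q=(V,A,s,t)$ is a finite directed graph with vertex set $V$, arrow set $A$ and source and target maps $s,t:A\to V$; loops and multiple arrows are allowed. For the dimension vector $\alpha=(1,\dots,1)$ the representation space is $Rep_\alpha Q=\mathbb{C}^{A}$, on which $GL_\alpha=(\mathbb{C}^* )^{V}$ acts by $(g\cdot X)_\rho=g_{t(\rho)}X_\rho g_{s(\rho)}^{-1}$, and $iss_\alpha Q=Rep_\alpha Q//GL_\alpha$ is the affine quotient, with coordinate ring $\mathbb{C}[iss_\alpha Q]=\mathbb{C}[Rep_\alpha Q]^{GL_\alpha}$. A primitive cycle is a directed cycle (of length $\ge 1$, up to cyclic rotation) that does not run through any vertex more than once; a loop is a primitive cycle. If $c_1,\dots,c_n$ are the primitive cycles of $Q$ and $f_i$ is the product of the coordinates $X_\rho$ over the arrows $\rho$ of $c_i$, then $f_1,\dots,f_n$ generate $\mathbb{C}[iss_\alpha Q]$. Let $\varphi:\mathbb{C}[x_1,\dots,x_n]\to\mathbb{C}[iss_\alpha Q]$, $\varphi(x_i)=f_i$. $(Q,\alpha)$ is a complete intersection if $iss_\alpha Q$ is a complete intersection, i.e. $\mathrm{Ker}(\varphi)$ can be generated by $n-\dim(iss_\alpha Q)$ elements. $Q$ is the connected sum of two subquivers $Q_1=(V_1,A_1)$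 and $Q_2=(V_2,A_2)$ at the vertex $v$ if $V=V_1\cup V_2$, $A=A_1\cup A_2$, $V_1\cap V_2=\{v\}$, $A_1\cap A_2=\emptyset$. $Q$ (with $\alpha=(1,\dots,1)$) is prime if it cannot be written as a non-trivial connected sum (non-trivial: neither $Q_1$ nor $Q_2$ is a single vertex without arrows). A connected pair is a pair of distinct vertices with at least one arrow in each direction between them. A path is a directed path with no repeated vertex; paths using different arrows (e.g. parallel arrows) are different. Reduction steps for $\alpha=(1,\dots,1)$. RI: if $Q$ has at least two vertices and $v$ is a vertex without loops whose in-degree is at most 1 or whose out-degree is at most 1, remove $v$ and all arrows incident to it and add, for each pair of an arrow $a$ into $v$ and an arrow $b$ out of $v$, a new arrow from $s(a)$ to $t(b)$. RII: remove the loops at a vertex having loops. RIII: applies only to vertices of dimension at least 2, so it can never be applied when $\alpha=(1,\dots,1)$. RIV: if $(v_1,v_2)$ is a connected pair such that either (a) there are exactly two paths from $v_1$ to $v_2$ and exactly two paths from $v_2$ to $v_1$, or (b) there is exactly one path from $v_1$ to $v_2$, or (c) there is exactly one path from $v_2$ to $v_1$, glue $v_1$ and $v_2$: replace them by a single vertex $w$, redirect to $w$ the endpoints in $\{v_1,v_2\}$ of arrows between $\{v_1,v_2\}$ and other vertices, and replace the $m$ arrows with both endpoints in $\{v_1,v_2\}$ by $m-1$ loops at $w$. *)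

theory Defs
  imports
    "HOL-Library.Poly_Mapping"
    "HOL-Library.Extended_Nat"
    "HOL-Computational_Algebra.Polynomial"
    "HOL-Algebra.RingHom"
    "Graph_Theory.Graph_Theory"
begin

text \<open>
  Quivers are the finite directed multigraphs \<^locale>\<open>fin_digraph\<close> (loops and parallel arcs
  are allowed); \<^const>\<open>tail\<close> is the source map and \<^const>\<open>head\<close> the target map. The dimension
  vector is \<open>(1,\<dots>,1)\<close> throughout.
\<close>

section \<open>Polynomial rings and Krull dimension\<close>

text \<open>
  A polynomial with variables of type \<open>'x\<close> maps an exponent vector of type \<open>'x \<Rightarrow>\<^sub>0 nat\<close> to its
  coefficient; multiplication is the convolution product of \<^type>\<open>poly_mapping\<close>.
\<close>

type_synonym ('x, 'k) mpoly = "('x \<Rightarrow>\<^sub>0 nat) \<Rightarrow>\<^sub>0 'k"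

definition vars :: "('x, 'k::zero) mpoly \<Rightarrow> 'x set" where
  "vars p = (\<Union>m\<in>Poly_Mapping.keys p. Poly_Mapping.keys m)"

definition mpoly_ring :: "'x set \<Rightarrow> ('x, 'k::comm_ring_1) mpoly ring" where
  "mpoly_ring I = \<lparr>carrier = {p. vars p \<subseteq> I}, mult = (*), one = 1, ring.zero = 0, add = (+)\<rparr>"

definition Const :: "'k::zero \<Rightarrow> ('x, 'k) mpoly" where
  "Const c = Poly_Mapping.single 0 c"

definition Var :: "'x \<Rightarrow> ('x, 'k::zero_neq_one) mpoly" where
  "Var x = Poly_Mapping.single (Poly_Mapping.single x 1) 1"

text \<open>The ring homomorphism given by \<open>h\<close> on coefficients and by \<open>f\<close> on variables.\<close>

definition mpoly_hom :: "('k::zero \<Rightarrow> 'r::comm_ring_1) \<Rightarrow> ('x \<Rightarrow> 'r) \<Rightarrow> ('x, 'k) mpoly \<Rightarrow> 'r" where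
  "mpoly_hom h f p = (\<Sum>m\<in>Poly_Mapping.keys p. h (Poly_Mapping.lookup p m) *
     (\<Prod>x\<in>Poly_Mapping.keys m. f x ^ Poly_Mapping.lookup m x))"

definition mpoly_eval :: "('x \<Rightarrow> 'k::comm_ring_1) \<Rightarrow> ('x, 'k) mpoly \<Rightarrow> 'k" where
  "mpoly_eval X = mpoly_hom (\<lambda>c. c) X"

definition krull_dim :: "('a, 'm) ring_scheme \<Rightarrow> enat" where
  "krull_dim R = (SUP n \<in> {n. \<exists>P :: nat \<Rightarrow> 'a set.
      (\<forall>i\<le>n. primeideal (P i) R) \<and> (\<forall>i<n. P i \<subset> P (Suc i))}. enat n)"

section \<open>The quotient \<open>iss\<^sub>\<alpha> Q\<close> and complete intersections\<close>

text \<open>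
  A representation assigns a scalar to every arc; values outside \<^term>\<open>arcs Q\<close> play no role.
\<close>

definition rep_act ::
    "('v, 'b) pre_digraph \<Rightarrow> ('v \<Rightarrow> 'k::field) \<Rightarrow> ('b \<Rightarrow> 'k) \<Rightarrow> 'b \<Rightarrow> 'k" where
  "rep_act Q g X = (\<lambda>a. g (head Q a) * X a * inverse (g (tail Q a)))"

definition iss_ring :: "('v, 'b) pre_digraph \<Rightarrow> ('b, 'k::field) mpoly ring" where
  "iss_ring Q = (mpoly_ring (arcs Q))\<lparr>carrier := {p \<in> carrier (mpoly_ring (arcs Q)).
      \<forall>g X. (\<forall>v\<in>verts Q. g v \<noteq> 0) \<longrightarrow> mpoly_eval (rep_act Q g X) p = mpoly_eval X p}\<rparr>"

text \<open>
  A primitive cycle is a rotation class of arc lists. A loop is a cycle in the sense of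
  \<^const>\<open>pre_digraph.cycle\<close>.
\<close>

definition primitive_cycles :: "('v, 'b) pre_digraph \<Rightarrow> 'b list set set" where
  "primitive_cycles Q = (\<lambda>p. range (\<lambda>i. rotate i p)) ` {p. pre_digraph.cycle Q p}"

definition cycle_arcs :: "'b list set \<Rightarrow> 'b set" where
  "cycle_arcs c = (\<Union>p\<in>c. set p)"

definition cycle_monom :: "'b list set \<Rightarrow> ('b, 'k::comm_ring_1) mpoly" where
  "cycle_monom c = (\<Prod>a\<in>cycle_arcs c. Var a)"

definition cycle_hom :: "('b list set, 'k::comm_ring_1) mpoly \<Rightarrow> ('b, 'k) mpoly" where
  "cycle_hom = mpoly_hom Const cycle_monom"

definition cycle_ideal :: "('v, 'b) pre_digraph \<Rightarrow> ('b list set, 'k::field) mpoly set" where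
  "cycle_ideal Q = a_kernel (mpoly_ring (primitive_cycles Q)) (iss_ring Q) cycle_hom"

text \<open>
  The kernel is generated by \<open>n - dim\<close> not necessarily distinct elements, that is, by a set of at
  most \<open>n - dim\<close> elements. The inequality is stated additively to avoid truncated subtraction.
\<close>

definition complete_intersection :: "'k::field itself \<Rightarrow> ('v, 'b) pre_digraph \<Rightarrow> bool" where
  "complete_intersection K Q \<longleftrightarrow>
    (\<exists>S :: ('b list set, 'k) mpoly set. finite S
      \<and> S \<subseteq> carrier (mpoly_ring (primitive_cycles Q))
      \<and> cycle_ideal Q = Idl\<^bsub>mpoly_ring (primitive_cycles Q)\<^esub> S
      \<and> enat (card S) + krull_dim (iss_ring Q :: ('b, 'k) mpoly ring)
          \<le> enat (card (primitive_cycles Q)))"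

section \<open>Prime quivers\<close>

definition connected_sum ::
    "('v, 'b) pre_digraph \<Rightarrow> ('v, 'b) pre_digraph \<Rightarrow> ('v, 'b) pre_digraph \<Rightarrow> 'v \<Rightarrow> bool" where
  "connected_sum Q Q1 Q2 v \<longleftrightarrow> subgraph Q1 Q \<and> subgraph Q2 Q
    \<and> verts Q = verts Q1 \<union> verts Q2 \<and> arcs Q = arcs Q1 \<union> arcs Q2
    \<and> verts Q1 \<inter> verts Q2 = {v} \<and> arcs Q1 \<inter> arcs Q2 = {}"

definition trivial_quiver :: "('v, 'b) pre_digraph \<Rightarrow> bool" where
  "trivial_quiver Q \<longleftrightarrow> (\<exists>v. verts Q = {v}) \<and> arcs Q = {}"

definition prime_quiver :: "('v, 'b) pre_digraph \<Rightarrow> bool" where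
  "prime_quiver Q \<longleftrightarrow> \<not> (\<exists>Q1 Q2 v. connected_sum Q Q1 Q2 v
    \<and> \<not> trivial_quiver Q1 \<and> \<not> trivial_quiver Q2)"

section \<open>Applicability of the reduction steps\<close>

definition loops_at :: "('v, 'b) pre_digraph \<Rightarrow> 'v \<Rightarrow> 'b set" where
  "loops_at Q v = in_arcs Q v \<inter> out_arcs Q v"

definition RI_applicable :: "('v, 'b) pre_digraph \<Rightarrow> 'v \<Rightarrow> bool" where
  "RI_applicable Q v \<longleftrightarrow> card (verts Q) \<ge> 2 \<and> v \<in> verts Q \<and> loops_at Q v = {}
    \<and> (in_degree Q v \<le> 1 \<or> out_degree Q v \<le> 1)"

definition RII_applicable :: "('v, 'b) pre_digraph \<Rightarrow> 'v \<Rightarrow> bool" where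
  "RII_applicable Q v \<longleftrightarrow> v \<in> verts Q \<and> loops_at Q v \<noteq> {}"

definition connected_pair :: "('v, 'b) pre_digraph \<Rightarrow> 'v \<Rightarrow> 'v \<Rightarrow> bool" where
  "connected_pair Q u v \<longleftrightarrow> u \<noteq> v \<and> u \<rightarrow>\<^bsub>Q\<^esub> v \<and> v \<rightarrow>\<^bsub>Q\<^esub> u"

definition num_paths :: "('v, 'b) pre_digraph \<Rightarrow> 'v \<Rightarrow> 'v \<Rightarrow> nat" where
  "num_paths Q u v = card {p. pre_digraph.apath Q u p v}"

definition RIV_applicable :: "('v, 'b) pre_digraph \<Rightarrow> 'v \<Rightarrow> 'v \<Rightarrow> bool" where
  "RIV_applicable Q u v \<longleftrightarrow> connected_pair Q u v
    \<and> (num_paths Q u v = 2 \<and> num_paths Q v u = 2 \<or> num_paths Q u v = 1 \<or> num_paths Q v u = 1)"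

text \<open>
  Only the preconditions of the steps matter here. The step RIII acts only on vertices of dimension at least two and hence never applies
  for the dimension vector \<open>(1,\<dots>,1)\<close>.
\<close>

definition reduced :: "('v, 'b) pre_digraph \<Rightarrow> bool" where
  "reduced Q \<longleftrightarrow> (\<nexists>v. RI_applicable Q v) \<and> (\<nexists>v. RII_applicable Q v)
    \<and> (\<nexists>u v. RIV_applicable Q u v)"

end

theory Submission
  imports Defs "HOL-Library.Multiset" "HOL-Library.Function_Algebras"
begin

text \<open>
  Grade the polynomial ring on the cycles by the arcs. If the cycle ideal has \<open>n - dim\<close> generators,
  Nakayama's lemma bounds the number of its minimal relations by the rank of the lattice of all
  relations between cycles. The minimal relations already span this lattice, so they are linearly
  independent, and no relation \<open>c1 c2 = v\<close> is a combination of two relations whose degrees are not above its own.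
  This excludes vertices \<open>u \<noteq> v\<close> with at least two paths one way and three the other way that meet only at
  the ends: since RIV does not apply, a connected pair would have this form.

  Contracting a strongly connected subquiver localises the ring, and inverting the cycles
  disjoint from the remaining arcs preserves the independence of the relations. By induction
  on the number of vertices, if all vertices but \<open>h\<close> have in- and out-degree at least two and every
  pair of opposite arcs involves \<open>h\<close>, then every arc is incident to \<open>h\<close>: contract a 2-cycle at \<open>h\<close>
  if there is one, the only arc leaving or entering \<open>h\<close> if \<open>h\<close> has small degree, and a shortest
  cycle otherwise. For a reduced quiver without connected pairs any vertex may serve as \<open>h\<close>; then
  every other vertex forms a connected pair with \<open>h\<close>.
\<close>

section \<open>Cycles and circulations\<close>

text \<open>The property of being a complete intersection is not transported to contracted quivers:
  deleting inner arcs changes both the number of cycles and the dimension. What is transported is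
  its consequence \<open>rigid\<close>, and each time it is derived afresh from the original quiver.
  Since \<open>descends\<close> composes, the cycles of every iterated contraction are compared
  directly with the original ones, and no localised ring is built. Nakayama's lemma is applied to
  the original ideal at the point where the cycles missing all remaining arcs have value 1 and all
  other cycles value 0. Relations among the inverted cycles also cost generators at that point, so
  they are counted beside the components of the fibres. The two forbidden shapes are classical. Two
  paths against three give a 2 by 3 matrix of products, whose three minors cut out codimension two
  only; two choices on each side of a triangle give the relations of the 2x2x2 Segre variety. In
  both cases one redundant relation yields the contradiction.\<close>

definition cycs :: "('v, 'b) pre_digraph \<Rightarrow> 'b set set" where
  "cycs G = set ` {p. pre_digraph.cycle G p}"

text \<open>A multiset of arc sets stands for a monomial in the cycle variables; this is the
  exponent vector of its image in the arc variables. Two multisets of cycles with equal flow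
  therefore give a binomial in the cycle ideal.\<close>

definition flow :: "'b set multiset \<Rightarrow> 'b \<Rightarrow> nat" where
  "flow w a = (\<Sum>c\<in>#w. of_bool (a \<in> c))"

lemma flow_empty [simp]: "flow {#} = (\<lambda>a. 0)"
  and flow_add_mset [simp]: "flow (add_mset c w) = (\<lambda>a. of_bool (a \<in> c) + flow w a)"
  and flow_union: "flow (w + w') a = flow w a + flow w' a"
  by (auto simp: flow_def fun_eq_iff)

lemma flow_pos_iff: "flow w a > 0 \<longleftrightarrow> (\<exists>c\<in>#w. a \<in> c)"
  by (induction w) auto

lemma flow_image_mset: "flow (\<Sum>x\<in>#w. f x) a = (\<Sum>x\<in>#w. flow (f x) a)"
  by (induction w) (auto simp: flow_union)

lemma set_mset_sum_image: "set_mset (\<Sum>x\<in>#w. f x) = (\<Union>x\<in>set_mset w. set_mset (f x))"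
  by (induction w) auto

definition circulation :: "('v, 'b) pre_digraph \<Rightarrow> ('b \<Rightarrow> nat) \<Rightarrow> bool" where
  "circulation G f \<longleftrightarrow> (\<forall>a. a \<notin> arcs G \<longrightarrow> f a = 0) \<and>
    (\<forall>v\<in>verts G. sum f (in_arcs G v) = sum f (out_arcs G v))"

section \<open>Walks, paths and cycles as lists of arcs\<close>

context wf_digraph
begin

lemma awalk_verts_eq: "awalk u p v \<Longrightarrow> awalk_verts u p = u # map (head G) p"
  by (induction p arbitrary: u) (auto simp: awalk_Cons_iff)

lemma awalk_tails_heads: "awalk u p v \<Longrightarrow> map (tail G) p @ [v] = u # map (head G) p"
  by (induction p arbitrary: u) (auto simp: awalk_simps)

lemma apath_iff: "apath u p v \<longleftrightarrow> awalk u p v \<and> distinct (u # map (head G) p)"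
  unfolding apath_def by (auto simp: awalk_verts_eq)

lemma cycle_iff: "cycle p \<longleftrightarrow> (\<exists>u. awalk u p u \<and> distinct (map (head G) p) \<and> p \<noteq> [])"
  unfolding cycle_def by (metis awalk_verts_eq list.sel(3))

lemma cycle_ConsI: "a \<in> arcs G \<Longrightarrow> apath (head G a) r (tail G a) \<Longrightarrow> cycle (a # r)"
  unfolding cycle_iff apath_iff by (intro exI[of _ "tail G a"]) (auto simp: awalk_Cons_iff)

lemma cycle_split:
  assumes "cycle p" "a \<in> set p"
  obtains r where "apath (head G a) r (tail G a)" "a \<notin> set r" "set p = insert a (set r)"
    "length p = Suc (length r)"
proof -
  obtain xs ys where p: "p = xs @ a # ys" using assms(2) by (auto simp: in_set_conv_decomp)
  obtain u where u: "awalk u p u" and d: "distinct (map (head G) p)"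
    using assms(1) by (auto simp: cycle_iff)
  have 1: "awalk (head G a) ys u" "awalk u xs (tail G a)"
    using u unfolding p by (auto simp: awalk_Cons_iff)
  have "awalk (head G a) (ys @ xs) (tail G a)" using 1 by (rule awalk_appendI)
  moreover have "distinct (head G a # map (head G) (ys @ xs))"
    using d unfolding p by auto
  ultimately have "apath (head G a) (ys @ xs) (tail G a)" unfolding apath_iff by blast
  moreover have "a \<notin> set (ys @ xs)" using d unfolding p by auto
  ultimately show thesis using that[of "ys @ xs"] p by auto
qed

lemma cycle_appendI:
  assumes p: "apath u p v" and q: "apath v q u" and "u \<noteq> v"
    and i: "set (awalk_verts u p) \<inter> set (awalk_verts v q) \<subseteq> {u, v}"
  shows "cycle (p @ q)"
proof -
  have w: "awalk u p v" "awalk v q u" using p q by (auto intro: awalkI_apath)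
  have "p \<noteq> []" using w assms(3) by (auto simp: awalk_Nil_iff)
  moreover have "awalk u (p @ q) u" using w by (rule awalk_appendI)
  moreover have "distinct (map (head G) (p @ q))"
    using p q i unfolding awalk_verts_eq[OF w(1)] awalk_verts_eq[OF w(2)] apath_iff by auto
  ultimately show ?thesis unfolding cycle_iff by blast
qed

lemma cycle_mset_heads:
  assumes "cycle p" shows "mset (map (tail G) p) = mset (map (head G) p)"
proof -
  obtain u where "awalk u p u" using assms by (auto simp: cycle_iff)
  from arg_cong[OF awalk_tails_heads[OF this], of mset] show ?thesis by simp
qed

lemma cycle_distinct:
  assumes "cycle p"
  shows "distinct p" "distinct (map (head G) p)" "distinct (map (tail G) p)"
proof -
  show h: "distinct (map (head G) p)" using assms by (auto simp: cycle_iff)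
  then show "distinct p" by (simp add: distinct_map)
  show "distinct (map (tail G) p)"
    using h mset_eq_imp_distinct_iff[OF cycle_mset_heads[OF assms]] by blast
qed

lemma cycle_arcs_sub: "cycle p \<Longrightarrow> set p \<subseteq> arcs G" "cycle p \<Longrightarrow> p \<noteq> []"
  by (auto simp: cycle_iff)

lemma cycle_heads: "cycle p \<Longrightarrow> head G ` set p = tail G ` set p"
  using cycle_mset_heads[of p] by (metis list.set_map set_mset_mset)

text \<open>Following chosen successors inside the finite set \<open>S\<close> must revisit an arc,
  which closes a walk. The walk is formed in the subgraph with arc set \<open>S\<close>, so that the
  cycle extracted from it uses no other arc.\<close>

lemma exists_cycle:
  assumes fin: "finite S" "S \<subseteq> arcs G" "S \<noteq> {}" and nxt: "\<And>a. a \<in> S \<Longrightarrow> \<exists>b\<in>S. tail G b = head G a"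
  obtains p where "cycle p" "set p \<subseteq> S"
proof -
  define H where "H = G\<lparr>arcs := S\<rparr>"
  interpret H: wf_digraph H using fin(2) by unfold_locales (auto simp: H_def)
  obtain n where n: "\<And>a. a \<in> S \<Longrightarrow> n a \<in> S \<and> tail G (n a) = head G a" using nxt by metis
  obtain a0 where a0: "a0 \<in> S" using fin(3) by auto
  define s where "s i = (n ^^ i) a0" for i
  have sS: "s i \<in> S" for i by (induction i) (use a0 n in \<open>auto simp: s_def\<close>)
  have w: "H.awalk (tail G (s i)) (map s [i..<i+k]) (tail G (s (i + k)))" for i k
  proof (induction k)
    case 0
    have "tail G (s i) \<in> verts H" using sS[of i] fin(2) by (auto simp: H_def)
    then show ?case by (auto simp: H.awalk_Nil_iff)
  next
    case (Suc k)
    have "s (i + k) \<in> arcs H" "tail H = tail G" "head H = head G"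
      using sS[of "i + k"] by (auto simp: H_def)
    with H.arc_implies_awalk[of "s (i + k)"] n[OF sS[of "i+k"]]
    have "H.awalk (tail G (s (i + k))) [s (i + k)] (tail G (s (i + Suc k)))"
      by (simp add: s_def)
    from H.awalk_appendI[OF Suc this] show ?case by simp
  qed
  have "\<not> inj s" using finite_subset[of "range s" S] sS fin(1) range_inj_infinite by blast
  then obtain i j where "i < j" "s i = s j" unfolding inj_def by (metis nat_neq_iff)
  then have "H.closed_w (map s [i..<j])" using w[of i "j - i"] by (auto simp: H.closed_w_def)
  then obtain p where p: "H.cycle p" using H.closed_w_imp_cycle by blast
  have "subgraph H G" using fin(2) H.wf_digraph wf_digraph
    by (auto simp: subgraph_def H_def compatible_def)
  from subgraph_cycle[OF this p] H.cycle_arcs_sub[OF p] show thesis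
    using that by (auto simp: H_def)
qed

end

context fin_digraph
begin

lemma in_sum_cycle:
  assumes "cycle p" shows "(\<Sum>a\<in>in_arcs G v. of_bool (a \<in> set p)) = (of_bool (v \<in> tail G ` set p) :: nat)"
    and "(\<Sum>a\<in>out_arcs G v. of_bool (a \<in> set p)) = (of_bool (v \<in> tail G ` set p) :: nat)"
proof -
  have inj: "inj_on (head G) (set p)" "inj_on (tail G) (set p)"
    using cycle_distinct[OF assms] by (auto simp: distinct_map)
  have sub: "set p \<subseteq> arcs G" using cycle_arcs_sub[OF assms] by auto
  have eq: "(\<Sum>a\<in>{a\<in>arcs G. f a = v}. of_bool (a \<in> set p)) = (of_bool (v \<in> f ` set p) :: nat)"
    if i: "inj_on f (set p)" for f :: "'b \<Rightarrow> 'a"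
  proof (cases "v \<in> f ` set p")
    case True
    then obtain a where a: "a \<in> set p" "f a = v" by auto
    have "(\<Sum>a\<in>{a\<in>arcs G. f a = v}. of_bool (a \<in> set p)) = (\<Sum>b\<in>{a}. of_bool (b \<in> set p) :: nat)"
      using a sub i by (intro sum.mono_neutral_right) (auto dest: inj_onD)
    then show ?thesis using a True by simp
  next
    case False
    then show ?thesis by (auto intro!: sum.neutral)
  qed
  show "(\<Sum>a\<in>in_arcs G v. of_bool (a \<in> set p)) = (of_bool (v \<in> tail G ` set p) :: nat)"
    using eq[OF inj(1)] unfolding in_arcs_def cycle_heads[OF assms] .
  show "(\<Sum>a\<in>out_arcs G v. of_bool (a \<in> set p)) = (of_bool (v \<in> tail G ` set p) :: nat)"
    using eq[OF inj(2)] unfolding out_arcs_def .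
qed

lemma finite_cycs: "finite (cycs G)"
  by (rule finite_subset[of _ "Pow (arcs G)"]) (use cycle_arcs_sub in \<open>auto simp: cycs_def\<close>)

lemma cycs_sub: "c \<in> cycs G \<Longrightarrow> c \<subseteq> arcs G" "c \<in> cycs G \<Longrightarrow> c \<noteq> {}"
  using cycle_arcs_sub by (auto simp: cycs_def)

section \<open>Circulations as sums of cycles\<close>

lemma circulation_add: "circulation G f \<Longrightarrow> circulation G g \<Longrightarrow> circulation G (\<lambda>a. f a + g a)"
  by (auto simp: circulation_def sum.distrib)

lemma circulation_diff:
  assumes "circulation G f" "circulation G g" "\<And>a. g a \<le> f a"
  shows "circulation G (\<lambda>a. f a - g a)"
  using assms by (auto simp: circulation_def sum_subtractf_nat)

lemma circulation_cycle: "c \<in> cycs G \<Longrightarrow> circulation G (\<lambda>a. of_bool (a \<in> c))"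
  using cycs_sub(1)[of c] by (auto simp: circulation_def cycs_def in_sum_cycle)

lemma circulation_flow: "set_mset w \<subseteq> cycs G \<Longrightarrow> circulation G (flow w)"
proof (induction w)
  case empty
  show ?case by (simp add: circulation_def)
next
  case (add c w)
  then show ?case using circulation_add[OF circulation_cycle] by simp
qed

text \<open>Conservation allows every walk inside the support to continue, so the support contains a
  cycle, and subtracting it lowers the total. This turns sums of paths that are not cycles
  themselves back into monomials in the cycle variables.\<close>

lemma circulation_decomp:
  assumes "circulation G f"
  obtains w where "set_mset w \<subseteq> cycs G" "flow w = f"
  using assms
proof (induction "sum f (arcs G)" arbitrary: f thesis rule: less_induct)
  case less
  define S where "S = {a \<in> arcs G. f a > 0}"
  show ?case
  proof (cases "S = {}")
    case True
    then have "f = (\<lambda>a. 0)" using less.prems by (auto simp: S_def circulation_def)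
    then show ?thesis using less.prems(1)[of "{#}"] by simp
  next
    case False
    have nxt: "\<exists>b\<in>S. tail G b = head G a" if a: "a \<in> S" for a
    proof -
      have "0 < f a" "a \<in> in_arcs G (head G a)" "head G a \<in> verts G" using a by (auto simp: S_def)
      moreover then have "f a \<le> sum f (in_arcs G (head G a))" by (intro member_le_sum) auto
      ultimately have "sum f (out_arcs G (head G a)) > 0" using less.prems(2)
        by (auto simp: circulation_def)
      then obtain b where "b \<in> out_arcs G (head G a)" "f b > 0"
        by (metis gr0I less_numeral_extra(3) sum.neutral)
      then show ?thesis by (auto simp: S_def)
    qed
    obtain p where p: "cycle p" "set p \<subseteq> S"
      using exists_cycle[OF _ _ False nxt] unfolding S_def by auto
    define g where "g a = f a - of_bool (a \<in> set p)" for a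
    have le: "of_bool (a \<in> set p) \<le> f a" for a using p(2) by (auto simp: S_def of_bool_def)
    have pc: "set p \<in> cycs G" using p(1) by (auto simp: cycs_def)
    have cg: "circulation G g" unfolding g_def
      using circulation_diff[OF less.prems(2) circulation_cycle[OF pc]] le by auto
    have "sum g (arcs G) < sum f (arcs G)"
    proof (rule sum_strict_mono_ex1)
      obtain a where "a \<in> set p" using cycle_arcs_sub[OF p(1)] by fastforce
      then show "\<exists>a\<in>arcs G. g a < f a" using p(2) by (intro bexI[of _ a]) (auto simp: g_def S_def)
    qed (auto simp: g_def)
    then obtain w where w: "set_mset w \<subseteq> cycs G" "flow w = g" using less.hyps cg by metis
    have "flow (add_mset (set p) w) = f" using le by (auto simp: w(2) g_def)
    then show ?thesis using less.prems(1)[of "add_mset (set p) w"] w pc by auto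
  qed
qed

text \<open>Within \<open>d\<close> each vertex has only one outgoing arc, so a walk along
  \<open>d\<close> that starts on \<open>c\<close> never leaves \<open>c\<close>.\<close>

lemma cycs_antichain:
  assumes "c \<in> cycs G" "d \<in> cycs G" "c \<subseteq> d" shows "c = d"
proof (rule ccontr)
  assume "c \<noteq> d"
  obtain p q where p: "cycle p" "c = set p" and q: "cycle q" "d = set q"
    using assms by (auto simp: cycs_def)
  obtain a where a: "a \<in> c" using p cycle_arcs_sub by fastforce
  obtain r where r: "apath (head G a) r (tail G a)" "d = insert a (set r)"
    using cycle_split[OF q(1), of a] a assms(3) q(2) by (metis subsetD)
  have nxt: "b \<in> c" if bd: "b \<in> d" and bc: "tail G b \<in> head G ` c" for b
  proof -
    obtain b' where "b' \<in> c" "tail G b' = tail G b"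
      using bc cycle_heads[OF p(1)] p(2) by auto
    moreover then have "b' = b" using bd assms(3) cycle_distinct(3)[OF q(1)] q(2)
      by (auto simp: distinct_map inj_on_def)
    ultimately show ?thesis by simp
  qed
  have "set s \<subseteq> c" if "awalk u s v" "u \<in> head G ` c" "set s \<subseteq> d" for u s v
    using that
  proof (induction s arbitrary: u)
    case (Cons e s)
    have "e \<in> c" using Cons.prems by (intro nxt) (auto simp: awalk_Cons_iff)
    then show ?case using Cons by (auto simp: awalk_Cons_iff)
  qed auto
  then have "set r \<subseteq> c" using r a awalkI_apath by blast
  then show False using r a assms(3) \<open>c \<noteq> d\<close> by auto
qed

end

section \<open>Rigid families and localisation\<close>

lemma of_bool_Un: "A \<inter> B = {} \<Longrightarrow> of_bool (x \<in> A \<union> B) = (of_bool (x \<in> A) + of_bool (x \<in> B) :: nat)"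
  by (auto simp: of_bool_def)

lemma Un_disjoint_cancel: "A \<inter> X = {} \<Longrightarrow> B \<inter> X = {} \<Longrightarrow> A \<union> X = B \<union> X \<Longrightarrow> A = B"
  by blast

text \<open>
  The lattice vector of the relation \<open>c1 c2 = v\<close> is a sum of lattice vectors of two relations
  \<open>w1 = w1'\<close> and \<open>w2 = w2'\<close> whose degrees are not above that of \<open>c1 c2\<close>. In a complete
  intersection such a redundant relation has to be trivial.
\<close>

definition rigid :: "'b set set \<Rightarrow> bool" where
  "rigid C \<longleftrightarrow> (\<forall>c1\<in>C. \<forall>c2\<in>C. \<forall>v w1 w1' w2 w2'.
    set_mset v \<subseteq> C \<and> set_mset w1 \<subseteq> C \<and> set_mset w1' \<subseteq> C \<and> set_mset w2 \<subseteq> C \<and> set_mset w2' \<subseteq> C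
    \<and> flow v = flow {#c1, c2#} \<and> flow w1 = flow w1' \<and> flow w2 = flow w2'
    \<and> \<not> flow {#c1, c2#} \<le> flow w1 \<and> \<not> flow {#c1, c2#} \<le> flow w2
    \<and> {#c1, c2#} + w1' + w2' = v + w1 + w2 \<longrightarrow> v = {#c1, c2#})"

lemma rigidD:
  assumes "rigid C" "c1 \<in> C" "c2 \<in> C" "set_mset v \<subseteq> C" "set_mset w1 \<subseteq> C" "set_mset w1' \<subseteq> C"
    "set_mset w2 \<subseteq> C" "set_mset w2' \<subseteq> C"
    "flow v = flow {#c1, c2#}" "flow w1 = flow w1'" "flow w2 = flow w2'"
    "flow w1 e1 < flow {#c1, c2#} e1" "flow w2 e2 < flow {#c1, c2#} e2"
    "{#c1, c2#} + w1' + w2' = v + w1 + w2"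
  shows "v = {#c1, c2#}"
proof -
  have "\<not> flow {#c1, c2#} \<le> flow w1" "\<not> flow {#c1, c2#} \<le> flow w2"
    using assms(12,13) by (meson le_funD leD)+
  note n = this
  show ?thesis
    by (intro assms(1)[unfolded rigid_def, rule_format, of c1 c2 v w1 w1' w2 w2'] conjI) (fact assms n)+
qed

text \<open>Read \<open>a\<close>, \<open>p\<close> as rows and \<open>b\<close>, \<open>r1\<close>,
  \<open>r2\<close> as columns of a matrix of products. The minor on the columns \<open>b\<close>,
  \<open>r1\<close> follows from those on \<open>b\<close>, \<open>r2\<close> and on
  \<open>r1\<close>, \<open>r2\<close>; neither of the latter has a degree above the first, since
  one falls short at \<open>f\<close> and the other at \<open>e\<close>. The pieces \<open>p\<close>
  and \<open>r1\<close>, \<open>r2\<close> may overlap, so their products are given only as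
  multisets \<open>d1\<close>, \<open>d2\<close>.\<close>

lemma rigid_no_K23:
  assumes R: "rigid C" and anti: "\<And>c d. c \<in> C \<Longrightarrow> d \<in> C \<Longrightarrow> c \<subseteq> d \<Longrightarrow> c = d"
    and C: "a \<union> b \<in> C" "p \<union> b \<in> C" "a \<union> r1 \<in> C" "a \<union> r2 \<in> C"
    and disj: "a \<inter> b = {}" "p \<inter> b = {}" "a \<inter> r1 = {}" "a \<inter> r2 = {}"
    and ne: "a \<noteq> p" "r1 \<noteq> r2" and e: "e \<in> b" "e \<notin> r1" "e \<notin> r2"
    and D: "set_mset d1 \<subseteq> C" "set_mset d2 \<subseteq> C"
      "\<And>x. flow d1 x = of_bool (x \<in> p) + of_bool (x \<in> r1)"
      "\<And>x. flow d2 x = of_bool (x \<in> p) + of_bool (x \<in> r2)"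
  shows False
proof -
  have "a \<union> r1 \<noteq> a \<union> r2" using ne(2) disj by blast
  \<comment> \<open>By the antichain property distinct members are not contained in each other. The
    arc \<open>f\<close> is where the minor on \<open>b\<close>, \<open>r2\<close> falls
    short.\<close>
  then obtain f where f: "f \<in> r1" "f \<notin> r2" "f \<notin> a" using anti[OF C(3,4)] disj by blast
  have "add_mset (a \<union> b) d1 = {#p \<union> b, a \<union> r1#}"
  proof (rule rigidD[OF R C(2,3), where ?w1.0 = "{#p \<union> b, a \<union> r2#}" and ?w1' = "add_mset (a \<union> b) d2"
        and ?w2.0 = "add_mset (a \<union> r1) d2" and ?w2' = "add_mset (a \<union> r2) d1" and ?e1.0 = f and ?e2.0 = e])
    show "flow (add_mset (a \<union> b) d1) = flow {#p \<union> b, a \<union> r1#}"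
      "flow {#p \<union> b, a \<union> r2#} = flow (add_mset (a \<union> b) d2)"
      "flow (add_mset (a \<union> r1) d2) = flow (add_mset (a \<union> r2) d1)"
      by (simp_all add: fun_eq_iff D of_bool_Un disj del: Un_iff)
    show "flow {#p \<union> b, a \<union> r2#} f < flow {#p \<union> b, a \<union> r1#} f" using f by simp
    have "e \<notin> p" "e \<notin> a" using e disj by blast+
    then show "flow (add_mset (a \<union> r1) d2) e < flow {#p \<union> b, a \<union> r1#} e" using e by (simp add: D)
  qed (use C D in auto)
  from arg_cong[OF this, of set_mset] have "a \<union> b \<in> {p \<union> b, a \<union> r1}"
    unfolding set_mset_add_mset_insert set_mset_empty by (rule subst) (rule insertI1)
  moreover have "a \<union> b \<noteq> p \<union> b" using ne(1) disj Un_disjoint_cancel by metis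
  moreover have "e \<notin> a" using e disj by blast
  ultimately show False using e by blast
qed

text \<open>On the cube of the eight members, exchanging \<open>r1\<close> and \<open>r2\<close>
  between the opposite corners 111 and 222 is a combination of two exchanges inside faces: one in
  the face \<open>p1\<close>, whose degree lacks an arc of \<open>p2\<close>, and one in the face
  \<open>q2\<close>, whose degree lacks an arc of \<open>q1\<close>.\<close>

lemma rigid_no_K222:
  assumes R: "rigid C" and anti: "\<And>c d. c \<in> C \<Longrightarrow> d \<in> C \<Longrightarrow> c \<subseteq> d \<Longrightarrow> c = d"
    and C: "\<And>p q r. p \<in> {p1, p2} \<Longrightarrow> q \<in> {q1, q2} \<Longrightarrow> r \<in> {r1, r2} \<Longrightarrow> p \<union> q \<union> r \<in> C"
    and disj: "(p1 \<union> p2) \<inter> (q1 \<union> q2) = {}" "(p1 \<union> p2) \<inter> (r1 \<union> r2) = {}" "(q1 \<union> q2) \<inter> (r1 \<union> r2) = {}"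
    and ne: "p1 \<noteq> p2" "q1 \<noteq> q2" "r1 \<noteq> r2"
  shows False
proof -
  have Cs: "p1 \<union> q1 \<union> r1 \<in> C" "p2 \<union> q1 \<union> r1 \<in> C" "p1 \<union> q2 \<union> r1 \<in> C" "p2 \<union> q2 \<union> r1 \<in> C"
    "p1 \<union> q1 \<union> r2 \<in> C" "p2 \<union> q1 \<union> r2 \<in> C" "p1 \<union> q2 \<union> r2 \<in> C" "p2 \<union> q2 \<union> r2 \<in> C"
    by (rule C; simp)+
  have "p2 \<inter> (q1 \<union> r1) = {}" "p1 \<inter> (q1 \<union> r1) = {}" using disj by auto
  then have "p2 \<union> (q1 \<union> r1) \<noteq> p1 \<union> (q1 \<union> r1)" using ne Un_disjoint_cancel by metis
  then have "p2 \<union> q1 \<union> r1 \<noteq> p1 \<union> q1 \<union> r1" by (simp only: Un_ac not_False_eq_True)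
  then have "\<not> p2 \<union> q1 \<union> r1 \<subseteq> p1 \<union> q1 \<union> r1" using anti[OF Cs(2,1)] by blast
  then obtain f where f: "f \<in> p2" "f \<notin> p1" "f \<notin> q1" "f \<notin> r1" by blast
  have "q1 \<inter> (p1 \<union> r1) = {}" "q2 \<inter> (p1 \<union> r1) = {}" using disj by auto
  then have "q1 \<union> (p1 \<union> r1) \<noteq> q2 \<union> (p1 \<union> r1)" using ne Un_disjoint_cancel by metis
  then have "p1 \<union> q1 \<union> r1 \<noteq> p1 \<union> q2 \<union> r1" by (simp only: Un_ac not_False_eq_True)
  then have "\<not> p1 \<union> q1 \<union> r1 \<subseteq> p1 \<union> q2 \<union> r1" using anti[OF Cs(1,3)] by blast
  then obtain g where g: "g \<in> q1" "g \<notin> q2" "g \<notin> p1" "g \<notin> r1" by blast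
  have sp: "of_bool (x \<in> p \<union> q \<union> r) = (of_bool (x \<in> p) + of_bool (x \<in> q) + of_bool (x \<in> r) :: nat)"
    if "p \<in> {p1, p2}" "q \<in> {q1, q2}" "r \<in> {r1, r2}" for p q r x
  proof -
    have "p \<inter> q = {}" "(p \<union> q) \<inter> r = {}" using that disj by auto
    then show ?thesis by (simp add: of_bool_Un del: Un_iff)
  qed
  have "{#p1 \<union> q1 \<union> r2, p2 \<union> q2 \<union> r1#} = {#p1 \<union> q1 \<union> r1, p2 \<union> q2 \<union> r2#}"
  proof (rule rigidD[OF R Cs(1,8), where ?w1.0 = "{#p1 \<union> q1 \<union> r1, p1 \<union> q2 \<union> r2#}" and ?w1' = "{#p1 \<union> q1 \<union> r2, p1 \<union> q2 \<union> r1#}"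
        and ?w2.0 = "{#p2 \<union> q2 \<union> r2, p1 \<union> q2 \<union> r1#}" and ?w2' = "{#p1 \<union> q2 \<union> r2, p2 \<union> q2 \<union> r1#}" and ?e1.0 = f and ?e2.0 = g])
    show "flow {#p1 \<union> q1 \<union> r2, p2 \<union> q2 \<union> r1#} = flow {#p1 \<union> q1 \<union> r1, p2 \<union> q2 \<union> r2#}"
      "flow {#p1 \<union> q1 \<union> r1, p1 \<union> q2 \<union> r2#} = flow {#p1 \<union> q1 \<union> r2, p1 \<union> q2 \<union> r1#}"
      "flow {#p2 \<union> q2 \<union> r2, p1 \<union> q2 \<union> r1#} = flow {#p1 \<union> q2 \<union> r2, p2 \<union> q2 \<union> r1#}"
      by (simp_all add: fun_eq_iff sp del: Un_iff)
    show "flow {#p1 \<union> q1 \<union> r1, p1 \<union> q2 \<union> r2#} f < flow {#p1 \<union> q1 \<union> r1, p2 \<union> q2 \<union> r2#} f"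
      "flow {#p2 \<union> q2 \<union> r2, p1 \<union> q2 \<union> r1#} g < flow {#p1 \<union> q1 \<union> r1, p2 \<union> q2 \<union> r2#} g"
      using f g by (simp_all add: sp del: Un_iff)
  qed (use Cs in auto)
  from arg_cong[OF this, of set_mset] have "p1 \<union> q1 \<union> r2 \<in> {p1 \<union> q1 \<union> r1, p2 \<union> q2 \<union> r2}"
    unfolding set_mset_add_mset_insert set_mset_empty by (rule subst) (rule insertI1)
  moreover have "p1 \<union> q1 \<union> r2 \<noteq> p1 \<union> q1 \<union> r1"
  proof -
    have "r2 \<inter> (p1 \<union> q1) = {}" "r1 \<inter> (p1 \<union> q1) = {}" using disj by auto
    then have "r2 \<union> (p1 \<union> q1) \<noteq> r1 \<union> (p1 \<union> q1)" using ne Un_disjoint_cancel by metis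
    then show ?thesis by (simp only: Un_ac not_False_eq_True)
  qed
  moreover have "g \<notin> p2" "g \<notin> r2" using g(1) disj by auto
  ultimately show False using g by blast
qed

text \<open>
  The combinatorial shadow of a localisation: \<open>C'\<close> on the arcs \<open>A'\<close> arises from \<open>C\<close> by inverting
  the monomials of the members of \<open>C\<close> disjoint from \<open>A'\<close>.
\<close>

definition descends :: "'b set set \<Rightarrow> 'b set \<Rightarrow> 'b set set \<Rightarrow> bool" where
  "descends C A' C' \<longleftrightarrow> (\<forall>c\<in>C'. c \<subseteq> A' \<and> (\<exists>d\<in>C. d \<inter> A' = c))
    \<and> (\<forall>d\<in>C. \<exists>w. set_mset w \<subseteq> C' \<and> (\<forall>a. flow w a = of_bool (a \<in> d \<inter> A')))
    \<and> (\<forall>w w'. set_mset w \<subseteq> C \<and> set_mset w' \<subseteq> C \<and> (\<forall>a\<in>A'. flow w a = flow w' a) \<longrightarrow>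
        (\<exists>x x'. set_mset x \<subseteq> {d\<in>C. d \<inter> A' = {}} \<and> set_mset x' \<subseteq> {d\<in>C. d \<inter> A' = {}}
          \<and> flow (w + x) = flow (w' + x')))"

lemma descendsD:
  assumes "descends C A' C'"
  shows "c \<in> C' \<Longrightarrow> c \<subseteq> A'" and "c \<in> C' \<Longrightarrow> \<exists>d. d \<in> C \<and> d \<inter> A' = c"
    and "d \<in> C \<Longrightarrow> \<exists>w. set_mset w \<subseteq> C' \<and> (\<forall>a. flow w a = of_bool (a \<in> d \<inter> A'))"
    and "set_mset w \<subseteq> C \<Longrightarrow> set_mset w' \<subseteq> C \<Longrightarrow> \<forall>a\<in>A'. flow w a = flow w' a \<Longrightarrow>
      \<exists>x x'. set_mset x \<subseteq> {d\<in>C. d \<inter> A' = {}} \<and> set_mset x' \<subseteq> {d\<in>C. d \<inter> A' = {}}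
          \<and> flow (w + x) = flow (w' + x')"
  proof -
  show "c \<in> C' \<Longrightarrow> c \<subseteq> A'" "c \<in> C' \<Longrightarrow> \<exists>d. d \<in> C \<and> d \<inter> A' = c"
    using assms by (auto simp: descends_def)
  show "d \<in> C \<Longrightarrow> \<exists>w. set_mset w \<subseteq> C' \<and> (\<forall>a. flow w a = of_bool (a \<in> d \<inter> A'))"
    using assms by (simp add: descends_def)
  show "set_mset w \<subseteq> C \<Longrightarrow> set_mset w' \<subseteq> C \<Longrightarrow> \<forall>a\<in>A'. flow w a = flow w' a \<Longrightarrow>
      \<exists>x x'. set_mset x \<subseteq> {d\<in>C. d \<inter> A' = {}} \<and> set_mset x' \<subseteq> {d\<in>C. d \<inter> A' = {}}
          \<and> flow (w + x) = flow (w' + x')"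
    using assms unfolding descends_def by (elim conjE allE[where x = w] allE[where x = w'] impE) auto
qed

lemma flow_cong_lift:
  assumes "\<And>c. c \<in># w \<Longrightarrow> (\<forall>a\<in>A. flow (l c) a = of_bool (a \<in> c))" "a \<in> A"
  shows "flow (\<Sum>c\<in>#w. l c) a = flow w a"
  using assms by (induction w) (auto simp: flow_union)

lemma descends_refl:
  assumes "\<And>c. c \<in> C \<Longrightarrow> c \<subseteq> A" shows "descends C A C"
  unfolding descends_def
proof (intro conjI ballI allI impI)
  fix d assume "d \<in> C"
  then show "\<exists>w. set_mset w \<subseteq> C \<and> (\<forall>a. flow w a = of_bool (a \<in> d \<inter> A))"
    using assms by (intro exI[of _ "{#d#}"]) (auto simp: of_bool_def)
next
  fix w w' assume *: "set_mset w \<subseteq> C \<and> set_mset w' \<subseteq> C \<and> (\<forall>a\<in>A. flow w a = flow w' a)"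
  have "flow w a = flow w' a" for a
  proof (cases "a \<in> A")
    case False
    then have "\<not> flow w a > 0" "\<not> flow w' a > 0" using * assms unfolding flow_pos_iff by blast+
    then show ?thesis by simp
  qed (use * in auto)
  then show "\<exists>x x'. set_mset x \<subseteq> {d \<in> C. d \<inter> A = {}} \<and> set_mset x' \<subseteq> {d \<in> C. d \<inter> A = {}} \<and>
    flow (w + x) = flow (w' + x')" by (intro exI[of _ "{#}"]) auto
qed (use assms in auto)

text \<open>Localising twice is localising once: a member of \<open>C\<close> that misses
  \<open>A'\<close> also misses the smaller set \<open>A''\<close>, so all monomials inverted on the
  way are inverted in the end.\<close>

lemma descends_trans:
  assumes 1: "descends C A' C'" and 2: "descends C' A'' C''" and sub: "A'' \<subseteq> A'"
  shows "descends C A'' C''"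
proof -
  obtain l1 where l1: "\<And>c. c \<in> C' \<Longrightarrow> l1 c \<in> C \<and> l1 c \<inter> A' = c" using descendsD(2)[OF 1] by metis
  obtain d1 where d1: "\<And>d. d \<in> C \<Longrightarrow> set_mset (d1 d) \<subseteq> C' \<and> (\<forall>a. flow (d1 d) a = of_bool (a \<in> d \<inter> A'))"
    using descendsD(3)[OF 1] by metis
  obtain l2 where l2: "\<And>c. c \<in> C'' \<Longrightarrow> l2 c \<in> C' \<and> l2 c \<inter> A'' = c" using descendsD(2)[OF 2] by metis
  obtain d2 where d2: "\<And>d. d \<in> C' \<Longrightarrow> set_mset (d2 d) \<subseteq> C'' \<and> (\<forall>a. flow (d2 d) a = of_bool (a \<in> d \<inter> A''))"
    using descendsD(3)[OF 2] by metis
  show ?thesis unfolding descends_def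
  proof (intro conjI ballI allI impI)
    fix c assume c: "c \<in> C''"
    show "c \<subseteq> A''" using descendsD(1)[OF 2 c] .
    show "\<exists>d\<in>C. d \<inter> A'' = c" using l1[of "l2 c"] l2[OF c] sub by (intro bexI[of _ "l1 (l2 c)"]) auto
  next
    fix d assume d: "d \<in> C"
    define w where "w = (\<Sum>c\<in>#d1 d. d2 c)"
    have "flow w a = of_bool (a \<in> d \<inter> A'')" for a
    proof (cases "a \<in> A''")
      case True
      have "flow w a = flow (d1 d) a" unfolding w_def
        using d2 d1[OF d] True by (intro flow_cong_lift[of _ A'']) auto
      then show ?thesis using d1[OF d] True sub by auto
    next
      case False
      have "\<not> flow w a > 0" unfolding flow_pos_iff w_def set_mset_sum_image
      proof clarsimp
        fix x y assume xy: "x \<in># d1 d" "y \<in># d2 x" "a \<in> y"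
        then have "flow (d2 x) a > 0" unfolding flow_pos_iff by blast
        moreover have "x \<in> C'" using xy d1[OF d] by auto
        ultimately show False using d2 False by simp
      qed
      then show ?thesis using False by simp
    qed
    moreover have "set_mset w \<subseteq> C''" using d1[OF d] d2 by (fastforce simp: w_def set_mset_sum_image)
    ultimately show "\<exists>w. set_mset w \<subseteq> C'' \<and> (\<forall>a. flow w a = of_bool (a \<in> d \<inter> A''))" by blast
  next
    fix w w' assume w: "set_mset w \<subseteq> C \<and> set_mset w' \<subseteq> C \<and> (\<forall>a\<in>A''. flow w a = flow w' a)"
    \<comment> \<open>Both sides are pushed down to \<open>C'\<close> and equalised there over
      \<open>A''\<close>; the correcting factors are lifted back by \<open>l1\<close>. The results
      agree on all of \<open>A'\<close>, so the first descent equalises them in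
      \<open>C\<close>.\<close>
    define W where "W v = (\<Sum>c\<in>#v. d1 c)" for v
    have W: "set_mset (W v) \<subseteq> C'" "\<And>a. a \<in> A' \<Longrightarrow> flow (W v) a = flow v a" if "set_mset v \<subseteq> C" for v
    proof -
      show "set_mset (W v) \<subseteq> C'" using that d1 by (fastforce simp: W_def set_mset_sum_image)
      show "flow (W v) a = flow v a" if "a \<in> A'" for a unfolding W_def
        by (rule flow_cong_lift[of _ A']) (use that d1 \<open>set_mset v \<subseteq> C\<close> in auto)
    qed
    have eqW: "flow (W w) a = flow (W w') a" if "a \<in> A''" for a using w W sub that by auto
    have "\<exists>x x'. set_mset x \<subseteq> {d \<in> C'. d \<inter> A'' = {}} \<and> set_mset x' \<subseteq> {d \<in> C'. d \<inter> A'' = {}} \<and>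
      flow (W w + x) = flow (W w' + x')"
      using w by (intro descendsD(4)[OF 2]) (simp_all add: W(1) eqW)
    then obtain x x' where x: "set_mset x \<subseteq> {d \<in> C'. d \<inter> A'' = {}}" "set_mset x' \<subseteq> {d \<in> C'. d \<inter> A'' = {}}"
      "flow (W w + x) = flow (W w' + x')" by (elim exE conjE) (rule that)
    define X where "X = image_mset l1"
    have X: "set_mset (X y) \<subseteq> {d\<in>C. d \<inter> A'' = {}}" "\<And>a. a \<in> A' \<Longrightarrow> flow (X y) a = flow y a"
      if "set_mset y \<subseteq> {d \<in> C'. d \<inter> A'' = {}}" for y
    proof -
      show "set_mset (X y) \<subseteq> {d\<in>C. d \<inter> A'' = {}}" using that l1 sub by (fastforce simp: X_def)
      show "flow (X y) a = flow y a" if "a \<in> A'" for a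
        using \<open>set_mset y \<subseteq> _\<close> unfolding X_def
      proof (induction y)
        case (add c y)
        have "a \<in> l1 c \<longleftrightarrow> a \<in> c" using add.prems l1[of c] that by auto
        then show ?case using add by simp
      qed simp
    qed
    have "set_mset (w + X x) \<subseteq> C \<and> set_mset (w' + X x') \<subseteq> C \<and> (\<forall>a\<in>A'. flow (w + X x) a = flow (w' + X x') a)"
    proof (intro conjI ballI)
      fix a assume "a \<in> A'"
      then show "flow (w + X x) a = flow (w' + X x') a"
        using fun_cong[OF x(3), of a] W w X x(1,2) by (simp add: flow_union)
    qed (use w X(1)[OF x(1)] X(1)[OF x(2)] in auto)
    note wX = this
    from descendsD(4)[OF 1 wX[THEN conjunct1] wX[THEN conjunct2, THEN conjunct1] wX[THEN conjunct2, THEN conjunct2]] obtain y y' where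
      y: "set_mset y \<subseteq> {d \<in> C. d \<inter> A' = {}}" "set_mset y' \<subseteq> {d \<in> C. d \<inter> A' = {}}"
      "flow (w + X x + y) = flow (w' + X x' + y')" by (elim exE conjE) (rule that)
    have "{d \<in> C. d \<inter> A' = {}} \<subseteq> {d \<in> C. d \<inter> A'' = {}}" using sub by auto
    then have "set_mset (X x + y) \<subseteq> {d \<in> C. d \<inter> A'' = {}}" "set_mset (X x' + y') \<subseteq> {d \<in> C. d \<inter> A'' = {}}"
      using y(1,2) X(1)[OF x(1)] X(1)[OF x(2)] by (simp_all only: set_mset_union Un_subset_iff) (meson subset_trans)+
    then show "\<exists>x x'. set_mset x \<subseteq> {d \<in> C. d \<inter> A'' = {}} \<and> set_mset x' \<subseteq> {d \<in> C. d \<inter> A'' = {}} \<and>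
      flow (w + x) = flow (w' + x')"
      using y(3) by (intro exI[of _ "X x + y"] exI[of _ "X x' + y'"]) (simp add: add.assoc)
  qed
qed

section \<open>Merging strongly connected subquivers\<close>

text \<open>Contraction of \<open>K\<close> to a vertex named \<open>k\<close>. Arcs keep their
  names and those inside \<open>K\<close> disappear, so cycles of the contraction are sets of arcs
  of \<open>G\<close> and can be compared with traces of cycles of \<open>G\<close>.\<close>

definition merge :: "('v, 'b) pre_digraph \<Rightarrow> 'v set \<Rightarrow> 'v \<Rightarrow> ('v, 'b) pre_digraph" where
  "merge G K k = \<lparr>verts = insert k (verts G - K), arcs = {a \<in> arcs G. \<not> (tail G a \<in> K \<and> head G a \<in> K)},
     tail = (\<lambda>a. if tail G a \<in> K then k else tail G a), head = (\<lambda>a. if head G a \<in> K then k else head G a)\<rparr>"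

lemma merge_simps [simp]:
  "verts (merge G K k) = insert k (verts G - K)"
  "arcs (merge G K k) = {a \<in> arcs G. \<not> (tail G a \<in> K \<and> head G a \<in> K)}"
  "tail (merge G K k) a = (if tail G a \<in> K then k else tail G a)"
  "head (merge G K k) a = (if head G a \<in> K then k else head G a)"
  by (simp_all add: merge_def)

locale merging = fin_digraph G for G :: "('v, 'b) pre_digraph" +
  fixes K :: "'v set" and k :: 'v
  assumes K: "K \<subseteq> verts G" "k \<in> K"
begin

abbreviation "M \<equiv> merge G K k"

sublocale M: fin_digraph M
  by unfold_locales (use K in auto)

lemma merge_strongly_connected:
  assumes "strongly_connected G" shows "strongly_connected M"
proof -
  let ?f = "\<lambda>v. if v \<in> K then k else v"
  have arc: "?f u \<rightarrow>\<^sup>*\<^bsub>M\<^esub> ?f v" if uv: "u \<rightarrow>\<^bsub>G\<^esub> v" for u v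
  proof -
    obtain a where a: "a \<in> arcs G" "tail G a = u" "head G a = v" using uv by (elim reachableE)
    show ?thesis
    proof (cases "u \<in> K \<and> v \<in> K")
      case True
      then show ?thesis by (auto intro!: M.reachable_refl)
    next
      case False
      then have "a \<in> arcs M" "tail M a = ?f u" "head M a = ?f v" using a by auto
      then have "?f u \<rightarrow>\<^bsub>M\<^esub> ?f v" using M.in_arcs_imp_in_arcs_ends[of a] by simp
      then show ?thesis by (rule M.reachable_adjI)
    qed
  qed
  have reach: "?f u \<rightarrow>\<^sup>*\<^bsub>M\<^esub> ?f v" if "u \<rightarrow>\<^sup>*\<^bsub>G\<^esub> v" for u v
    using that
  proof (induction rule: reachable_induct)
    case base
    then show ?case using K by (auto intro!: M.reachable_refl)
  next
    case (step x y)
    show ?case by (rule M.reachable_trans[OF step.IH arc[OF step.hyps(2)]])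
  qed
  have "u \<rightarrow>\<^sup>*\<^bsub>M\<^esub> v" if "u \<in> verts M" "v \<in> verts M" for u v
  proof -
    have "?f u = u" "?f v = v" "u \<in> verts G" "v \<in> verts G" using that K by auto
    then show ?thesis using reach[of u v] assms by auto
  qed
  then show ?thesis by auto
qed

text \<open>At the merged vertex, conservation is the sum of the conservation laws over
  \<open>K\<close>: the arcs inside \<open>K\<close> occur on both sides and cancel.\<close>

lemma merge_circulation:
  assumes f: "circulation G f"
  shows "circulation M (\<lambda>a. if a \<in> arcs M then f a else 0)"
  unfolding circulation_def
proof (intro conjI ballI allI impI)
  fix v assume v: "v \<in> verts M"
  let ?g = "\<lambda>a. if a \<in> arcs M then f a else 0"
  show "sum ?g (in_arcs M v) = sum ?g (out_arcs M v)"
  proof (cases "v = k")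
    case False
    then have "in_arcs M v = in_arcs G v" "out_arcs M v = out_arcs G v" "v \<in> verts G" using v by auto
    moreover have "sum ?g (in_arcs M v) = sum f (in_arcs M v)" "sum ?g (out_arcs M v) = sum f (out_arcs M v)"
      by (rule sum.cong; simp)+
    ultimately show ?thesis using f by (simp add: circulation_def)
  next
    case True
    let ?I = "{a \<in> arcs G. tail G a \<in> K \<and> head G a \<in> K}"
    have fK: "finite K" by (rule finite_subset[OF K(1) finite_verts])
    have i: "{a \<in> arcs G. head G a \<in> K} = in_arcs M v \<union> ?I" "in_arcs M v \<inter> ?I = {}"
      using True K v by (auto split: if_splits)
    have o: "{a \<in> arcs G. tail G a \<in> K} = out_arcs M v \<union> ?I" "out_arcs M v \<inter> ?I = {}"
      using True K v by (auto split: if_splits)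
    have U: "{a \<in> arcs G. head G a \<in> K} = (\<Union>x\<in>K. in_arcs G x)" "{a \<in> arcs G. tail G a \<in> K} = (\<Union>x\<in>K. out_arcs G x)" by auto
    have "sum f {a \<in> arcs G. head G a \<in> K} = (\<Sum>x\<in>K. sum f (in_arcs G x))"
      "sum f {a \<in> arcs G. tail G a \<in> K} = (\<Sum>x\<in>K. sum f (out_arcs G x))"
      unfolding U by (rule sum.UNION_disjoint[OF fK]; auto)+
    moreover have "(\<Sum>x\<in>K. sum f (in_arcs G x)) = (\<Sum>x\<in>K. sum f (out_arcs G x))"
      by (rule sum.cong[OF refl]) (use f K(1) in \<open>auto simp: circulation_def\<close>)
    moreover have "sum f {a \<in> arcs G. head G a \<in> K} = sum f (in_arcs M v) + sum f ?I"
      "sum f {a \<in> arcs G. tail G a \<in> K} = sum f (out_arcs M v) + sum f ?I"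
      unfolding i(1) o(1) by (rule sum.union_disjoint; use i(2) o(2) in auto)+
    moreover have "sum ?g (in_arcs M v) = sum f (in_arcs M v)" "sum ?g (out_arcs M v) = sum f (out_arcs M v)"
      by (rule sum.cong; simp)+
    ultimately show ?thesis by simp
  qed
qed auto

text \<open>Every passage of a cycle through the merged vertex can be completed inside \<open>K\<close>.\<close>

lemma merge_descends:
  assumes link: "\<And>a b. a \<in> arcs M \<Longrightarrow> b \<in> arcs M \<Longrightarrow> head G a \<in> K \<Longrightarrow> tail G b \<in> K \<Longrightarrow>
      \<exists>r. apath (head G a) r (tail G b) \<and> set (awalk_verts (head G a) r) \<subseteq> K"
    and inner: "\<And>w w'. set_mset w \<subseteq> cycs G \<Longrightarrow> set_mset w' \<subseteq> cycs G \<Longrightarrow> (\<forall>a\<in>arcs M. flow w a = flow w' a) \<Longrightarrow>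
      \<exists>x x'. set_mset x \<subseteq> {d\<in>cycs G. d \<inter> arcs M = {}} \<and> set_mset x' \<subseteq> {d\<in>cycs G. d \<inter> arcs M = {}}
          \<and> flow (w + x) = flow (w' + x')"
  shows "descends (cycs G) (arcs M) (cycs M)"
  unfolding descends_def
proof (intro conjI ballI allI impI)
  fix c assume c: "c \<in> cycs M"
  show "c \<subseteq> arcs M" using M.cycs_sub(1)[OF c] .
  obtain p where p: "M.cycle p" "c = set p" using c by (auto simp: cycs_def)
  \<comment> \<open>A walk that never enters \<open>k\<close> has unchanged heads, so it lifts arc
    by arc.\<close>
  have lift: "awalk u s v" if "M.awalk u s v" "u \<noteq> k" "u \<in> verts G" "k \<notin> set (map (head M) s)" for u s v
    using that
  proof (induction s arbitrary: u)
    case Nil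
    then show ?case by (auto simp: awalk_Nil_iff M.awalk_Nil_iff)
  next
    case (Cons e s)
    then show ?case by (auto simp: awalk_Cons_iff M.awalk_Cons_iff split: if_splits)
  qed
  show "\<exists>d\<in>cycs G. d \<inter> arcs M = c"
  proof (cases "k \<in> head M ` c")
    case False
    obtain u where u: "M.awalk u p u" "distinct (map (head M) p)" "p \<noteq> []" using p by (auto simp: M.cycle_iff)
    have hp: "map (head M) p = map (head G) p" using False p(2) K by (auto split: if_splits)
    have "u \<in> set (map (head M) p)" using u(1,3)
      by (metis M.awalk_tails_heads M.cycle_heads hd_append hd_map list.map_disc_iff list.sel(1) list.set_map hd_in_set p(1))
    then have "u \<noteq> k" "u \<in> verts M" using False p(2) u(1) by (auto dest: M.awalk_hd_in_verts)
    then have "awalk u p u" using lift[OF u(1)] False p(2) by auto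
    then have "cycle p" unfolding cycle_iff using u hp by auto
    moreover have "set p \<subseteq> arcs M" using M.cycle_arcs_sub[OF p(1)] by simp
    ultimately show ?thesis using p(2) by (intro bexI[of _ "set p"]) (auto simp: cycs_def)
  next
    case True
    then have "k \<in> tail M ` c" using M.cycle_heads[OF p(1)] p(2) by auto
    then obtain b where b: "b \<in> set p" "tail M b = k" using p(2) by auto
    obtain r where r: "M.apath (head M b) r (tail M b)" "b \<notin> set r" "set p = insert b (set r)"
      using M.cycle_split[OF p(1) b(1)] by metis
    have bM: "b \<in> arcs M" using b(1) M.cycle_arcs_sub[OF p(1)] by auto
    then have tb: "tail G b \<in> K" using b(2) K by (auto split: if_splits)
    then have hb: "head G b \<notin> K" "head M b = head G b" using bM by auto
    have rne: "r \<noteq> []" using r(1) hb b(2) K by (auto simp: M.apath_Nil_iff)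
    \<comment> \<open>The cycle enters the merged vertex by \<open>a\<close> and leaves it by
      \<open>b\<close>. It is opened there and closed again by a path inside \<open>K\<close>, whose
      arcs vanish in the contraction.\<close>
    define a s where "a = last r" and "s = butlast r"
    have rs: "r = s @ [a]" using rne by (simp add: a_def s_def)
    have w: "M.awalk (head M b) s (tail M a)" "a \<in> arcs M" "head M a = k"
      using r(1) b(2) unfolding rs M.apath_iff by (auto simp: M.awalk_simps)
    have dr: "distinct (map (head M) (b # r))" using r(1) unfolding M.apath_iff by simp
    have ks: "k \<notin> set (map (head M) s)" using dr w(3) unfolding rs by auto
    have "head M b \<noteq> k" "head M b \<in> verts G" using hb K bM by auto
    from lift[OF w(1) this ks] have aw: "awalk (head G b) s (tail M a)" unfolding hb(2) .
    have ha: "head G a \<in> K" using w(2,3) K by (auto split: if_splits)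
    then have ta: "tail G a \<notin> K" "tail M a = tail G a" using w(2) by auto
    obtain t where t: "apath (head G a) t (tail G b)" "set (awalk_verts (head G a) t) \<subseteq> K"
      using link[OF w(2) bM ha tb] by blast
    have tw: "awalk (head G a) t (tail G b)" using t(1) by (rule awalkI_apath)
    have hs: "map (head M) s = map (head G) s" using ks K by (auto split: if_splits)
    have "awalk (head G b) (s @ a # t) (tail G b)"
      using aw ta tw w(2) by (intro awalk_appendI[OF aw]) (auto simp: awalk_Cons_iff)
    moreover have "distinct (map (head G) (b # s @ a # t))"
    proof -
      have "distinct (map (head G) (b # s))" using dr hb hs unfolding rs by simp
      moreover have "distinct (map (head G) (a # t))" using t(1) unfolding apath_iff by simp
      moreover have "set (map (head G) (a # t)) \<subseteq> K" using t(2) unfolding awalk_verts_eq[OF tw] by simp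
      moreover have "set (map (head G) (b # s)) \<inter> K = {}"
      proof -
        have "head G x \<notin> K" if "x \<in> set s" for x
          using that ks by (auto split: if_splits)
        then show ?thesis using hb by auto
      qed
      ultimately have "distinct (map (head G) (b # s) @ map (head G) (a # t))" unfolding distinct_append by blast
      then show ?thesis by simp
    qed
    ultimately have "cycle (b # s @ a # t)" using bM hb
      by (intro cycle_ConsI) (auto simp: apath_iff)
    moreover have "set (b # s @ a # t) \<inter> arcs M = c"
    proof -
      have "x \<notin> arcs M" if "x \<in> set t" for x
      proof -
        have "tail G x \<in> K" "head G x \<in> K"
          using that t(2) awalk_verts_arc1[of x t] awalk_verts_arc2[OF tw that] by auto
        then show ?thesis by simp
      qed
      moreover have "set (b # s @ [a]) = c" using r(3) p(2) unfolding rs by auto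
      moreover have "c \<subseteq> arcs M" using M.cycs_sub(1)[OF c] .
      ultimately show ?thesis by auto
    qed
    moreover from calculation(1) have "set (b # s @ a # t) \<in> cycs G" unfolding cycs_def by blast
    ultimately show ?thesis by blast
  qed
next
  fix d assume "d \<in> cycs G"
  from merge_circulation[OF circulation_cycle[OF this]]
  have c: "circulation M (\<lambda>a. of_bool (a \<in> d \<inter> arcs M))"
    by (rule back_subst[of "circulation M"]) auto
  from M.circulation_decomp[OF this] obtain w where "set_mset w \<subseteq> cycs M" "flow w = (\<lambda>a. of_bool (a \<in> d \<inter> arcs M))"
    by metis
  then show "\<exists>w. set_mset w \<subseteq> cycs M \<and> (\<forall>a. flow w a = of_bool (a \<in> d \<inter> arcs M))"
    by (intro exI[of _ w]) simp
qed (use inner in blast)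


text \<open>Any two vertices of a cycle are joined along it, so every arc inside \<open>K\<close>,
  chords included, lies on a cycle inside \<open>K\<close>. Adding enough of these to
  \<open>w'\<close> dominates the flow of \<open>w\<close>; the difference is a circulation that
  vanishes on the remaining arcs, hence a sum of inverted cycles.\<close>

lemma merge_cycle_descends:
  assumes p: "cycle p" and Kp: "K = tail G ` set p"
  shows "descends (cycs G) (arcs M) (cycs M)"
proof -
  have path: "\<exists>r. apath u r v \<and> set (awalk_verts u r) \<subseteq> K" if uK: "u \<in> K" and vK: "v \<in> K" for u v
  proof -
    obtain e where e: "e \<in> set p" "head G e = u" using uK cycle_heads[OF p] unfolding Kp by force
    obtain r where r: "apath u r (tail G e)" "set p = insert e (set r)"
      using cycle_split[OF p e(1)] e(2) by metis
    have vs: "set (awalk_verts u r) = K"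
    proof -
      have "set (awalk_verts u r) = insert u (head G ` set r)"
        using awalk_verts_eq[OF awalkI_apath[OF r(1)]] by simp
      also have "\<dots> = head G ` set p" using e r(2) by auto
      finally show ?thesis using cycle_heads[OF p] Kp by simp
    qed
    then obtain q s where q: "r = q @ s" "awalk u q v" "awalk v s (tail G e)"
      using awalk_decomp[OF awalkI_apath[OF r(1)], of v] vK by auto
    have "apath u q v" using r(1) q(2) unfolding q(1) apath_iff by auto
    moreover have "set (awalk_verts u q) \<subseteq> K"
      using vs set_awalk_verts_append[OF q(2,3)] q(1) by auto
    ultimately show ?thesis by blast
  qed
  show ?thesis
  proof (rule merge_descends)
    fix a b assume "head G a \<in> K" "tail G b \<in> K"
    then show "\<exists>r. apath (head G a) r (tail G b) \<and> set (awalk_verts (head G a) r) \<subseteq> K" by (rule path)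
  next
    fix w w' assume w: "set_mset w \<subseteq> cycs G" "set_mset w' \<subseteq> cycs G" "\<forall>a\<in>arcs M. flow w a = flow w' a"
    define I where "I = arcs G - arcs M"
    have fI: "finite I" by (simp add: I_def)
    have "\<exists>c\<in>cycs G. a \<in> c \<and> c \<inter> arcs M = {}" if a: "a \<in> I" for a
    proof -
      have aK: "a \<in> arcs G" "tail G a \<in> K" "head G a \<in> K" using a by (auto simp: I_def)
      then obtain r where r: "apath (head G a) r (tail G a)" "set (awalk_verts (head G a) r) \<subseteq> K" using path by metis
      have "cycle (a # r)" using aK(1) r(1) by (rule cycle_ConsI)
      moreover have "x \<notin> arcs M" if "x \<in> set r" for x
        using that r(2) awalk_verts_arc1[of x r] awalk_verts_arc2[OF awalkI_apath[OF r(1)] that] by auto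
      moreover from calculation(1) have "set (a # r) \<in> cycs G" unfolding cycs_def by blast
      ultimately show ?thesis using aK by (intro bexI[of _ "set (a # r)"]) auto
    qed
    then obtain c where c: "\<And>a. a \<in> I \<Longrightarrow> c a \<in> cycs G \<and> a \<in> c a \<and> c a \<inter> arcs M = {}" by metis
    \<comment> \<open>As many copies of \<open>c a\<close> as \<open>w\<close> has flow on
      \<open>a\<close>, so that the subtraction below stays nonnegative.\<close>
    define Z where "Z = (\<Sum>a\<in>#mset_set I. replicate_mset (flow w a) (c a))"
    have Z: "set_mset Z \<subseteq> {d\<in>cycs G. d \<inter> arcs M = {}}"
      using c fI by (auto simp: Z_def set_mset_sum_image split: if_splits)
    have fr: "flow (replicate_mset n d) a = n * of_bool (a \<in> d)" for n d a
      by (induction n) auto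
    have le: "flow w a \<le> flow w' a + flow Z a" for a
    proof (cases "a \<in> I")
      case True
      have "flow Z a = (\<Sum>b\<in>I. flow w b * of_bool (a \<in> c b))"
        unfolding Z_def flow_image_mset fr by (simp add: sum_unfold_sum_mset)
      also have "\<dots> \<ge> flow w a * of_bool (a \<in> c a)"
        using fI True by (intro member_le_sum) auto
      finally show ?thesis using c[OF True] by simp
    next
      case False
      show ?thesis
      proof (cases "a \<in> arcs M")
        case True
        then show ?thesis using w(3) by simp
      next
        case False
        then have "a \<notin> arcs G" using \<open>a \<notin> I\<close> by (simp add: I_def)
        then show ?thesis using circulation_flow[OF w(1)] by (simp add: circulation_def)
      qed
    qed
    have "circulation G (\<lambda>a. flow w' a + flow Z a - flow w a)"
      using circulation_diff[OF circulation_add[OF circulation_flow[OF w(2)] circulation_flow[of Z]] circulation_flow[OF w(1)]] le Z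
      by blast
    then obtain x where x: "set_mset x \<subseteq> cycs G" "flow x = (\<lambda>a. flow w' a + flow Z a - flow w a)"
      using circulation_decomp by metis
    have "d \<inter> arcs M = {}" if "d \<in># x" for d
    proof (rule ccontr)
      assume "d \<inter> arcs M \<noteq> {}"
      then obtain a where a: "a \<in> d" "a \<in> arcs M" by blast
      then have "flow x a > 0" using that flow_pos_iff by metis
      moreover have "\<not> flow Z a > 0" using a(2) Z unfolding flow_pos_iff by blast
      ultimately show False using x(2) w(3) a(2) by simp
    qed
    moreover have "flow (w + x) = flow (w' + Z)" using le by (simp add: fun_eq_iff flow_union x(2))
    ultimately show "\<exists>x x'. set_mset x \<subseteq> {d\<in>cycs G. d \<inter> arcs M = {}} \<and> set_mset x' \<subseteq> {d\<in>cycs G. d \<inter> arcs M = {}}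
          \<and> flow (w + x) = flow (w' + x')"
      using x(1) Z by (intro exI[of _ x] exI[of _ Z]) auto
  qed
qed

text \<open>Here \<open>K\<close> contains no cycle, so nothing can be used as a correcting factor.
  Instead conservation at \<open>h\<close> determines the flow on \<open>e\<close> from the other
  arcs at \<open>h\<close>: agreement outside \<open>e\<close> is agreement everywhere.\<close>

lemma merge_single_arc_descends:
  assumes hK: "K = {h, x}" "h \<noteq> x" and inner: "arcs G - arcs M = {e}"
    and e: "out_arcs G h = {e} \<and> head G e = x \<or> in_arcs G h = {e} \<and> tail G e = x"
  shows "descends (cycs G) (arcs M) (cycs M)"
proof (rule merge_descends)
  have hx: "h \<in> verts G" "x \<in> verts G" using K(1) hK(1) by auto
  fix a b assume ab: "a \<in> arcs M" "b \<in> arcs M" "head G a \<in> K" "tail G b \<in> K"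
  from e show "\<exists>r. apath (head G a) r (tail G b) \<and> set (awalk_verts (head G a) r) \<subseteq> K"
  proof (elim disjE conjE)
    assume o: "out_arcs G h = {e}" "head G e = x"
    then have e': "e \<in> arcs G" "tail G e = h" by auto
    have "b \<noteq> e" "b \<in> arcs G" using ab inner by auto
    \<comment> \<open>As \<open>e\<close> is the only arc out of \<open>h\<close>, the next arc of
      the cycle starts at \<open>x\<close>: an entry at \<open>h\<close> is completed by
      \<open>e\<close>, an entry at \<open>x\<close> by the empty path.\<close>
    then have "tail G b = x" using ab(4) o hK by (metis insertE in_out_arcs_conv singletonD)
    moreover have "apath h [e] x" using e' o(2) hK(2) hx by (auto simp: apath_simps)
    moreover have "apath x [] x" using hx by (simp add: apath_simps)
    moreover have "awalk_verts h [e] = [h, x]" using e' o by simp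
    ultimately show ?thesis using ab(3) hK(1)
      by (metis awalk_verts.simps(1) empty_set insertE insert_subset list.simps(15) order_refl singletonD subset_insertI)
  next
    assume o: "in_arcs G h = {e}" "tail G e = x"
    then have e': "e \<in> arcs G" "head G e = h" by auto
    have "a \<noteq> e" "a \<in> arcs G" using ab inner by auto
    then have "head G a = x" using ab(3) o hK by (metis insertE in_in_arcs_conv singletonD)
    moreover have "apath x [e] h" using e' o(2) hK(2) hx by (auto simp: apath_simps)
    moreover have "apath x [] x" using hx by (simp add: apath_simps)
    moreover have "awalk_verts x [e] = [x, h]" using e' o by simp
    ultimately show ?thesis using ab(4) hK(1)
      by (metis awalk_verts.simps(1) empty_set insertE insert_subset list.simps(15) order_refl singletonD subset_insertI)
  qed
next
  have hx: "h \<in> verts G" using K(1) hK(1) by auto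
  fix w w' assume w: "set_mset w \<subseteq> cycs G" "set_mset w' \<subseteq> cycs G" "\<forall>a\<in>arcs M. flow w a = flow w' a"
  have c: "circulation G (flow w)" "circulation G (flow w')" using w by (auto intro: circulation_flow)
  have "flow w e = flow w' e"
    using e
  proof (elim disjE conjE)
    assume o: "out_arcs G h = {e}" "head G e = x"
    then have "in_arcs G h \<subseteq> arcs M" using inner hK(2) by auto
    then have "sum (flow w) (in_arcs G h) = sum (flow w') (in_arcs G h)" using w(3) by (intro sum.cong) auto
    then show ?thesis using c hx o by (simp add: circulation_def)
  next
    assume o: "in_arcs G h = {e}" "tail G e = x"
    then have "out_arcs G h \<subseteq> arcs M" using inner hK(2) by auto
    then have "sum (flow w) (out_arcs G h) = sum (flow w') (out_arcs G h)" using w(3) by (intro sum.cong) auto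
    moreover have "sum (flow w) (in_arcs G h) = sum (flow w) (out_arcs G h)"
      "sum (flow w') (in_arcs G h) = sum (flow w') (out_arcs G h)"
      using c hx unfolding circulation_def by blast+
    ultimately show ?thesis using o by simp
  qed
  have "flow w a = flow w' a" for a
  proof -
    consider "a \<in> arcs M" | "a = e" | "a \<notin> arcs G" using inner by blast
    then show ?thesis
      using w(3) \<open>flow w e = flow w' e\<close> c unfolding circulation_def by cases auto
  qed
  then show "\<exists>x x'. set_mset x \<subseteq> {d\<in>cycs G. d \<inter> arcs M = {}} \<and> set_mset x' \<subseteq> {d\<in>cycs G. d \<inter> arcs M = {}}
          \<and> flow (w + x) = flow (w' + x')"
    by (intro exI[of _ "{#}"]) auto
qed

end

section \<open>Generators of toric ideals\<close>

interpretation fv: vector_space "(\<lambda>c f x. c * f x) :: 'f::field \<Rightarrow> ('x \<Rightarrow> 'f) \<Rightarrow> 'x \<Rightarrow> 'f"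
  by unfold_locales (auto simp: fun_eq_iff algebra_simps)

lemma sum_fun_eval: "(\<Sum>i\<in>A. f i) x = (\<Sum>i\<in>A. (f i x :: 'f::comm_monoid_add))"
  by (induction A rule: infinite_finite_induct) auto

text \<open>A family whose values at the points \<open>p j\<close> form a diagonal matrix with
  nonzero entries is independent. It serves both sides of the comparison of dimensions: the count of
  generators and the count of relations.\<close>

lemma card_le_of_diagonal:
  fixes y :: "'j \<Rightarrow> 'x \<Rightarrow> 'f::field"
  assumes S: "finite S" and y: "\<And>j. j \<in> J \<Longrightarrow> y j \<in> fv.span S"
    and d: "\<And>j. j \<in> J \<Longrightarrow> y j (p j) \<noteq> 0" and o: "\<And>i j. i \<in> J \<Longrightarrow> j \<in> J \<Longrightarrow> i \<noteq> j \<Longrightarrow> y i (p j) = 0"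
  shows "finite J \<and> card J \<le> card S"
proof -
  have inj: "inj_on y J" using d o by (metis inj_onI)
  have "fv.independent (y ` J)"
    unfolding fv.independent_explicit_module
  proof (intro allI impI)
    fix t u v assume t: "finite t" "t \<subseteq> y ` J" "(\<Sum>v\<in>t. (\<lambda>x. u v * v x)) = 0" "v \<in> t"
    obtain j where j: "j \<in> J" "v = y j" using t by auto
    have "0 = (\<Sum>v\<in>t. u v * v (p j))" using fun_cong[OF t(3), of "p j"] by (simp add: sum_fun_eval)
    also have "\<dots> = (\<Sum>v\<in>{v}. u v * v (p j))"
      using t j o by (intro sum.mono_neutral_right) auto
    finally show "u v = 0" using d[OF j(1)] j by simp
  qed
  from fv.independent_span_bound[OF S this] y have "finite (y ` J)" "card (y ` J) \<le> card S" by auto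
  then show ?thesis using inj finite_imageD card_image by metis
qed

section \<open>Polynomial rings and their ideals inside a monoid algebra\<close>

lemma poly_mapping_expand: "p = (\<Sum>m\<in>Poly_Mapping.keys p. Poly_Mapping.single m (Poly_Mapping.lookup p m))"
  by (rule poly_mapping_eqI)
    (auto simp: lookup_sum lookup_single when_def in_keys_iff sum.delta')

lemma keys_add_nat: "Poly_Mapping.keys (m + n) = Poly_Mapping.keys m \<union> Poly_Mapping.keys (n :: 'x \<Rightarrow>\<^sub>0 nat)"
  by (auto simp: in_keys_iff lookup_add)

lemma vars_add: "vars (p + q) \<subseteq> vars p \<union> vars q"
  using keys_add[of p q] unfolding vars_def by blast

lemma vars_mult: "vars (p * q) \<subseteq> vars p \<union> vars (q :: ('x, 'k::comm_ring_1) mpoly)"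
  using keys_mult[of p q] unfolding vars_def by (fastforce simp: keys_add_nat)

lemma vars_uminus: "vars (- p) = vars (p :: ('x, 'k::comm_ring_1) mpoly)"
  unfolding vars_def by (simp add: in_keys_iff Poly_Mapping.keys.rep_eq)

lemma vars_single: "vars (Poly_Mapping.single m c) \<subseteq> Poly_Mapping.keys m"
  by (auto simp: vars_def)

lemma vars_one: "vars (1 :: ('x, 'k::comm_ring_1) mpoly) = {}"
  by (simp add: vars_def)

lemma cring_of_closed:
  fixes U :: "'r::comm_ring_1 set"
  assumes U: "0 \<in> U" "1 \<in> U" "\<And>x y. x \<in> U \<Longrightarrow> y \<in> U \<Longrightarrow> x + y \<in> U" "\<And>x y. x \<in> U \<Longrightarrow> y \<in> U \<Longrightarrow> x * y \<in> U"
    "\<And>x. x \<in> U \<Longrightarrow> - x \<in> U"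
    and R: "R = \<lparr>carrier = U, mult = (*), one = 1, ring.zero = 0, add = (+)\<rparr>"
  shows "cring R"
proof (rule cringI)
  have "\<exists>y\<in>U. y + x = 0" if "x \<in> U" for x using U(5)[OF that] by (intro bexI[of _ "- x"]) simp_all
  then show "abelian_group R" using U by (intro abelian_groupI) (simp_all add: R add.assoc add.commute)
  show "comm_monoid R" using U by (intro comm_monoidI) (simp_all add: R mult.assoc mult.commute)
qed (simp add: R distrib_right)

lemma ideal_of_closed:
  fixes U :: "'r::comm_ring_1 set"
  assumes "cring R" and R: "R = \<lparr>carrier = U, mult = (*), one = 1, ring.zero = 0, add = (+)\<rparr>"
    and J: "J \<subseteq> U" "0 \<in> J" "\<And>x y. x \<in> J \<Longrightarrow> y \<in> J \<Longrightarrow> x + y \<in> J" "\<And>q x. q \<in> U \<Longrightarrow> x \<in> J \<Longrightarrow> q * x \<in> J"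
  shows "ideal J R"
proof -
  interpret cring R by fact
  have inv: "\<ominus>\<^bsub>R\<^esub> x \<in> J" if "x \<in> J" for x
  proof -
    have "\<ominus>\<^bsub>R\<^esub> \<one>\<^bsub>R\<^esub> \<in> U" using a_inv_closed[OF one_closed] by (simp add: R)
    then have "(\<ominus>\<^bsub>R\<^esub> \<one>\<^bsub>R\<^esub>) \<otimes>\<^bsub>R\<^esub> x \<in> J" using J(4)[OF _ that] by (simp add: R)
    moreover have xc: "x \<in> carrier R" using J(1) that by (auto simp: R)
    have "(\<ominus>\<^bsub>R\<^esub> \<one>\<^bsub>R\<^esub>) \<otimes>\<^bsub>R\<^esub> x = \<ominus>\<^bsub>R\<^esub> x" unfolding l_minus[OF one_closed xc] l_one[OF xc] ..
    ultimately show ?thesis by simp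
  qed
  show ?thesis
  proof (rule idealI[OF ring_axioms])
    show "subgroup J (add_monoid R)"
    proof (rule group.subgroupI)
      show "group (add_monoid R)" by (rule a_group)
      show "J \<subseteq> carrier (add_monoid R)" "J \<noteq> {}" using J(1,2) by (auto simp: R)
      show "inv\<^bsub>add_monoid R\<^esub> x \<in> J" if "x \<in> J" for x using inv[OF that] by (simp add: a_inv_def)
      show "x \<otimes>\<^bsub>add_monoid R\<^esub> y \<in> J" if "x \<in> J" "y \<in> J" for x y using J(3)[OF that] by (simp add: R)
    qed
  next
    fix x q assume "x \<in> J" "q \<in> carrier R"
    then have "q * x \<in> J" using J(4) by (simp add: R)
    then show "q \<otimes>\<^bsub>R\<^esub> x \<in> J" "x \<otimes>\<^bsub>R\<^esub> q \<in> J" by (simp_all add: R mult.commute[of x q])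
  qed
qed

lemma mpoly_ring_cring: "cring (mpoly_ring I :: ('x, 'k::comm_ring_1) mpoly ring)"
proof (rule cring_of_closed[OF _ _ _ _ _ mpoly_ring_def])
  fix p q :: "('x, 'k) mpoly" assume "p \<in> {p. vars p \<subseteq> I}" "q \<in> {p. vars p \<subseteq> I}"
  then show "p + q \<in> {p. vars p \<subseteq> I}" "p * q \<in> {p. vars p \<subseteq> I}" using vars_add[of p q] vars_mult[of p q] by blast+
qed (simp_all add: vars_uminus vars_one, simp add: vars_def)

section \<open>Linear functionals given by their values on monomials\<close>

definition wsum :: "('m \<Rightarrow> 'k) \<Rightarrow> ('m \<Rightarrow>\<^sub>0 'k::comm_ring_1) \<Rightarrow> 'k" where
  "wsum \<phi> p = (\<Sum>m\<in>Poly_Mapping.keys p. Poly_Mapping.lookup p m * \<phi> m)"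

lemma wsum_superset: "finite A \<Longrightarrow> Poly_Mapping.keys p \<subseteq> A \<Longrightarrow> wsum \<phi> p = (\<Sum>m\<in>A. Poly_Mapping.lookup p m * \<phi> m)"
  unfolding wsum_def by (rule sum.mono_neutral_left) (auto simp: in_keys_iff)

lemma wsum_add: "wsum \<phi> (p + q) = wsum \<phi> p + wsum \<phi> q"
proof -
  let ?A = "Poly_Mapping.keys p \<union> Poly_Mapping.keys q"
  show ?thesis using keys_add[of p q]
    by (simp add: wsum_superset[of ?A] lookup_add distrib_right sum.distrib)
qed

lemma wsum_zero [simp]: "wsum \<phi> 0 = 0" by (simp add: wsum_def)

lemma wsum_sum: "wsum \<phi> (\<Sum>i\<in>A. f i) = (\<Sum>i\<in>A. wsum \<phi> (f i))"
  by (induction A rule: infinite_finite_induct) (auto simp: wsum_add)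

lemma wsum_single [simp]: "wsum \<phi> (Poly_Mapping.single m c) = c * \<phi> m"
  by (simp add: wsum_superset[of "{m}"])

lemma wsum_minus: "wsum \<phi> (p - q) = wsum \<phi> p - wsum \<phi> q"
  using wsum_add[of \<phi> "p - q" q] by simp

lemma wsum_add_fun: "wsum (\<lambda>m. \<phi> m + \<psi> m) p = wsum \<phi> p + wsum \<psi> p"
  and wsum_mult_fun: "wsum (\<lambda>m. c * \<phi> m) p = c * wsum \<phi> p"
  and wsum_cong: "(\<And>m. m \<in> Poly_Mapping.keys p \<Longrightarrow> \<phi> m = \<psi> m) \<Longrightarrow> wsum \<phi> p = wsum \<psi> p"
  by (auto simp: wsum_def algebra_simps sum.distrib sum_distrib_left intro!: sum.cong)

lemma wsum_mult:
  fixes q g :: "'m::monoid_add \<Rightarrow>\<^sub>0 'k::comm_ring_1"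
  shows "wsum \<phi> (q * g) = wsum (\<lambda>a. wsum (\<lambda>m. \<phi> (a + m)) g) q"
proof -
  have "q * g = (\<Sum>a\<in>Poly_Mapping.keys q. Poly_Mapping.single a (Poly_Mapping.lookup q a)) *
      (\<Sum>m\<in>Poly_Mapping.keys g. Poly_Mapping.single m (Poly_Mapping.lookup g m))"
    using poly_mapping_expand[of q] poly_mapping_expand[of g] by simp
  then show ?thesis
    by (simp add: sum_product wsum_sum mult_single)
       (simp add: wsum_def sum_distrib_left mult.assoc)
qed

text \<open>
  If functionals on an ideal are semilinear over one and the same point evaluation \<open>e\<close>, the ideal
  needs at least as many generators as there are independent functionals (Nakayama).
\<close>

lemma card_generators_ge:
  fixes S :: "('i, 'k::field) mpoly set" and \<Phi> :: "'x \<Rightarrow> ('i, 'k) mpoly \<Rightarrow> 'k"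
  assumes S: "finite S" "S \<subseteq> carrier (mpoly_ring N)"
    and I: "I = Idl\<^bsub>mpoly_ring N\<^esub> S"
    and add: "\<And>x p q. \<Phi> x (p + q) = \<Phi> x p + \<Phi> x q"
    and mult: "\<And>x q g. x \<in> X \<Longrightarrow> q \<in> carrier (mpoly_ring N) \<Longrightarrow> g \<in> I \<Longrightarrow> \<Phi> x (q * g) = e q * \<Phi> x g"
    and g: "\<And>x. x \<in> X \<Longrightarrow> g x \<in> I" "\<And>x. x \<in> X \<Longrightarrow> \<Phi> x (g x) \<noteq> 0"
      "\<And>x y. x \<in> X \<Longrightarrow> y \<in> X \<Longrightarrow> x \<noteq> y \<Longrightarrow> \<Phi> y (g x) = 0"
  shows "finite X \<and> card X \<le> card S"
proof -
  let ?R = "mpoly_ring N :: ('i, 'k) mpoly ring"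
  interpret cring ?R by (rule mpoly_ring_cring)
  define V where "V f = (\<lambda>x. if x \<in> X then \<Phi> x f else 0)" for f
  \<comment> \<open>The elements whose vector of values is spanned by the vectors of the generators.
    Since all functionals in \<open>X\<close> are semilinear over the same \<open>e\<close>, and the
    others are replaced by 0, these elements form an ideal; it contains \<open>S\<close>, hence all
    of \<open>I\<close>.\<close>
  define J where "J = {f \<in> I. V f \<in> fv.span (V ` S)}"
  have "ideal I ?R" unfolding I using S(2) by (rule genideal_ideal)
  then interpret I: ideal I ?R .
  have Vadd: "V (f + h) = V f + V h" for f h by (auto simp: V_def add fun_eq_iff)
  have Vmult: "V (q * f) = (\<lambda>x. e q * V f x)" if "q \<in> carrier ?R" "f \<in> I" for q f
    using mult that by (auto simp: V_def fun_eq_iff)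
  have Ic: "I \<subseteq> carrier ?R" using I.a_subset .
  have zero: "\<zero>\<^bsub>?R\<^esub> = 0" "f \<oplus>\<^bsub>?R\<^esub> h = f + h" "f \<otimes>\<^bsub>?R\<^esub> h = f * h" for f h
    by (simp_all add: mpoly_ring_def)
  have clm: "q * f \<in> J" if "q \<in> carrier ?R" "f \<in> J" for q f
    using that I.I_l_closed[of f q] Vmult[of q f] fv.span_scale[of "V f" "V ` S" "e q"] by (simp add: J_def zero)
  have "ideal J ?R"
  proof (rule ideal_of_closed[OF mpoly_ring_cring mpoly_ring_def])
    show "J \<subseteq> {p. vars p \<subseteq> N}" using Ic by (auto simp: J_def mpoly_ring_def)
    have "V 0 = 0" using Vadd[of 0 0] by simp
    then show "0 \<in> J" using I.zero_closed by (simp add: J_def zero fv.span_zero)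
    show "f + h \<in> J" if "f \<in> J" "h \<in> J" for f h
      using that I.a_closed[of f h] Vadd by (simp add: J_def zero fv.span_add)
    show "q * f \<in> J" if "q \<in> {p. vars p \<subseteq> N}" "f \<in> J" for q f
      using clm[of q f] that by (simp add: mpoly_ring_def)
  qed
  moreover have "S \<subseteq> J" using genideal_self[OF S(2)] by (auto simp: J_def I intro: fv.span_base)
  ultimately have "I \<subseteq> J" unfolding I by (rule genideal_minimal)
  then have "V (g x) \<in> fv.span (V ` S)" if "x \<in> X" for x using g(1)[OF that] by (auto simp: J_def)
  from card_le_of_diagonal[of "V ` S" X "\<lambda>x. V (g x)" "\<lambda>x. x", OF _ this] g S(1)
  have "finite X \<and> card X \<le> card (V ` S)" by (auto simp: V_def)
  then show ?thesis using card_image_le[OF S(1), of V] by linarith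
qed

abbreviation (input) "lk \<equiv> Poly_Mapping.lookup"
abbreviation (input) "kys \<equiv> Poly_Mapping.keys"

section \<open>Toric ideals and fibre graphs, with some variables inverted\<close>

locale toric =
  fixes N :: "'i set" and D :: "'i \<Rightarrow> 'b set" and A' :: "'b set"
  assumes finite_N: "finite N" and finite_D: "\<And>i. i \<in> N \<Longrightarrow> finite (D i)"
begin

definition deg :: "('i \<Rightarrow>\<^sub>0 nat) \<Rightarrow> 'b \<Rightarrow>\<^sub>0 nat" where
  "deg m = (\<Sum>i\<in>kys m. \<Sum>a\<in>D i. Poly_Mapping.single a (lk m i))"

text \<open>The variables whose monomials become units when only the arcs \<open>A'\<close> are
  kept.\<close>

definition "F = {i\<in>N. D i \<inter> A' = {}}"
definition "ex = {m :: 'i \<Rightarrow>\<^sub>0 nat. kys m \<subseteq> N}"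
definition "agree m m' \<longleftrightarrow> (\<forall>a\<in>A'. lk (deg m) a = lk (deg m') a)"

text \<open>Edges of the fibre graph for the degree on \<open>A'\<close>. Monomials that coincide
  outside \<open>F\<close> differ by units; monomials with a common variable outside
  \<open>F\<close> differ, up to units, by an element of the maximal ideal times the toric ideal. So
  only the components of a fibre are seen by minimal generators.\<close>

definition adj :: "('i \<Rightarrow>\<^sub>0 nat) \<Rightarrow> ('i \<Rightarrow>\<^sub>0 nat) \<Rightarrow> bool" where
  "adj m m' \<longleftrightarrow> m \<in> ex \<and> m' \<in> ex \<and> agree m m' \<and>
     ((\<forall>i\<in>N - F. lk m i = lk m' i) \<or> (\<exists>i\<in>N - F. lk m i \<noteq> 0 \<and> lk m' i \<noteq> 0))"

abbreviation "conn \<equiv> adj\<^sup>*\<^sup>*"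

text \<open>The toric ideal, that is, the kernel of the map to arc monomials, described by
  coefficients: their sum over each fibre of \<open>deg\<close> is zero.\<close>

definition ker :: "('i, 'k::comm_ring_1) mpoly set" where
  "ker = {p. vars p \<subseteq> N \<and> (\<forall>d. wsum (\<lambda>m. of_bool (deg m = d)) p = 0)}"

lemma ex_add: "m + m' \<in> ex \<longleftrightarrow> m \<in> ex \<and> m' \<in> ex"
  by (simp add: ex_def keys_add_nat)

lemma lookup_deg: "m \<in> ex \<Longrightarrow> lk (deg m) a = (\<Sum>i\<in>N. lk m i * of_bool (a \<in> D i))"
proof -
  assume m: "m \<in> ex"
  have "lk (deg m) a = (\<Sum>i\<in>kys m. \<Sum>b\<in>D i. lk m i when b = a)"
    by (simp add: deg_def lookup_sum lookup_single)
  also have "\<dots> = (\<Sum>i\<in>kys m. lk m i * of_bool (a \<in> D i))"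
  proof (rule sum.cong[OF refl])
    fix i assume "i \<in> kys m"
    then have "finite (D i)" using m finite_D by (auto simp: ex_def)
    then show "(\<Sum>b\<in>D i. lk m i when b = a) = lk m i * of_bool (a \<in> D i)"
      by (simp add: when_def sum.delta')
  qed
  also have "\<dots> = (\<Sum>i\<in>N. lk m i * of_bool (a \<in> D i))"
    using m finite_N by (intro sum.mono_neutral_left) (auto simp: ex_def in_keys_iff)
  finally show ?thesis .
qed

lemma deg_add: "m \<in> ex \<Longrightarrow> m' \<in> ex \<Longrightarrow> deg (m + m') = deg m + deg m'"
  by (rule poly_mapping_eqI)
    (simp add: lookup_deg ex_add lookup_add distrib_right sum.distrib)

lemma F_ex: "kys m \<subseteq> F \<Longrightarrow> m \<in> ex"
  by (auto simp: ex_def F_def)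

lemma deg_F: "m \<in> ex \<Longrightarrow> kys m \<subseteq> F \<longleftrightarrow> (\<forall>a\<in>A'. lk (deg m) a = 0)"
proof -
  assume m: "m \<in> ex"
  have Z: "lk (deg m) a = 0 \<longleftrightarrow> (\<forall>i\<in>N. lk m i = 0 \<or> a \<notin> D i)" for a
    using finite_N by (auto simp: lookup_deg[OF m])
  have "(\<forall>a\<in>A'. lk (deg m) a = 0) \<longleftrightarrow> (\<forall>i\<in>N. lk m i \<noteq> 0 \<longrightarrow> D i \<inter> A' = {})" unfolding Z disjoint_iff by metis
  also have "\<dots> \<longleftrightarrow> (\<forall>i\<in>N. i \<in> kys m \<longrightarrow> D i \<inter> A' = {})" by (simp only: in_keys_iff)
  also have "\<dots> \<longleftrightarrow> kys m \<subseteq> F" using m unfolding ex_def F_def by blast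
  finally show ?thesis by simp
qed

lemma agree_F_add: "m \<in> ex \<Longrightarrow> kys x \<subseteq> F \<Longrightarrow> agree (x + m) m"
  using deg_F[of x] F_ex[of x] by (simp add: agree_def deg_add lookup_add)

lemma agree_refl [simp]: "agree m m" and agree_sym: "agree m m' \<Longrightarrow> agree m' m"
  and agree_trans: "agree m m' \<Longrightarrow> agree m' m'' \<Longrightarrow> agree m m''"
  by (auto simp: agree_def)

lemma agree_add_cancel: "m \<in> ex \<Longrightarrow> m' \<in> ex \<Longrightarrow> x \<in> ex \<Longrightarrow> agree (x + m) (x + m') \<longleftrightarrow> agree m m'"
  by (simp add: agree_def deg_add lookup_add)

lemma adj_sym: "adj m m' \<Longrightarrow> adj m' m"
  unfolding adj_def agree_def by auto

lemma conn_sym: "conn m m' \<Longrightarrow> conn m' m"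
proof (induction rule: rtranclp_induct)
  case (step y z)
  show ?case using adj_sym[OF step.hyps(2)] step.IH by (rule converse_rtranclp_into_rtranclp)
qed simp

lemma conn_agree: "conn m m' \<Longrightarrow> agree m m'"
  by (induction rule: rtranclp_induct) (simp_all add: adj_def agree_def)

lemma conn_ex: "conn m m' \<Longrightarrow> m \<in> ex \<longleftrightarrow> m' \<in> ex"
  by (induction rule: rtranclp_induct) (auto simp: adj_def)

lemma conn_F_add:
  assumes "m \<in> ex" "kys x \<subseteq> F" shows "conn (x + m) m"
proof -
  have "lk x i = 0" if "i \<in> N - F" for i using that assms(2) by (auto simp: in_keys_iff)
  then have "adj (x + m) m" using assms F_ex agree_F_add
    by (simp add: adj_def ex_add lookup_add)
  then show ?thesis by blast
qed

text \<open>Such a functional sees only the coefficient sums over the fibres of the degree, and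
  these vanish.\<close>

lemma wsum_ker:
  assumes p: "p \<in> ker" and \<phi>: "\<And>m m'. m \<in> ex \<Longrightarrow> m' \<in> ex \<Longrightarrow> deg m = deg m' \<Longrightarrow> \<phi> m = \<phi> m'"
  shows "wsum \<phi> p = 0"
proof -
  have ks: "kys p \<subseteq> ex" using p by (auto simp: ker_def vars_def ex_def)
  have "wsum \<phi> p = (\<Sum>d\<in>deg ` kys p. \<Sum>m\<in>{m\<in>kys p. deg m = d}. lk p m * \<phi> m)"
    unfolding wsum_def by (rule sum.image_gen) simp
  also have "\<dots> = 0"
  proof (rule sum.neutral, rule ballI)
    fix d assume "d \<in> deg ` kys p"
    then obtain m0 where m0: "m0 \<in> kys p" "deg m0 = d" by auto
    have "\<phi> m = \<phi> m0" if "m \<in> kys p" "deg m = d" for m using that m0 ks by (intro \<phi>) auto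
    then have "(\<Sum>m\<in>{m\<in>kys p. deg m = d}. lk p m * \<phi> m) = (\<Sum>m\<in>{m\<in>kys p. deg m = d}. lk p m * \<phi> m0)"
      by (intro sum.cong refl) simp
    also have "\<dots> = wsum (\<lambda>m. of_bool (deg m = d)) p * \<phi> m0"
      unfolding wsum_def sum_distrib_right sum.inter_filter[OF finite_keys] by (rule sum.cong) auto
    also have "\<dots> = 0" using p by (simp add: ker_def)
    finally show "(\<Sum>m\<in>{m\<in>kys p. deg m = d}. lk p m * \<phi> m) = 0" .
  qed
  finally show ?thesis .
qed

lemma binomial_ker:
  assumes "m \<in> ex" "m' \<in> ex" "deg m = deg m'"
  shows "(Poly_Mapping.single m 1 - Poly_Mapping.single m' 1 :: ('i, 'k::comm_ring_1) mpoly) \<in> ker"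
proof -
  have "vars (Poly_Mapping.single m 1 + - Poly_Mapping.single m' (1 :: 'k)) \<subseteq>
      vars (Poly_Mapping.single m (1 :: 'k)) \<union> vars (Poly_Mapping.single m' (1 :: 'k))"
    using vars_add vars_uminus by metis
  also have "\<dots> \<subseteq> N" using vars_single[of m "1::'k"] vars_single[of m' "1::'k"] assms(1,2) unfolding ex_def by blast
  finally have "vars (Poly_Mapping.single m 1 - Poly_Mapping.single m' (1 :: 'k)) \<subseteq> N" by simp
  then show ?thesis using assms by (simp add: ker_def wsum_minus)
qed

text \<open>Nakayama at the point where the variables of \<open>F\<close> are 1 and the others 0.
  Each component other than the root of its fibre gives one functional, and each \<open>j\<close> in
  \<open>E\<close> another one that detects a relation among the inverted variables. The test
  elements are binomials; for components, \<open>lift\<close> supplies the units that make the two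
  terms have the same full degree.\<close>

lemma card_generators_ge_components:
  fixes S :: "('i, 'k::field_char_0) mpoly set"
  assumes S: "finite S" "S \<subseteq> carrier (mpoly_ring N)" "ker = Idl\<^bsub>mpoly_ring N\<^esub> S"
    and lift: "\<And>m m'. m \<in> ex \<Longrightarrow> m' \<in> ex \<Longrightarrow> agree m m' \<Longrightarrow>
      \<exists>x x'. kys x \<subseteq> F \<and> kys x' \<subseteq> F \<and> deg (x + m) = deg (x' + m')"
    and T: "T \<subseteq> ex" "\<And>r. r \<in> T \<Longrightarrow> rt r \<in> ex \<and> agree r (rt r)"
      "\<And>r r'. r \<in> T \<Longrightarrow> r' \<in> T \<Longrightarrow> \<not> conn (rt r) r'" "\<And>r r'. r \<in> T \<Longrightarrow> r' \<in> T \<Longrightarrow> conn r r' \<Longrightarrow> r = r'"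
    and E: "E \<subseteq> F" "\<And>j. j \<in> E \<Longrightarrow> \<exists>m m'. kys m \<subseteq> F \<and> kys m' \<subseteq> F \<and> deg m = deg m' \<and> lk m j \<noteq> lk m' j
      \<and> (\<forall>i\<in>E - {j}. lk m i = lk m' i)"
  shows "finite T \<and> card T + card E \<le> card S"
proof -
  let ?X = "Inl ` T \<union> Inr ` E :: (('i \<Rightarrow>\<^sub>0 nat) + 'i) set"
  \<comment> \<open>\<open>Inl r\<close> sums the coefficients over the component of
    \<open>r\<close>. \<open>Inr j\<close> is the partial derivative in the variable
    \<open>j\<close> at the chosen point, whence the factor \<open>lk m j\<close>; characteristic
    zero keeps differences of exponents nonzero in the field.\<close>
  define \<phi> :: "('i \<Rightarrow>\<^sub>0 nat) + 'i \<Rightarrow> ('i \<Rightarrow>\<^sub>0 nat) \<Rightarrow> 'k" where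
    "\<phi> x = case_sum (\<lambda>r m. of_bool (conn m r)) (\<lambda>j m. of_bool (kys m \<subseteq> F) * of_nat (lk m j)) x" for x
  define e :: "('i, 'k) mpoly \<Rightarrow> 'k" where "e = wsum (\<lambda>a. of_bool (kys a \<subseteq> F))"
  define b :: "('i \<Rightarrow>\<^sub>0 nat) \<Rightarrow> ('i \<Rightarrow>\<^sub>0 nat) \<Rightarrow> ('i, 'k) mpoly" where
    "b m m' = Poly_Mapping.single m 1 - Poly_Mapping.single m' 1" for m m'
  obtain x x' where x: "\<And>r. r \<in> T \<Longrightarrow> kys (x r) \<subseteq> F \<and> kys (x' r) \<subseteq> F \<and> deg (x r + r) = deg (x' r + rt r)"
  proof -
    have "\<forall>r\<in>T. \<exists>x x'. kys x \<subseteq> F \<and> kys x' \<subseteq> F \<and> deg (x + r) = deg (x' + rt r)"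
      using lift T(1,2) by blast
    from bchoice[OF this] obtain f where "\<forall>r\<in>T. \<exists>x'. kys (f r) \<subseteq> F \<and> kys x' \<subseteq> F \<and> deg (f r + r) = deg (x' + rt r)" ..
    from bchoice[OF this] obtain f' where "\<forall>r\<in>T. kys (f r) \<subseteq> F \<and> kys (f' r) \<subseteq> F \<and> deg (f r + r) = deg (f' r + rt r)" ..
    then show thesis using that[of f f'] by simp
  qed
  obtain y y' where y: "\<And>j. j \<in> E \<Longrightarrow> kys (y j) \<subseteq> F \<and> kys (y' j) \<subseteq> F \<and> deg (y j) = deg (y' j) \<and> lk (y j) j \<noteq> lk (y' j) j
      \<and> (\<forall>i\<in>E - {j}. lk (y j) i = lk (y' j) i)"
  proof -
    from bchoice[OF ballI[OF E(2)]] obtain f where "\<forall>j\<in>E. \<exists>m'. kys (f j) \<subseteq> F \<and> kys m' \<subseteq> F \<and> deg (f j) = deg m' \<and> lk (f j) j \<noteq> lk m' j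
      \<and> (\<forall>i\<in>E - {j}. lk (f j) i = lk m' i)" ..
    from bchoice[OF this] obtain f' where "\<forall>j\<in>E. kys (f j) \<subseteq> F \<and> kys (f' j) \<subseteq> F \<and> deg (f j) = deg (f' j) \<and> lk (f j) j \<noteq> lk (f' j) j
      \<and> (\<forall>i\<in>E - {j}. lk (f j) i = lk (f' j) i)" ..
    then show thesis using that[of f f'] by simp
  qed
  define g where "g = case_sum (\<lambda>r. b (x r + r) (x' r + rt r)) (\<lambda>j. b (y j) (y' j))"
  \<comment> \<open>Semilinearity for one monomial factor. A unit does not change components. A
    factor outside \<open>F\<close> makes all monomials of a fibre adjacent, so the functional
    becomes constant on fibres and kills \<open>ker\<close>. For derivatives this is the product
    rule, whose other term is the value of \<open>f\<close> at the point, which is 0.\<close>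
  have shift: "wsum (\<lambda>m. \<phi> z (a + m)) f = of_bool (kys a \<subseteq> F) * wsum (\<phi> z) f"
    if a: "a \<in> ex" and f: "f \<in> ker" for z a f
  proof (cases z)
    case (Inl r)
    show ?thesis
    proof (cases "kys a \<subseteq> F")
      case True
      have "conn (a + m) r \<longleftrightarrow> conn m r" if "m \<in> kys f" for m
      proof -
        have "m \<in> ex" using that f by (auto simp: ker_def vars_def ex_def)
        then have "conn (a + m) m" using True by (rule conn_F_add)
        then show ?thesis using conn_sym rtranclp_trans by metis
      qed
      then have "wsum (\<lambda>m. \<phi> z (a + m)) f = wsum (\<phi> z) f" by (intro wsum_cong) (simp add: \<phi>_def Inl)
      then show ?thesis using True by simp
    next
      case False
      then obtain i where i: "i \<in> N - F" "lk a i \<noteq> 0" using a by (auto simp: ex_def in_keys_iff)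
      have "wsum (\<lambda>m. \<phi> z (a + m)) f = 0"
      proof (rule wsum_ker[OF f])
        fix m m' assume m: "m \<in> ex" "m' \<in> ex" "deg m = deg m'"
        have "agree (a + m) (a + m')" using m a by (simp add: agree_add_cancel) (simp add: agree_def)
        then have "adj (a + m) (a + m')" using i m a by (auto simp: adj_def ex_add lookup_add)
        then have "conn (a + m) r \<longleftrightarrow> conn (a + m') r"
          using adj_sym by (metis converse_rtranclp_into_rtranclp)
        then show "\<phi> z (a + m) = \<phi> z (a + m')" by (simp add: \<phi>_def Inl)
      qed
      then show ?thesis using False by simp
    qed
  next
    case (Inr j)
    have k: "kys (a + m) \<subseteq> F \<longleftrightarrow> kys a \<subseteq> F \<and> kys m \<subseteq> F" for m by (simp add: keys_add_nat)
    show ?thesis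
    proof (cases "kys a \<subseteq> F")
      case True
      have "wsum (\<lambda>m. \<phi> z (a + m)) f = wsum (\<lambda>m. of_nat (lk a j) * of_bool (kys m \<subseteq> F) + \<phi> z m) f"
        by (rule wsum_cong) (simp add: \<phi>_def Inr k True lookup_add of_bool_def)
      also have "\<dots> = of_nat (lk a j) * wsum (\<lambda>m. of_bool (kys m \<subseteq> F)) f + wsum (\<phi> z) f"
        by (simp only: wsum_add_fun wsum_mult_fun)
      also have "wsum (\<lambda>m. of_bool (kys m \<subseteq> F)) f = 0"
        by (rule wsum_ker[OF f]) (simp add: deg_F)
      finally show ?thesis using True by simp
    next
      case False
      then show ?thesis by (simp add: \<phi>_def Inr k wsum_def)
    qed
  qed
  have bker: "b m m' \<in> ker" if "m \<in> ex" "m' \<in> ex" "deg m = deg m'" for m m'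
    unfolding b_def using that by (rule binomial_ker)
  have wb: "wsum f (b m m') = f m - f m'" for f m m' by (simp add: b_def wsum_minus)
  have cx: "conn (x r + r) m \<longleftrightarrow> conn r m" "conn (x' r + rt r) m \<longleftrightarrow> conn (rt r) m" if "r \<in> T" for r m
    using conn_F_add[of r "x r"] conn_F_add[of "rt r" "x' r"] x[OF that] T(1,2) that conn_sym rtranclp_trans
    by (metis subsetD)+
  \<comment> \<open>A monomial supported on \<open>F\<close> is adjacent to its whole fibre, so that
    fibre has no component besides the root.\<close>
  have nF: "\<not> kys (x r + r) \<subseteq> F \<and> \<not> kys (x' r + rt r) \<subseteq> F" if "r \<in> T" for r
  proof -
    have r: "r \<in> ex" "rt r \<in> ex" "agree r (rt r)" using T that by auto
    have iff: "kys r \<subseteq> F \<longleftrightarrow> kys (rt r) \<subseteq> F"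
      using deg_F[OF r(1)] deg_F[OF r(2)] r(3) by (simp add: agree_def)
    have "\<not> kys r \<subseteq> F"
    proof
      assume "kys r \<subseteq> F"
      then have "\<forall>i\<in>N - F. lk (rt r) i = lk r i" using iff by (metis DiffD2 in_keys_iff subsetD)
      then have "adj (rt r) r" using r by (auto simp: adj_def agree_sym)
      then show False using T(3)[OF that that] by blast
    qed
    then show ?thesis using iff by (simp add: keys_add_nat)
  qed
  have "finite ?X \<and> card ?X \<le> card S"
  proof (rule card_generators_ge[OF S, where \<Phi> = "\<lambda>z. wsum (\<phi> z)" and e = e and g = g])
    show "wsum (\<phi> z) (p + q) = wsum (\<phi> z) p + wsum (\<phi> z) q" for z p q by (rule wsum_add)
    show "wsum (\<phi> z) (q * f) = e q * wsum (\<phi> z) f"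
      if "q \<in> carrier (mpoly_ring N)" "f \<in> ker" for z q f
    proof -
      have "wsum (\<phi> z) (q * f) = wsum (\<lambda>a. wsum (\<lambda>m. \<phi> z (a + m)) f) q" by (rule wsum_mult)
      also have "\<dots> = wsum (\<lambda>a. wsum (\<phi> z) f * of_bool (kys a \<subseteq> F)) q"
        using that by (intro wsum_cong) (subst shift, auto simp: mpoly_ring_def vars_def ex_def mult.commute)
      also have "\<dots> = e q * wsum (\<phi> z) f" by (simp add: e_def wsum_mult_fun mult.commute)
      finally show ?thesis .
    qed
    show "g z \<in> ker" if "z \<in> ?X" for z
      using that
    proof (elim UnE imageE)
      fix r assume r: "r \<in> T" "z = Inl r"
      then have "x r + r \<in> ex" "x' r + rt r \<in> ex" using x[OF r(1)] T(1) T(2)[OF r(1)] F_ex by (auto simp: ex_add)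
      then show ?thesis using x[OF r(1)] r(2) by (simp add: g_def bker)
    next
      fix j assume j: "j \<in> E" "z = Inr j"
      then show ?thesis using y[OF j(1)] F_ex by (simp add: g_def bker)
    qed
    show "wsum (\<phi> z) (g z) \<noteq> 0" if "z \<in> ?X" for z
      using that
    proof (elim UnE imageE)
      fix r assume r: "r \<in> T" "z = Inl r"
      have "conn (x r + r) r" "\<not> conn (x' r + rt r) r" using cx[OF r(1), of r] T(3)[OF r(1) r(1)] by auto
      then show ?thesis by (simp add: g_def wb \<phi>_def r(2))
    next
      fix j assume j: "j \<in> E" "z = Inr j"
      then show ?thesis using y[OF j(1)] by (simp add: g_def wb \<phi>_def)
    qed
    show "wsum (\<phi> z') (g z) = 0" if "z \<in> ?X" "z' \<in> ?X" "z \<noteq> z'" for z z'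
      using that(1)
    proof (elim UnE imageE)
      fix r assume r: "r \<in> T" "z = Inl r"
      show ?thesis using that(2)
      proof (elim UnE imageE)
        fix r' assume r': "r' \<in> T" "z' = Inl r'"
        then have "\<not> conn (x r + r) r'" "\<not> conn (x' r + rt r) r'"
          using cx[OF r(1), of r'] T(3)[OF r(1) r'(1)] T(4)[OF r(1) r'(1)] that(3) r(2) by auto
        then show ?thesis by (simp add: g_def wb \<phi>_def r(2) r'(2))
      next
        fix j assume j: "j \<in> E" "z' = Inr j"
        then show ?thesis using r nF[OF r(1)] by (simp add: g_def wb \<phi>_def)
      qed
    next
      fix j assume j: "j \<in> E" "z = Inr j"
      show ?thesis using that(2)
      proof (elim UnE imageE)
        fix r' assume r': "r' \<in> T" "z' = Inl r'"
        have "\<not> conn m r'" if mF: "kys m \<subseteq> F" for m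
        proof
          assume "conn m r'"
          from conn_agree[OF this] have "kys r' \<subseteq> F"
            using deg_F[OF F_ex[OF mF]] deg_F[of r'] mF T(1) r'(1) by (auto simp: agree_def)
          then show False using nF[OF r'(1)] x[OF r'(1)] by (simp add: keys_add_nat)
        qed
        then show ?thesis using j r' y[OF j(1)] by (simp add: g_def wb \<phi>_def)
      next
        fix j' assume j': "j' \<in> E" "z' = Inr j'"
        then show ?thesis using j that(3) y[OF j(1)] by (auto simp: g_def wb \<phi>_def)
      qed
    qed
  qed
  then have X: "finite ?X" "card ?X \<le> card S" by blast+
  then have "finite (Inl ` T :: (('i \<Rightarrow>\<^sub>0 nat) + 'i) set)" "finite (Inr ` E :: (('i \<Rightarrow>\<^sub>0 nat) + 'i) set)"
    by (simp_all only: finite_Un)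
  then have fin: "finite T" "finite E" by (auto dest: finite_imageD simp: inj_on_def)
  have "card ?X = card T + card E"
    using fin by (subst card_Un_disjoint) (auto simp: card_image)
  then show ?thesis using X fin by simp
qed

end

lemma diff_diff_telescope:
  fixes x :: "'a::ab_group_add" shows "x - y + (y - z) = x - z" "x - z - (y - z) = x - y"
  by simp_all

context toric
begin

text \<open>
  Comparing dimensions: the ideal needs as many generators as there are non-root components, while
  the differences of component representatives already span all relations. If \<open>B\<close> is a basis of the
  degrees, both numbers agree, so no such difference is redundant.
\<close>

lemma conn_of_relation:
  fixes S :: "('i, 'k::field_char_0) mpoly set"
  assumes S: "finite S" "S \<subseteq> carrier (mpoly_ring N)" "ker = Idl\<^bsub>mpoly_ring N\<^esub> S"
    and lift: "\<And>m m'. m \<in> ex \<Longrightarrow> m' \<in> ex \<Longrightarrow> agree m m' \<Longrightarrow>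
      \<exists>x x'. kys x \<subseteq> F \<and> kys x' \<subseteq> F \<and> deg (x + m) = deg (x' + m')"
    and B: "B \<subseteq> N" "card S + card B \<le> card N"
    and rel: "\<And>j. j \<in> N - B \<Longrightarrow> \<exists>m m'. m \<in> ex \<and> m' \<in> ex \<and> deg m = deg m' \<and> lk m j \<noteq> lk m' j
      \<and> (\<forall>i\<in>N - B - {j}. lk m i = lk m' i) \<and> (j \<in> F \<longrightarrow> kys m \<subseteq> F \<and> kys m' \<subseteq> F)"
    and w: "u \<in> ex" "v \<in> ex" "w1 \<in> ex" "w1' \<in> ex" "w2 \<in> ex" "w2' \<in> ex"
      "agree u v" "agree w1 w1'" "agree w2 w2'"
    and a: "a1 \<in> A'" "lk (deg w1) a1 < lk (deg u) a1" "a2 \<in> A'" "lk (deg w2) a2 < lk (deg u) a2"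
    and eq: "\<And>i. i \<in> N - F \<Longrightarrow> lk u i + lk w1' i + lk w2' i = lk v i + lk w1 i + lk w2 i"
  shows "conn u v"
proof (rule ccontr)
  assume nuv: "\<not> conn u v"
  have cc: "conn m r \<longleftrightarrow> conn m' r" if "conn m m'" for m m' r
    using conn_sym[OF that] that by (meson rtranclp_trans)
  have ac: "agree m r \<longleftrightarrow> agree m' r" if "agree m m'" for m m' r
    using that by (simp add: agree_def)
  \<comment> \<open>Representatives of components and roots of fibres are chosen so that
    \<open>u\<close> and \<open>v\<close> represent their own components and \<open>u\<close> is the
    root of their common fibre. The component of \<open>v\<close> then contributes exactly the
    difference of \<open>u\<close> and \<open>v\<close>.\<close>
  define rp where "rp m = (if conn m u then u else if conn m v then v else (SOME r. conn m r))" for m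
  define rt where "rt m = (if agree m u then u else rp (SOME r. r \<in> ex \<and> agree m r))" for m
  have rp_conn: "conn m (rp m)" for m
    using someI[of "conn m" m] by (simp add: rp_def)
  have rp_eq: "rp m = rp m'" if "conn m m'" for m m'
  proof -
    have "conn m = conn m'" using cc[OF that] by (intro ext)
    then show ?thesis by (simp add: rp_def)
  qed
  have rp_rp: "rp (rp m) = rp m" for m using rp_eq[OF rp_conn] by simp
  have rt_ex: "rt m \<in> ex \<and> agree m (rt m)" if "m \<in> ex" for m
  proof (cases "agree m u")
    case True
    then show ?thesis using w(1) by (simp add: rt_def)
  next
    case False
    define r where "r = (SOME r. r \<in> ex \<and> agree m r)"
    have r: "r \<in> ex" "agree m r" using someI[of "\<lambda>r. r \<in> ex \<and> agree m r" m] that by (simp_all add: r_def)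
    have "rp r \<in> ex" "agree r (rp r)" using conn_ex[OF rp_conn[of r]] conn_agree[OF rp_conn[of r]] r(1) by auto
    then show ?thesis using False r(2) agree_trans by (simp add: rt_def r_def[symmetric])
  qed
  have rt_eq: "rt m = rt m'" if "agree m m'" for m m'
  proof -
    have "agree m = agree m'" using ac[OF that] by (intro ext)
    then show ?thesis by (simp add: rt_def)
  qed
  have rp_rt: "rp (rt m) = rt m" for m
    by (simp add: rt_def rp_rp) (simp add: rp_def)
  define T where "T = {r \<in> ex. rp r = r \<and> rt r \<noteq> r}"
  have "finite T \<and> card T + card (F - B) \<le> card S"
  proof (rule card_generators_ge_components[OF S lift, where rt = rt])
    show "rt r \<in> ex \<and> agree r (rt r)" if "r \<in> T" for r using that rt_ex by (simp add: T_def)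
    show "\<not> conn (rt r) r'" if r: "r \<in> T" "r' \<in> T" for r r'
    proof
      assume c: "conn (rt r) r'"
      have "rt r = r'" using rp_eq[OF c] rp_rt r(2) by (simp add: T_def)
      moreover have "agree r (rt r)" using rt_ex r(1) by (simp add: T_def)
      ultimately have "rt r' = r'" using rt_eq by metis
      then show False using r(2) by (simp add: T_def)
    qed
    show "r = r'" if "r \<in> T" "r' \<in> T" "conn r r'" for r r'
      using rp_eq[OF that(3)] that(1,2) by (simp add: T_def)
    show "\<exists>m m'. kys m \<subseteq> F \<and> kys m' \<subseteq> F \<and> deg m = deg m' \<and> lk m j \<noteq> lk m' j \<and> (\<forall>i\<in>F - B - {j}. lk m i = lk m' i)"
      if j: "j \<in> F - B" for j
    proof -
      have "j \<in> N - B" using j by (auto simp: F_def)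
      from rel[OF this] obtain m m' where m: "deg m = deg m'" "lk m j \<noteq> lk m' j"
        "\<forall>i\<in>N - B - {j}. lk m i = lk m' i" "j \<in> F \<longrightarrow> kys m \<subseteq> F \<and> kys m' \<subseteq> F" by (elim exE conjE) (rule that)
      have "F - B - {j} \<subseteq> N - B - {j}" by (auto simp: F_def)
      then have m3: "\<forall>i\<in>F - B - {j}. lk m i = lk m' i" using m(3) by blast
      have k: "kys m \<subseteq> F" "kys m' \<subseteq> F" using m(4) j by blast+
      show ?thesis by (intro exI[of _ m] exI[of _ m'] conjI; fact k m m3)
    qed
  qed (auto simp: T_def)
  then have fT: "finite T" and cT: "card T + card (F - B) \<le> card S" by auto
  have FN: "F \<subseteq> N" by (auto simp: F_def)
  have "card N = card B + card (N - B)"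
    using card_Un_disjoint[of B "N - B"] B(1) finite_N finite_subset[OF B(1)] by (simp add: Un_absorb1)
  moreover have "card (N - B) = card (F - B) + card (N - F - B)"
  proof -
    have "N - B = (F - B) \<union> (N - F - B)" "(F - B) \<inter> (N - F - B) = {}" using FN by blast+
    then show ?thesis using card_Un_disjoint[of "F - B" "N - F - B"] finite_N finite_subset[OF FN] by simp
  qed
  \<comment> \<open>There are at most \<open>card N - card B\<close> generators, and the relations
    among inverted variables already account for \<open>F - B\<close> of them.\<close>
  ultimately have T_le: "card T \<le> card (N - F - B)" using cT B(2) by linarith
  have avu: "agree v u" using w(7) by (rule agree_sym)
  have "\<not> conn v u" using nuv conn_sym by blast
  moreover have "u \<noteq> v" using nuv by blast
  ultimately have vT: "v \<in> T" and rtv: "rt v = u" using w(2) avu by (simp_all add: T_def rp_def rt_def)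
  \<comment> \<open>Lattice vectors are taken over the rationals and only outside \<open>F\<close>,
    so units become invisible.\<close>
  define \<pi> :: "('i \<Rightarrow>\<^sub>0 nat) \<Rightarrow> 'i \<Rightarrow> rat" where "\<pi> m = (\<lambda>i. if i \<in> N - F then of_nat (lk m i) else 0)" for m
  define t where "t r = \<pi> r - \<pi> (rt r)" for r
  define U where "U = (\<Union>i\<in>N. D i) \<inter> A'"
  define sz where "sz m = (\<Sum>a\<in>U. lk (deg m) a)" for m
  have fU: "finite U" using finite_N finite_D by (simp add: U_def)
  have sz_agree: "sz m = sz m'" if "agree m m'" for m m'
    unfolding sz_def using that by (intro sum.cong) (auto simp: U_def agree_def)
  \<comment> \<open>Cancelling a common variable outside \<open>F\<close> strictly lowers
    \<open>sz\<close>, because such a variable involves an arc of \<open>A'\<close>. The bound on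
    the degree of \<open>r\<close> is kept through the induction: it is what excludes
    \<open>v\<close> below.\<close>
  have span: "\<pi> m - \<pi> m' \<in> fv.span (t ` {r \<in> T. \<forall>a\<in>A'. lk (deg r) a \<le> lk (deg m) a})"
    if "m \<in> ex" "m' \<in> ex" "agree m m'" for m m'
    using that
  proof (induction "sz m" arbitrary: m m' rule: less_induct)
    case less
    let ?W = "t ` {r \<in> T. \<forall>a\<in>A'. lk (deg r) a \<le> lk (deg m) a}"
    have st: "\<pi> x - \<pi> y \<in> fv.span ?W" if xy: "adj x y" and xm: "agree x m" for x y
    proof (cases "\<forall>i\<in>N - F. lk x i = lk y i")
      case True
      then have "\<pi> x - \<pi> y = 0" by (auto simp: \<pi>_def fun_eq_iff)
      then show ?thesis by (simp add: fv.span_zero)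
    next
      case False
      then obtain i where i: "i \<in> N - F" "lk x i \<noteq> 0" "lk y i \<noteq> 0" using xy by (auto simp: adj_def)
      have split: "\<exists>z1. z = Poly_Mapping.single i 1 + z1" if "lk z i \<noteq> 0" for z :: "'i \<Rightarrow>\<^sub>0 nat"
      proof (intro exI[of _ "Poly_Mapping.update i (lk z i - 1) z"] poly_mapping_eqI)
        fix k
        show "lk z k = lk (Poly_Mapping.single i 1 + Poly_Mapping.update i (lk z i - 1) z) k"
          using that by (cases "k = i") (simp_all add: lookup_add lookup_single lookup_update)
      qed
      obtain x1 y1 where x1: "x = Poly_Mapping.single i 1 + x1" and y1: "y = Poly_Mapping.single i 1 + y1"
        using split[OF i(2)] split[OF i(3)] by (elim exE) (rule that)
      have sx: "Poly_Mapping.single i 1 \<in> ex" using i(1) by (simp add: ex_def)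
      have ex1: "x1 \<in> ex" "y1 \<in> ex" using xy unfolding adj_def x1 y1 ex_add by auto
      have ag1: "agree x1 y1" using xy agree_add_cancel[OF ex1 sx] unfolding adj_def x1 y1 by auto
      obtain b where b: "b \<in> D i" "b \<in> A'" using i(1) by (auto simp: F_def)
      have "lk (deg (Poly_Mapping.single i 1)) b = (\<Sum>j\<in>N. (1 when i = j) * of_bool (b \<in> D j))"
        using lookup_deg[OF sx] by (simp add: lookup_single)
      also have "\<dots> \<ge> (1 when i = i) * of_bool (b \<in> D i)"
        using i(1) finite_N by (intro member_le_sum) auto
      finally have "lk (deg (Poly_Mapping.single i 1)) b > 0" using b by simp
      moreover have "b \<in> U" using b i(1) by (auto simp: U_def)
      ultimately have "sz (Poly_Mapping.single i 1) > 0"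
        unfolding sz_def using fU by (metis member_le_sum order_less_le_trans zero_le)
      moreover have "sz x = sz (Poly_Mapping.single i 1) + sz x1"
        unfolding sz_def x1 deg_add[OF sx ex1(1)] lookup_add by (rule sum.distrib)
      ultimately have "sz x1 < sz m" using sz_agree[OF xm] by simp
      from less.hyps[OF this ex1 ag1]
      have "\<pi> x1 - \<pi> y1 \<in> fv.span (t ` {r \<in> T. \<forall>a\<in>A'. lk (deg r) a \<le> lk (deg x1) a})" .
      moreover have "t ` {r \<in> T. \<forall>a\<in>A'. lk (deg r) a \<le> lk (deg x1) a} \<subseteq> ?W"
      proof -
        have "lk (deg x1) a \<le> lk (deg m) a" if "a \<in> A'" for a
        proof -
          have "lk (deg m) a = lk (deg x) a" using xm that by (simp add: agree_def)
          also have "\<dots> = lk (deg (Poly_Mapping.single i 1)) a + lk (deg x1) a"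
            unfolding x1 deg_add[OF sx ex1(1)] lookup_add by (rule refl)
          finally show ?thesis by simp
        qed
        then have "{r \<in> T. \<forall>a\<in>A'. lk (deg r) a \<le> lk (deg x1) a} \<subseteq> {r \<in> T. \<forall>a\<in>A'. lk (deg r) a \<le> lk (deg m) a}"
          by (auto intro: order_trans)
        then show ?thesis by (rule image_mono)
      qed
      moreover have "\<pi> x - \<pi> y = \<pi> x1 - \<pi> y1" by (auto simp: \<pi>_def x1 y1 lookup_add fun_eq_iff)
      ultimately show ?thesis using fv.span_mono[of _ ?W] by auto
    qed
    have cn: "\<pi> x - \<pi> y \<in> fv.span ?W" if "conn x y" "agree x m" for x y
      using that
    proof (induction rule: rtranclp_induct)
      case base
      show ?case unfolding diff_self by (rule fv.span_zero)
    next
      case (step y z)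
      have "agree y m" using agree_trans[OF agree_sym[OF conn_agree[OF step.hyps(1)]] step.prems] .
      from fv.span_add[OF step.IH[OF step.prems] st[OF step.hyps(2) this]] show ?case
        unfolding diff_diff_telescope .
    qed
    have rr: "\<pi> x - \<pi> (rt m) \<in> fv.span ?W" if x: "x \<in> ex" "agree x m" for x
    proof -
      have ax: "agree (rp x) m" using agree_trans[OF agree_sym[OF conn_agree[OF rp_conn[of x]]] x(2)] .
      have exx: "rp x \<in> ex" using conn_ex[OF rp_conn] x(1) by blast
      have rtx: "rt (rp x) = rt m" using rt_eq[OF ax] .
      have "\<pi> (rp x) - \<pi> (rt m) \<in> fv.span ?W"
      proof (cases "rp x = rt m")
        case True
        show ?thesis unfolding True diff_self by (rule fv.span_zero)
      next
        case False
        then have "rp x \<in> T" using exx rp_rp rtx by (simp add: T_def)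
        then have "t (rp x) \<in> ?W" using ax by (auto simp: agree_def)
        then show ?thesis unfolding t_def rtx by (rule fv.span_base)
      qed
      from fv.span_add[OF cn[OF rp_conn x(2)] this] show ?thesis unfolding diff_diff_telescope .
    qed
    from fv.span_diff[OF rr[OF less.prems(1) agree_refl] rr[OF less.prems(2) agree_sym[OF less.prems(3)]]]
    show ?case unfolding diff_diff_telescope .
  qed
  define W where "W = t ` (T - {v})"
  \<comment> \<open>A degree that is smaller than that of \<open>u\<close> at one arc of
    \<open>A'\<close> is not above the degree of \<open>v\<close>, so \<open>t v\<close> does not
    occur in the combination.\<close>
  have low: "\<pi> m - \<pi> m' \<in> fv.span W"
    if m: "m \<in> ex" "m' \<in> ex" "agree m m'" "a \<in> A'" "lk (deg m) a < lk (deg u) a" for m m' a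
  proof -
    have "\<not> lk (deg v) a \<le> lk (deg m) a" using avu m(4,5) by (simp add: agree_def)
    then have "{r \<in> T. \<forall>a\<in>A'. lk (deg r) a \<le> lk (deg m) a} \<subseteq> T - {v}" using m(4) by auto
    then have "t ` {r \<in> T. \<forall>a\<in>A'. lk (deg r) a \<le> lk (deg m) a} \<subseteq> W" unfolding W_def by (rule image_mono)
    from subsetD[OF fv.span_mono[OF this] span[OF m(1,2,3)]] show ?thesis .
  qed
  have "t v = - ((\<pi> w1 - \<pi> w1') + (\<pi> w2 - \<pi> w2'))"
  proof
    fix i
    show "t v i = (- ((\<pi> w1 - \<pi> w1') + (\<pi> w2 - \<pi> w2'))) i"
    proof (cases "i \<in> N - F")
      case True
      have "rat_of_nat (lk u i + lk w1' i + lk w2' i) = rat_of_nat (lk v i + lk w1 i + lk w2 i)"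
        using eq[OF True] by simp
      moreover have "\<pi> m i = of_nat (lk m i)" for m using True by (simp only: \<pi>_def if_True)
      ultimately show ?thesis by (simp add: t_def rtv)
    next
      case False
      then have "\<pi> m i = 0" for m by (simp only: \<pi>_def if_False)
      then show ?thesis by (simp add: t_def)
    qed
  qed
  then have tv: "t v \<in> fv.span W"
    using fv.span_neg[OF fv.span_add[OF low[OF w(3,4,8) a(1,2)] low[OF w(5,6,9) a(3,4)]]] by (simp only:)
  have "t ` T \<subseteq> fv.span W"
  proof
    fix y assume "y \<in> t ` T"
    then obtain r where "r \<in> T" "y = t r" by auto
    then show "y \<in> fv.span W" using tv fv.span_base[of y W] by (cases "r = v") (auto simp: W_def)
  qed
  then have TW: "fv.span (t ` T) \<subseteq> fv.span W" by (rule fv.span_minimal) (rule fv.subspace_span)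
  have all: "\<pi> m - \<pi> m' \<in> fv.span W" if "m \<in> ex" "m' \<in> ex" "deg m = deg m'" for m m'
  proof -
    have "\<pi> m - \<pi> m' \<in> fv.span (t ` {r \<in> T. \<forall>a\<in>A'. lk (deg r) a \<le> lk (deg m) a})"
      using that by (intro span) (simp_all add: agree_def)
    moreover have "t ` {r \<in> T. \<forall>a\<in>A'. lk (deg r) a \<le> lk (deg m) a} \<subseteq> t ` T" by (rule image_mono) auto
    ultimately show ?thesis using subsetD[OF fv.span_mono] subsetD[OF TW] by blast
  qed
  \<comment> \<open>The span of \<open>W\<close> contains a diagonal family indexed by
    \<open>N - F - B\<close>, although \<open>W\<close> has fewer elements than \<open>T\<close>,
    and \<open>T\<close> has at most that many.\<close>
  have "\<forall>j\<in>N - F - B. \<exists>y. y \<in> fv.span W \<and> y j \<noteq> 0 \<and> (\<forall>i\<in>N - F - B - {j}. y i = 0)"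
  proof
    fix j assume j: "j \<in> N - F - B"
    then have "j \<in> N - B" by auto
    from rel[OF this] obtain m m' where m: "m \<in> ex" "m' \<in> ex" "deg m = deg m'" "lk m j \<noteq> lk m' j"
      "\<forall>i\<in>N - B - {j}. lk m i = lk m' i" by (elim exE conjE) (rule that)
    show "\<exists>y. y \<in> fv.span W \<and> y j \<noteq> 0 \<and> (\<forall>i\<in>N - F - B - {j}. y i = 0)"
    proof (intro exI[of _ "\<pi> m - \<pi> m'"] conjI ballI)
      show "\<pi> m - \<pi> m' \<in> fv.span W" by (rule all[OF m(1-3)])
      have "\<pi> m'' i = of_nat (lk m'' i)" if "i \<in> N - F - B" for m'' i using that by (simp add: \<pi>_def)
      note p = this
      show "(\<pi> m - \<pi> m') j \<noteq> 0" using m(4) by (simp add: p[OF j])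
      fix i assume i: "i \<in> N - F - B - {j}"
      then have "i \<in> N - F - B" "lk m i = lk m' i" using m(5) by auto
      then show "(\<pi> m - \<pi> m') i = 0" by (simp add: p)
    qed
  qed
  from bchoice[OF this] obtain y where y: "\<forall>j\<in>N - F - B. y j \<in> fv.span W \<and> y j j \<noteq> 0 \<and> (\<forall>i\<in>N - F - B - {j}. y j i = 0)" ..
  have fW: "finite W" using fT by (simp add: W_def)
  have "card (N - F - B) \<le> card W"
    using card_le_of_diagonal[OF fW, of "N - F - B" y "\<lambda>j. j"] y by auto
  also have "\<dots> \<le> card (T - {v})" unfolding W_def by (rule card_image_le) (use fT in simp)
  also have "\<dots> < card T" using fT vT by (intro psubset_card_mono) auto
  finally show False using T_le by simp
qed

end

section \<open>The Krull dimension of the quotient\<close>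

definition lin_ext :: "('k::comm_ring_1 \<Rightarrow> 'r::comm_ring_1) \<Rightarrow> ('m::monoid_add \<Rightarrow> 'r) \<Rightarrow> ('m \<Rightarrow>\<^sub>0 'k) \<Rightarrow> 'r" where
  "lin_ext h \<phi> p = (\<Sum>m\<in>Poly_Mapping.keys p. h (Poly_Mapping.lookup p m) * \<phi> m)"

locale lin_ext_hom =
  fixes h :: "'k::comm_ring_1 \<Rightarrow> 'r::comm_ring_1" and \<phi> :: "'m::monoid_add \<Rightarrow> 'r"
  assumes h: "h 0 = 0" "h 1 = 1" "\<And>a b. h (a + b) = h a + h b" "\<And>a b. h (a * b) = h a * h b"
    and \<phi>: "\<phi> 0 = 1" "\<And>m n. \<phi> (m + n) = \<phi> m * \<phi> n"
begin

lemma superset: "finite A \<Longrightarrow> Poly_Mapping.keys p \<subseteq> A \<Longrightarrow> lin_ext h \<phi> p = (\<Sum>m\<in>A. h (Poly_Mapping.lookup p m) * \<phi> m)"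
  unfolding lin_ext_def by (rule sum.mono_neutral_left) (auto simp: in_keys_iff h)

lemma hom_add: "lin_ext h \<phi> (p + q) = lin_ext h \<phi> p + lin_ext h \<phi> q"
proof -
  let ?A = "Poly_Mapping.keys p \<union> Poly_Mapping.keys q"
  show ?thesis using keys_add[of p q]
    by (simp add: superset[of ?A] lookup_add distrib_right sum.distrib h)
qed

lemma hom_zero: "lin_ext h \<phi> 0 = 0" by (simp add: lin_ext_def)

lemma hom_uminus: "lin_ext h \<phi> (- p) = - lin_ext h \<phi> p"
  using hom_add[of p "- p"] by (simp add: hom_zero minus_unique)

lemma hom_sum: "lin_ext h \<phi> (\<Sum>i\<in>A. f i) = (\<Sum>i\<in>A. lin_ext h \<phi> (f i))"
  by (induction A rule: infinite_finite_induct) (auto simp: hom_add hom_zero)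

lemma hom_single: "lin_ext h \<phi> (Poly_Mapping.single m c) = h c * \<phi> m"
  by (simp add: superset[of "{m}"])

lemma hom_one: "lin_ext h \<phi> 1 = 1"
  using hom_single[of 0 1] by (simp add: h \<phi>)

lemma hom_mult: "lin_ext h \<phi> (p * q) = lin_ext h \<phi> p * lin_ext h \<phi> q"
proof -
  have "p * q = (\<Sum>a\<in>Poly_Mapping.keys p. Poly_Mapping.single a (Poly_Mapping.lookup p a)) *
      (\<Sum>m\<in>Poly_Mapping.keys q. Poly_Mapping.single m (Poly_Mapping.lookup q m))"
    using poly_mapping_expand[of p] poly_mapping_expand[of q] by simp
  also have "lin_ext h \<phi> \<dots> = (\<Sum>a\<in>Poly_Mapping.keys p. \<Sum>m\<in>Poly_Mapping.keys q.
      (h (Poly_Mapping.lookup p a) * \<phi> a) * (h (Poly_Mapping.lookup q m) * \<phi> m))"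
    by (simp add: sum_product hom_sum mult_single hom_single h \<phi> mult_ac)
  also have "\<dots> = lin_ext h \<phi> p * lin_ext h \<phi> q" by (simp add: lin_ext_def sum_product)
  finally show ?thesis .
qed

end

text \<open>The map of monoid algebras induced by a map of exponents. It is used with rational
  exponent vectors in the target, where the algebra is still a domain.\<close>

lemma lin_ext_hom_pushforward:
  fixes L :: "'m::monoid_add \<Rightarrow> 'n::comm_monoid_add"
  assumes "L 0 = 0" "\<And>m n. L (m + n) = L m + L n"
  shows "lin_ext_hom (Poly_Mapping.single 0 :: 'k::comm_ring_1 \<Rightarrow> 'n \<Rightarrow>\<^sub>0 'k) (\<lambda>m. Poly_Mapping.single (L m) 1)"
  by unfold_locales (simp_all add: single_add mult_single assms)

definition mono_eval :: "('x \<Rightarrow> 'r::comm_ring_1) \<Rightarrow> ('x \<Rightarrow>\<^sub>0 nat) \<Rightarrow> 'r" where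
  "mono_eval X m = (\<Prod>x\<in>Poly_Mapping.keys m. X x ^ Poly_Mapping.lookup m x)"

lemma mono_eval_superset: "finite A \<Longrightarrow> Poly_Mapping.keys m \<subseteq> A \<Longrightarrow> mono_eval X m = (\<Prod>x\<in>A. X x ^ Poly_Mapping.lookup m x)"
  unfolding mono_eval_def by (rule prod.mono_neutral_left) (auto simp: in_keys_iff)

lemma mono_eval_add: "mono_eval X (m + n) = mono_eval X m * mono_eval X n"
proof -
  let ?A = "Poly_Mapping.keys m \<union> Poly_Mapping.keys n"
  show ?thesis by (simp add: mono_eval_superset[of ?A] keys_add_nat lookup_add power_add prod.distrib)
qed

lemma mono_eval_zero: "mono_eval X 0 = 1" by (simp add: mono_eval_def)

lemma mono_eval_single: "mono_eval X (Poly_Mapping.single x n) = X x ^ n"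
  by (simp add: mono_eval_superset[of "{x}"])

lemma mono_eval_sum: "mono_eval X (\<Sum>i\<in>A. f i) = (\<Prod>i\<in>A. mono_eval X (f i))"
  by (induction A rule: infinite_finite_induct) (auto simp: mono_eval_add mono_eval_zero)

lemma mpoly_eval_hom: "lin_ext_hom (\<lambda>c. c) (mono_eval X)"
  by unfold_locales (simp_all add: mono_eval_add mono_eval_zero)

lemma mpoly_eval_eq: "mpoly_eval X p = lin_ext (\<lambda>c. c) (mono_eval X) p"
  by (simp add: mpoly_eval_def mpoly_hom_def lin_ext_def mono_eval_def)

definition arc_exp :: "'b set \<Rightarrow> 'b \<Rightarrow>\<^sub>0 nat" where
  "arc_exp c = (\<Sum>a\<in>c. Poly_Mapping.single a 1)"

lemma lookup_arc_exp: "finite c \<Longrightarrow> Poly_Mapping.lookup (arc_exp c) a = of_bool (a \<in> c)"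
  by (simp add: arc_exp_def lookup_sum lookup_single when_def sum.delta)

lemma krull_dim_ge:
  assumes "\<And>i. i \<le> n \<Longrightarrow> primeideal (P i) R" "\<And>i. i < n \<Longrightarrow> P i \<subset> P (Suc i)"
  shows "enat n \<le> krull_dim R"
  unfolding krull_dim_def using assms by (intro SUP_upper) auto

section \<open>A chain of primes from independent cycles\<close>

definition vec :: "'b set \<Rightarrow> 'b \<Rightarrow> rat" where
  "vec c = (\<lambda>a. of_bool (a \<in> c))"

context fin_digraph
begin

abbreviation iss :: "('b, 'k::field) mpoly set" where
  "iss \<equiv> {p \<in> carrier (mpoly_ring (arcs G)).
      \<forall>g X. (\<forall>v\<in>verts G. g v \<noteq> 0) \<longrightarrow> mpoly_eval (rep_act G g X) p = mpoly_eval X p}"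

lemma iss_ring_eq: "iss_ring G = \<lparr>carrier = iss, mult = (*), one = 1, ring.zero = 0, add = (+)\<rparr>"
  by (simp add: iss_ring_def mpoly_ring_def)

lemma iss_closed:
  fixes x y :: "('b, 'k::field) mpoly"
  shows "(0 :: ('b, 'k) mpoly) \<in> iss" "(1 :: ('b, 'k) mpoly) \<in> iss"
    "x \<in> iss \<Longrightarrow> y \<in> iss \<Longrightarrow> x + y \<in> iss" "x \<in> iss \<Longrightarrow> y \<in> iss \<Longrightarrow> x * y \<in> iss" "x \<in> iss \<Longrightarrow> - x \<in> iss"
proof -
  have c: "carrier (mpoly_ring (arcs G)) = {p :: ('b, 'k) mpoly. vars p \<subseteq> arcs G}" by (simp add: mpoly_ring_def)
  interpret E: lin_ext_hom "\<lambda>c. c :: 'k" "mono_eval X" for X :: "'b \<Rightarrow> 'k" by (rule mpoly_eval_hom)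
  show "(0 :: ('b, 'k) mpoly) \<in> iss" by (simp add: c vars_def mpoly_eval_eq E.hom_zero)
  show "(1 :: ('b, 'k) mpoly) \<in> iss" by (simp add: c vars_one mpoly_eval_eq E.hom_one)
  assume x: "x \<in> iss"
  show "- x \<in> iss" using x by (simp add: c vars_uminus mpoly_eval_eq E.hom_uminus)
  assume y: "y \<in> iss"
  have "vars (x + y) \<subseteq> arcs G" "vars (x * y) \<subseteq> arcs G" using vars_add[of x y] vars_mult[of x y] x y unfolding c by blast+
  then show "x + y \<in> iss" "x * y \<in> iss" using x y by (simp_all add: c mpoly_eval_eq E.hom_add E.hom_mult)
qed

lemma iss_ring_cring: "cring (iss_ring G :: ('b, 'k::field) mpoly ring)"
  by (rule cring_of_closed[OF iss_closed iss_ring_eq])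

text \<open>The weights of the group action cancel, because the heads and the tails of a cycle run
  through the same vertices, each once.\<close>

lemma cycle_monomial_iss:
  assumes "c \<in> cycs G"
  shows "(Poly_Mapping.single (arc_exp c) 1 :: ('b, 'k::field) mpoly) \<in> iss"
proof -
  interpret E: lin_ext_hom "\<lambda>c. c :: 'k" "mono_eval X" for X :: "'b \<Rightarrow> 'k" by (rule mpoly_eval_hom)
  obtain p where p: "cycle p" "c = set p" using assms by (auto simp: cycs_def)
  have ev: "mpoly_eval X (Poly_Mapping.single (arc_exp c) 1) = (\<Prod>a\<in>c. X a)" for X :: "'b \<Rightarrow> 'k"
    by (simp add: mpoly_eval_eq E.hom_single arc_exp_def mono_eval_sum mono_eval_single)
  have "(\<Prod>a\<in>c. rep_act G g X a) = (\<Prod>a\<in>c. X a)" if g: "\<forall>v\<in>verts G. g v \<noteq> 0" for g and X :: "'b \<Rightarrow> 'k"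
  proof -
    have inj: "inj_on (head G) c" "inj_on (tail G) c" using cycle_distinct[OF p(1)] p(2) by (auto simp: distinct_map)
    have "(\<Prod>a\<in>c. g (head G a)) = (\<Prod>v\<in>head G ` c. g v)" using inj(1) by (simp add: prod.reindex)
    also have "\<dots> = (\<Prod>v\<in>tail G ` c. g v)" using cycle_heads[OF p(1)] p(2) by simp
    also have "\<dots> = (\<Prod>a\<in>c. g (tail G a))" using inj(2) by (simp add: prod.reindex)
    finally have eq: "(\<Prod>a\<in>c. g (head G a)) = (\<Prod>a\<in>c. g (tail G a))" .
    have "(\<Prod>a\<in>c. g (tail G a)) \<noteq> 0" using g cycs_sub(1)[OF assms] p(2) by (auto simp: prod_zero_iff)
    moreover have "(\<Prod>a\<in>c. inverse (g (tail G a))) = inverse (\<Prod>a\<in>c. g (tail G a))"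
      using prod_inversef[of "\<lambda>a. g (tail G a)" c] by (simp add: o_def)
    ultimately show ?thesis by (simp add: rep_act_def prod.distrib eq)
  qed
  moreover have "vars (Poly_Mapping.single (arc_exp c) (1 :: 'k)) \<subseteq> arcs G"
  proof -
    have "finite c" using p by simp
    then have "Poly_Mapping.keys (arc_exp c) \<subseteq> c" by (auto simp: in_keys_iff lookup_arc_exp)
    then show ?thesis using vars_single[of "arc_exp c" "1 :: 'k"] cycs_sub(1)[OF assms] by blast
  qed
  ultimately show ?thesis by (simp add: ev mpoly_ring_def)
qed

text \<open>Exponents are read in coordinates dual to the independent cycles. Forgetting these
  coordinates one at a time gives kernels of maps to domains, that is, a chain of
  \<open>card C + 1\<close> primes.\<close>

lemma krull_dim_iss_ring_ge:
  assumes C: "C \<subseteq> cycs G" and inj: "inj_on vec C" and ind: "fv.independent (vec ` C)"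
  shows "enat (card C) \<le> krull_dim (iss_ring G :: ('b, 'k::field) mpoly ring)"
proof -
  define r where "r = card C"
  have "finite C" using C finite_cycs finite_subset by blast
  then obtain f where f: "bij_betw f {0..<r} C" using ex_bij_betw_nat_finite unfolding r_def by blast
  have fC: "f i \<in> C" if "i < r" for i using f that by (auto simp: bij_betw_def)
  define bs where "bs = fv.extend_basis (vec ` C)"
  have bs: "fv.independent bs" "fv.span bs = UNIV" "vec ` C \<subseteq> bs"
    using fv.independent_extend_basis[OF ind] fv.span_extend_basis[OF ind] fv.extend_basis_superset[OF ind]
    by (simp_all add: bs_def)
  define cf :: "('b \<Rightarrow>\<^sub>0 nat) \<Rightarrow> 'b \<Rightarrow> rat" where "cf m = (\<lambda>a. of_nat (Poly_Mapping.lookup m a))" for m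
  define co where "co m i = fv.representation bs (cf m) (vec (f i))" for m i
  have cf_add: "cf (m + n) = cf m + cf n" for m n by (simp add: cf_def lookup_add fun_eq_iff)
  have co_add: "co (m + n) i = co m i + co n i" for m n i
    unfolding co_def cf_add using fv.representation_add[OF bs(1), of "cf n" "cf m"] bs(2) by simp
  have co_zero: "co 0 i = 0" for i using co_add[of 0 0 i] by simp
  have co_cycle: "co (arc_exp (f j)) i = of_bool (i = j)" if "i < r" "j < r" for i j
  proof -
    have "finite (f j)" using fC[OF that(2)] C cycs_sub(1) finite_arcs finite_subset by (meson subsetD)
    then have "cf (arc_exp (f j)) = vec (f j)" by (simp add: cf_def vec_def lookup_arc_exp fun_eq_iff)
    moreover have "vec (f j) \<in> bs" using fC[OF that(2)] bs(3) by blast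
    moreover have "vec (f i) = vec (f j) \<longleftrightarrow> i = j"
      using inj f that by (auto simp: bij_betw_def inj_on_def)
    ultimately show ?thesis by (auto simp: co_def fv.representation_basis[OF bs(1)])
  qed
  \<comment> \<open>The coordinates from \<open>j\<close> on. They may be negative or fractional,
    hence the rational exponents in the target of \<open>\<psi> j\<close>.\<close>
  define L where "L j m = (\<Sum>i\<in>{j..<r}. Poly_Mapping.single i (co m i))" for j m
  have L_hom: "L j 0 = 0" "L j (m + n) = L j m + L j n" for j m n
    by (simp_all add: L_def co_zero co_add single_add sum.distrib)
  define \<psi> :: "nat \<Rightarrow> ('b, 'k) mpoly \<Rightarrow> (nat \<Rightarrow>\<^sub>0 rat) \<Rightarrow>\<^sub>0 'k" where
    "\<psi> j = lin_ext (Poly_Mapping.single 0) (\<lambda>m. Poly_Mapping.single (L j m) 1)" for j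
  interpret H: lin_ext_hom "Poly_Mapping.single 0 :: 'k \<Rightarrow> (nat \<Rightarrow>\<^sub>0 rat) \<Rightarrow>\<^sub>0 'k" "\<lambda>m. Poly_Mapping.single (L j m) 1" for j
    by (rule lin_ext_hom_pushforward) (rule L_hom)+
  define P where "P j = {p \<in> iss. \<psi> j p = 0}" for j
  have one_nz: "\<psi> j 1 \<noteq> 0" for j by (simp add: \<psi>_def H.hom_one)
  interpret R: cring "iss_ring G :: ('b, 'k) mpoly ring" by (rule iss_ring_cring)
  have prime: "primeideal (P j) (iss_ring G)" for j
  proof (rule primeidealI)
    show "ideal (P j) (iss_ring G)"
    proof (rule ideal_of_closed[OF iss_ring_cring iss_ring_eq])
      show "0 \<in> P j" using R.zero_closed by (simp add: P_def \<psi>_def H.hom_zero iss_ring_eq)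
      show "x + y \<in> P j" if "x \<in> P j" "y \<in> P j" for x y
        using that R.a_closed[of x y] by (simp add: P_def \<psi>_def H.hom_add iss_ring_eq)
      show "q * x \<in> P j" if "q \<in> iss" "x \<in> P j" for q x
        using that R.m_closed[of q x] by (simp add: P_def \<psi>_def H.hom_mult iss_ring_eq)
    qed (auto simp: P_def)
    show "cring (iss_ring G :: ('b, 'k) mpoly ring)" by (rule iss_ring_cring)
    show "carrier (iss_ring G) \<noteq> P j" using R.one_closed one_nz[of j] by (auto simp: P_def iss_ring_eq)
    show "x \<in> P j \<or> y \<in> P j" if "x \<in> carrier (iss_ring G)" "y \<in> carrier (iss_ring G)" "x \<otimes>\<^bsub>iss_ring G\<^esub> y \<in> P j" for x y
    proof -
      have "\<psi> j x * \<psi> j y = 0" using that(3) by (simp add: P_def \<psi>_def H.hom_mult iss_ring_eq)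
      then have "\<psi> j x = 0 \<or> \<psi> j y = 0" by simp
      then show ?thesis using that(1,2) by (auto simp: P_def iss_ring_eq)
    qed
  qed
  have sub: "P j \<subset> P (Suc j)" if j: "j < r" for j
  proof
    \<comment> \<open>The map \<open>\<pi>\<close> forgets coordinate \<open>j\<close>, so
      \<open>\<psi> (Suc j)\<close> factors through \<open>\<psi> j\<close>.\<close>
    define \<pi> :: "(nat \<Rightarrow>\<^sub>0 rat) \<Rightarrow> nat \<Rightarrow>\<^sub>0 rat" where "\<pi> d = d - Poly_Mapping.single j (Poly_Mapping.lookup d j)" for d
    have \<pi>_hom: "\<pi> 0 = 0" "\<pi> (d + e) = \<pi> d + \<pi> e" for d e
      by (simp_all add: \<pi>_def lookup_add single_add)
    interpret Q: lin_ext_hom "Poly_Mapping.single 0 :: 'k \<Rightarrow> (nat \<Rightarrow>\<^sub>0 rat) \<Rightarrow>\<^sub>0 'k" "\<lambda>m. Poly_Mapping.single (\<pi> m) 1"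
      by (rule lin_ext_hom_pushforward) (rule \<pi>_hom)+
    have "L j m = Poly_Mapping.single j (co m j) + L (Suc j) m" for m
      unfolding L_def using j by (simp add: sum.atLeast_Suc_lessThan)
    moreover have "Poly_Mapping.lookup (L (Suc j) m) j = 0" for m
      unfolding L_def by (simp add: lookup_sum lookup_single when_def)
    ultimately have \<pi>L: "\<pi> (L j m) = L (Suc j) m" for m by (simp add: \<pi>_def lookup_add)
    have "lin_ext (Poly_Mapping.single 0) (\<lambda>m. Poly_Mapping.single (\<pi> m) 1) (\<psi> j p) = \<psi> (Suc j) p" for p
      by (simp add: \<psi>_def lin_ext_def[of _ "\<lambda>m. Poly_Mapping.single (L _ m) 1"] Q.hom_sum Q.hom_mult Q.hom_single \<pi>_hom \<pi>L mult_single)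
    note comp = this
    have "\<psi> (Suc j) p = 0" if "\<psi> j p = 0" for p using comp[of p] unfolding that Q.hom_zero by simp
    then show "P j \<subseteq> P (Suc j)" unfolding P_def by blast
    \<comment> \<open>The monomial of the cycle \<open>f j\<close> has \<open>j\<close> as its only
      nonzero coordinate, so it becomes 1 exactly when that coordinate is forgotten.\<close>
    define x where "x = Poly_Mapping.single (arc_exp (f j)) 1 - (1 :: ('b, 'k) mpoly)"
    have fj: "f j \<in> cycs G" using fC[OF j] C by blast
    have "x \<in> iss"
      unfolding x_def diff_conv_add_uminus by (intro iss_closed cycle_monomial_iss fj)
    moreover have "\<psi> i x = Poly_Mapping.single (L i (arc_exp (f j))) 1 - 1" for i
      using H.hom_add[of i x 1] by (simp add: x_def \<psi>_def H.hom_one H.hom_single mult_single)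
    moreover have "L (Suc j) (arc_exp (f j)) = 0"
      unfolding L_def using co_cycle[OF _ j] by (intro sum.neutral) simp
    moreover have "Poly_Mapping.lookup (L j (arc_exp (f j))) j = 1"
      unfolding L_def using co_cycle[OF j j] j by (simp add: lookup_sum lookup_single when_def sum.delta)
    then have "L j (arc_exp (f j)) \<noteq> 0" by auto
    then have "Poly_Mapping.single (L j (arc_exp (f j))) (1 :: 'k) \<noteq> 1"
    proof (rule contrapos_nn)
      assume "Poly_Mapping.single (L j (arc_exp (f j))) (1 :: 'k) = 1"
      from arg_cong[OF this, of "\<lambda>p. Poly_Mapping.lookup p 0"] show "L j (arc_exp (f j)) = 0"
        by (simp add: lookup_single lookup_one when_def split: if_splits)
    qed
    ultimately have "x \<in> P (Suc j)" "x \<notin> P j" by (simp_all add: P_def)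
    then show "P j \<noteq> P (Suc j)" by blast
  qed
  show ?thesis unfolding r_def[symmetric] by (rule krull_dim_ge[of r P]) (use prime sub in auto)
qed

end

section \<open>Complete intersections are rigid\<close>

lemma common_denominator:
  fixes u :: "'x \<Rightarrow> rat"
  assumes "finite A"
  shows "\<exists>d::nat. d > 0 \<and> (\<forall>v\<in>A. \<exists>z::int. of_nat d * u v = of_int z)"
  using assms
proof (induction A rule: finite_induct)
  case empty
  show ?case by (intro exI[of _ 1]) simp
next
  case (insert x A)
  then obtain d :: nat where d: "d > 0" "\<forall>v\<in>A. \<exists>z::int. of_nat d * u v = of_int z" by auto
  obtain p q where pq: "quotient_of (u x) = (p, q)" by (cases "quotient_of (u x)")
  have q: "q > 0" "u x = of_int p / of_int q" using quotient_of_denom_pos[OF pq] quotient_of_div[OF pq] by auto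
  define e where "e = nat q"
  have e: "e > 0" "of_nat e * u x = of_int p" using q by (simp_all add: e_def of_nat_nat)
  show ?case
  proof (intro exI[of _ "d * e"] conjI ballI)
    show "0 < d * e" using d e by simp
    fix v assume "v \<in> insert x A"
    then consider "v = x" | "v \<in> A" by blast
    then show "\<exists>z::int. of_nat (d * e) * u v = of_int z"
    proof cases
      case 1
      then have "of_nat (d * e) * u v = of_int (int d * p)" using e(2) by (simp add: mult.assoc)
      then show ?thesis ..
    next
      case 2
      then obtain z :: int where "of_nat d * u v = of_int z" using d(2) by blast
      then have "of_nat (d * e) * u v = of_int (int e * z)" by (simp add: mult.commute mult.left_commute)
      then show ?thesis ..
    qed
  qed
qed

lemma flow_replicate: "flow (replicate_mset n d) a = n * of_bool (a \<in> d)"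
  by (induction n) auto

lemma flow_sum: "flow (\<Sum>i\<in>A. f i) a = (\<Sum>i\<in>A. flow (f i) a)"
  by (induction A rule: infinite_finite_induct) (auto simp: flow_union)

text \<open>Chooses a variable \<open>l c\<close> for each member \<open>c\<close> of the multiset.
  Two choices occur: the cycle with arc set \<open>c\<close>, and a cycle with trace
  \<open>c\<close> on the remaining arcs.\<close>

definition exponent :: "('b set \<Rightarrow> 'i) \<Rightarrow> 'b set multiset \<Rightarrow> 'i \<Rightarrow>\<^sub>0 nat" where
  "exponent l w = (\<Sum>c\<in>#w. Poly_Mapping.single (l c) 1)"

lemma exponent_simps [simp]: "exponent l {#} = 0" "exponent l (add_mset c w) = Poly_Mapping.single (l c) 1 + exponent l w"
  and exponent_union: "exponent l (w + w') = exponent l w + exponent l w'"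
  by (simp_all add: exponent_def)

context toric
begin

lemma lookup_deg_single: "i \<in> N \<Longrightarrow> lk (deg (Poly_Mapping.single i n)) a = n * of_bool (a \<in> D i)"
proof -
  assume i: "i \<in> N"
  have "Poly_Mapping.single i n \<in> ex" using i by (auto simp: ex_def)
  then have "lk (deg (Poly_Mapping.single i n)) a = (\<Sum>j\<in>N. lk (Poly_Mapping.single i n) j * of_bool (a \<in> D j))" by (rule lookup_deg)
  also have "\<dots> = (\<Sum>j\<in>{i}. lk (Poly_Mapping.single i n) j * of_bool (a \<in> D j))"
    using i finite_N by (intro sum.mono_neutral_right) (auto simp: lookup_single)
  finally show ?thesis by simp
qed

lemma single_ex: "i \<in> N \<Longrightarrow> Poly_Mapping.single i n \<in> ex"
  by (auto simp: ex_def)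

lemma ex_zero: "0 \<in> ex" by (simp add: ex_def)

lemma lookup_deg_add: "m \<in> ex \<Longrightarrow> m' \<in> ex \<Longrightarrow> lk (deg (m + m')) a = lk (deg m) a + lk (deg m') a"
  by (simp add: deg_add lookup_add)

lemma lookup_deg_zero: "lk (deg 0) a = 0"
  by (simp add: lookup_deg[OF ex_zero])

lemma deg_sum:
  assumes "\<And>x. x \<in> A \<Longrightarrow> f x \<in> ex"
  shows "sum f A \<in> ex \<and> lk (deg (sum f A)) a = (\<Sum>x\<in>A. lk (deg (f x)) a)"
  using assms by (induction A rule: infinite_finite_induct) (simp_all add: ex_zero lookup_deg_zero ex_add lookup_deg_add)

lemma exponent_deg:
  assumes "\<And>c. c \<in># w \<Longrightarrow> l c \<in> N \<and> (a \<in> D (l c) \<longleftrightarrow> a \<in> c)"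
  shows "lk (deg (exponent l w)) a = flow w a"
proof -
  have "exponent l w \<in> ex \<and> lk (deg (exponent l w)) a = flow w a"
    using assms by (induction w) (simp_all add: ex_zero lookup_deg_zero ex_add lookup_deg_add single_ex lookup_deg_single)
  then show ?thesis ..
qed

lemma exponent_keys: "l ` set_mset w \<subseteq> X \<Longrightarrow> kys (exponent l w) \<subseteq> X"
  by (induction w) (auto simp: keys_add_nat)

text \<open>A rational dependence is multiplied by a common denominator \<open>d\<close>; the
  negative coefficients are moved to the side with \<open>d\<close> copies of the variable
  \<open>j\<close>.\<close>

lemma relation_of_span:
  assumes B: "B \<subseteq> N" and j: "j \<in> N" "j \<notin> B" and s: "vec (D j) \<in> fv.span (vec ` D ` B)"
  shows "\<exists>m m'. kys m \<subseteq> insert j B \<and> kys m' \<subseteq> B \<and> deg m = deg m' \<and> lk m j \<noteq> 0"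
proof -
  define V where "V = vec ` D ` B"
  have fV: "finite V" using finite_subset[OF B finite_N] by (simp add: V_def)
  obtain u where u: "vec (D j) = (\<Sum>v\<in>V. (\<lambda>x. u v * v x))"
    using s fv.span_finite[OF fV] by (auto simp: V_def)
  have "\<forall>v\<in>V. \<exists>i. i \<in> B \<and> vec (D i) = v" by (auto simp: V_def)
  from bchoice[OF this] obtain h where h: "\<forall>v\<in>V. h v \<in> B \<and> vec (D (h v)) = v" ..
  obtain d :: nat where d: "d > 0" "\<forall>v\<in>V. \<exists>z::int. of_nat d * u v = of_int z"
    using common_denominator[OF fV] by blast
  from bchoice[OF d(2)] obtain z :: "('b \<Rightarrow> rat) \<Rightarrow> int" where z: "\<forall>v\<in>V. of_nat d * u v = of_int (z v)" ..
  define n where "n = (\<Sum>v\<in>V. Poly_Mapping.single (h v) (nat (- z v)))"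
  define m' where "m' = (\<Sum>v\<in>V. Poly_Mapping.single (h v) (nat (z v)))"
  define m where "m = Poly_Mapping.single j d + n"
  have hN: "h v \<in> N" if "v \<in> V" for v using h that B by blast
  have ks: "kys (\<Sum>v\<in>V. Poly_Mapping.single (h v) (f v)) \<subseteq> B" for f :: "('b \<Rightarrow> rat) \<Rightarrow> nat"
    by (rule order_trans[OF keys_sum]) (use h in auto)
  have ds: "(\<Sum>v\<in>V. Poly_Mapping.single (h v) (f v)) \<in> ex
    \<and> lk (deg (\<Sum>v\<in>V. Poly_Mapping.single (h v) (f v))) a = (\<Sum>v\<in>V. f v * of_bool (a \<in> D (h v)))"
    for f :: "('b \<Rightarrow> rat) \<Rightarrow> nat" and a
  proof -
    have "(\<Sum>v\<in>V. lk (deg (Poly_Mapping.single (h v) (f v))) a) = (\<Sum>v\<in>V. f v * of_bool (a \<in> D (h v)))"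
      by (rule sum.cong[OF refl]) (rule lookup_deg_single[OF hN])
    then show ?thesis using deg_sum[of V "\<lambda>v. Poly_Mapping.single (h v) (f v)" a] single_ex[OF hN] by simp
  qed
  have kn: "kys n \<subseteq> B" "kys m' \<subseteq> B" unfolding n_def m'_def by (rule ks)+
  have nex: "n \<in> ex" "m' \<in> ex" unfolding n_def m'_def by (rule ds[THEN conjunct1])+
  have "deg m = deg m'"
  proof (rule poly_mapping_eqI)
    fix a
    have ob: "of_bool (a \<in> D (h v)) = v a" if "v \<in> V" for v
    proof -
      have "vec (D (h v)) a = v a" using h that by simp
      then show ?thesis by (simp only: vec_def)
    qed
    have dv: "rat_of_nat (\<Sum>v\<in>V. f v * of_bool (a \<in> D (h v))) = (\<Sum>v\<in>V. of_nat (f v) * v a)" for f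
      unfolding of_nat_sum of_nat_mult of_nat_of_bool by (rule sum.cong[OF refl]) (simp add: ob)
    have "rat_of_nat (lk (deg m) a) = of_nat d * vec (D j) a + rat_of_nat (lk (deg n) a)"
      unfolding m_def lookup_deg_add[OF single_ex[OF j(1)] nex(1)] lookup_deg_single[OF j(1)] by (simp add: vec_def)
    also have "rat_of_nat (lk (deg n) a) = (\<Sum>v\<in>V. of_nat (nat (- z v)) * v a)"
      unfolding n_def using ds[of "\<lambda>v. nat (- z v)" a] dv by simp
    also have "vec (D j) a = (\<Sum>v\<in>V. u v * v a)" using u by (simp add: sum_fun_eval)
    also have "of_nat d * (\<Sum>v\<in>V. u v * v a) = (\<Sum>v\<in>V. of_int (z v) * v a)"
      unfolding sum_distrib_left mult.assoc[symmetric] using z by (intro sum.cong refl) simp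
    also have "(\<Sum>v\<in>V. of_int (z v) * v a) + (\<Sum>v\<in>V. of_nat (nat (- z v)) * v a)
        = (\<Sum>v\<in>V. of_nat (nat (z v)) * v a)"
      unfolding sum.distrib[symmetric] distrib_right[symmetric]
    proof (rule sum.cong[OF refl])
      fix v
      have "rat_of_int (z v) + of_nat (nat (- z v)) = of_nat (nat (z v))"
        by (cases "z v \<ge> 0") (simp_all add: of_nat_nat)
      then show "(rat_of_int (z v) + of_nat (nat (- z v))) * v a = of_nat (nat (z v)) * v a" by simp
    qed
    also have "\<dots> = rat_of_nat (lk (deg m') a)"
      unfolding m'_def using ds[of "\<lambda>v. nat (z v)" a] dv[of "\<lambda>v. nat (z v)"] by simp
    finally show "lk (deg m) a = lk (deg m') a" by simp
  qed
  moreover have "kys m \<subseteq> insert j B" using kn(1) by (auto simp: m_def keys_add_nat split: if_splits)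
  moreover have "lk m j \<noteq> 0" using d(1) by (simp add: m_def lookup_add)
  ultimately show ?thesis using kn(2) by blast
qed

end

context fin_digraph
begin

section \<open>The cycle ideal as a toric ideal\<close>

lemma cycle_arcs_rotations: "cycle_arcs (range (\<lambda>i. rotate i p)) = set p"
  by (auto simp: cycle_arcs_def)

lemma cycle_arcs_primitive: "cycle_arcs ` primitive_cycles G = cycs G"
  by (auto simp: primitive_cycles_def cycs_def cycle_arcs_rotations image_image)

lemma finite_primitive_cycles: "finite (primitive_cycles G)"
proof -
  have "{p. cycle p} \<subseteq> {p. set p \<subseteq> arcs G \<and> distinct p}" using cycle_arcs_sub cycle_distinct by auto
  then show ?thesis unfolding primitive_cycles_def using finite_subset_distinct[OF finite_arcs]
    by (auto intro: finite_subset)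
qed

lemma toric_primitive_cycles: "toric (primitive_cycles G) cycle_arcs"
proof
  fix i assume "i \<in> primitive_cycles G"
  then have "cycle_arcs i \<subseteq> arcs G" using cycle_arcs_primitive cycs_sub(1) by blast
  then show "finite (cycle_arcs i)" using finite_arcs finite_subset by blast
qed (rule finite_primitive_cycles)

lemma Var_prod_power:
  "(\<Prod>a\<in>A. Var a) ^ n = (Poly_Mapping.single (\<Sum>a\<in>A. Poly_Mapping.single a n) 1 :: ('b, 'k::comm_ring_1) mpoly)"
proof -
  have "Var a ^ n = (Poly_Mapping.single (Poly_Mapping.single a n) 1 :: ('b, 'k) mpoly)" for a
    by (induction n) (simp_all add: Var_def mult_single single_add[symmetric])
  then have "(\<Prod>a\<in>A. Var a) ^ n = (\<Prod>a\<in>A. (Poly_Mapping.single (Poly_Mapping.single a n) 1 :: ('b, 'k) mpoly))"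
    by (simp add: prod_power_distrib)
  also have "\<dots> = Poly_Mapping.single (\<Sum>a\<in>A. Poly_Mapping.single a n) 1"
    by (induction A rule: infinite_finite_induct) (simp_all add: mult_single)
  finally show ?thesis .
qed

lemma cycle_ideal_eq: "cycle_ideal G = (toric.ker (primitive_cycles G) cycle_arcs :: ('b list set, 'k::field) mpoly set)"
proof -
  interpret toric "primitive_cycles G" cycle_arcs by (rule toric_primitive_cycles)
  have mono: "(\<Prod>c\<in>kys m. cycle_monom c ^ lk m c) = (Poly_Mapping.single (deg m) 1 :: ('b, 'k) mpoly)" for m
  proof -
    have "(\<Prod>c\<in>X. Poly_Mapping.single (f c) 1) = (Poly_Mapping.single (\<Sum>c\<in>X. f c) 1 :: ('b, 'k) mpoly)" for X :: "'b list set set" and f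
      by (induction X rule: infinite_finite_induct) (simp_all add: mult_single)
    then show ?thesis by (simp add: cycle_monom_def Var_prod_power deg_def)
  qed
  have "cycle_hom p = (\<Sum>m\<in>kys p. Poly_Mapping.single (deg m) (lk p m))" for p :: "('b list set, 'k) mpoly"
    by (simp add: cycle_hom_def mpoly_hom_def mono Const_def mult_single)
  then have "lk (cycle_hom p) d = wsum (\<lambda>m. of_bool (deg m = d)) p" for p :: "('b list set, 'k) mpoly" and d
    by (simp add: lookup_sum lookup_single wsum_def when_def of_bool_def if_distrib cong: if_cong)
  then have "cycle_hom p = 0 \<longleftrightarrow> (\<forall>d. wsum (\<lambda>m. of_bool (deg m = d)) p = 0)" for p :: "('b list set, 'k) mpoly"
    by (simp add: poly_mapping_eq_iff fun_eq_iff)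
  then show ?thesis
    by (auto simp: cycle_ideal_def a_kernel_def kernel_def ker_def mpoly_ring_def iss_ring_def)
qed

text \<open>One basis \<open>B\<close> of the cycle vectors serves both counts: its size bounds the
  dimension from below, hence the number of generators from above, and its complement indexes
  independent relations. This puts \<open>c1 c2\<close> and \<open>v\<close> in one component of a
  fibre; following the connecting steps on traces then shows that a product of two indecomposable
  members cannot change.\<close>

theorem rigid_of_complete_intersection:
  assumes ci: "complete_intersection TYPE('k::field_char_0) G" and desc: "descends (cycs G) A' C'"
    and anti: "\<And>c d. c \<in> C' \<Longrightarrow> d \<in> C' \<Longrightarrow> c \<subseteq> d \<Longrightarrow> c = d" and ne: "{} \<notin> C'"
  shows "rigid C'"
proof -
  let ?N = "primitive_cycles G"
  interpret toric ?N cycle_arcs A' by (rule toric_primitive_cycles)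
  obtain S :: "('b list set, 'k) mpoly set" where S: "finite S" "S \<subseteq> carrier (mpoly_ring ?N)"
    "ker = Idl\<^bsub>mpoly_ring ?N\<^esub> S"
    "enat (card S) + krull_dim (iss_ring G :: ('b, 'k) mpoly ring) \<le> enat (card ?N)"
    using ci unfolding complete_intersection_def cycle_ideal_eq by (elim exE conjE) (rule that)
  have F_sub: "F \<subseteq> ?N" by (auto simp: F_def)
  obtain ix where ix: "\<And>d. d \<in> cycs G \<Longrightarrow> ix d \<in> ?N \<and> cycle_arcs (ix d) = d"
  proof -
    have "\<forall>d\<in>cycs G. \<exists>i. i \<in> ?N \<and> cycle_arcs i = d" by (auto simp flip: cycle_arcs_primitive)
    from bchoice[OF this] show thesis using that by blast
  qed
  \<comment> \<open>A basis of the inverted cycles comes first and is then extended, so that an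
    inverted cycle outside \<open>B\<close> satisfies a relation with inverted cycles only.\<close>
  obtain BF where BF: "BF \<subseteq> vec ` cycle_arcs ` F" "fv.independent BF" "vec ` cycle_arcs ` F \<subseteq> fv.span BF"
    using fv.maximal_independent_subset[of "vec ` cycle_arcs ` F"] by blast
  have "BF \<subseteq> vec ` cycle_arcs ` ?N" using BF(1) F_sub by blast
  from fv.maximal_independent_subset_extend[OF this BF(2)]
  obtain BV where BV: "BF \<subseteq> BV" "BV \<subseteq> vec ` cycle_arcs ` ?N" "fv.independent BV" "vec ` cycle_arcs ` ?N \<subseteq> fv.span BV"
    by blast
  have vinj: "c = d" if "vec c = vec d" for c d :: "'b set"
  proof (rule Set.set_eqI)
    show "a \<in> c \<longleftrightarrow> a \<in> d" for a using fun_cong[OF that, of a] by (simp add: vec_def of_bool_eq_iff)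
  qed
  have "\<forall>b\<in>BV. \<exists>i. i \<in> ?N \<and> vec (cycle_arcs i) = b" using BV(2) by auto
  from bchoice[OF this] obtain g where g: "\<forall>b\<in>BV. g b \<in> ?N \<and> vec (cycle_arcs (g b)) = b" ..
  define B where "B = g ` BV"
  have BN: "B \<subseteq> ?N" using g by (auto simp: B_def)
  have vB: "vec ` cycle_arcs ` B = BV" using g by (force simp: B_def)
  have inj: "inj_on (vec \<circ> cycle_arcs) B" using g by (auto simp: B_def inj_on_def)
  have "inj_on cycle_arcs B" using inj by (auto simp: inj_on_def)
  then have "card (cycle_arcs ` B) = card B" by (rule card_image)
  moreover have "cycle_arcs ` B \<subseteq> cycs G" using BN by (auto simp flip: cycle_arcs_primitive)
  moreover have "inj_on vec (cycle_arcs ` B)" using vinj by (auto intro: inj_onI)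
  ultimately have "enat (card B) \<le> krull_dim (iss_ring G :: ('b, 'k) mpoly ring)"
    using krull_dim_iss_ring_ge[of "cycle_arcs ` B"] vB BV(3) by simp
  then have "enat (card S) + enat (card B) \<le> enat (card ?N)" using S(4) by (meson add_left_mono order_trans)
  then have card: "card S + card B \<le> card ?N" by simp
  have rel: "\<exists>m m'. m \<in> ex \<and> m' \<in> ex \<and> deg m = deg m' \<and> lk m j \<noteq> lk m' j
      \<and> (\<forall>i\<in>?N - B - {j}. lk m i = lk m' i) \<and> (j \<in> F \<longrightarrow> kys m \<subseteq> F \<and> kys m' \<subseteq> F)" if j: "j \<in> ?N - B" for j
  proof -
    define B0 where "B0 = (if j \<in> F then B \<inter> F else B)"
    have sp: "vec (cycle_arcs j) \<in> fv.span (vec ` cycle_arcs ` B0)"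
    proof (cases "j \<in> F")
      case True
      have "BF \<subseteq> vec ` cycle_arcs ` (B \<inter> F)"
      proof
        fix b assume b: "b \<in> BF"
        then obtain i where i: "i \<in> F" "b = vec (cycle_arcs i)" using BF(1) by auto
        have gb: "g b \<in> ?N" "vec (cycle_arcs (g b)) = b" using g b BV(1) by auto
        then have "cycle_arcs (g b) = cycle_arcs i" using i(2) vinj by metis
        then have "g b \<in> B \<inter> F" using gb(1) i(1) b BV(1) by (auto simp: B_def F_def)
        then show "b \<in> vec ` cycle_arcs ` (B \<inter> F)" using gb(2) by (metis imageI)
      qed
      then have "fv.span BF \<subseteq> fv.span (vec ` cycle_arcs ` (B \<inter> F))" by (rule fv.span_mono)
      then show ?thesis using True BF(3) by (auto simp: B0_def)
    next
      case False
      then show ?thesis using BV(4) vB j by (auto simp: B0_def)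
    qed
    have B0N: "B0 \<subseteq> ?N" "j \<in> ?N" "j \<notin> B0" using BN j by (auto simp: B0_def)
    from relation_of_span[OF B0N sp] obtain m m' where m: "kys m \<subseteq> insert j B0" "kys m' \<subseteq> B0" "deg m = deg m'" "lk m j \<noteq> 0"
      by (elim exE conjE) (rule that)
    have B0: "B0 \<subseteq> B" "j \<in> F \<Longrightarrow> B0 \<subseteq> F" by (auto simp: B0_def)
    have jm: "j \<notin> kys m'" using m(2) B0N(3) by blast
    have "lk m i = lk m' i" if "i \<in> ?N - B - {j}" for i
    proof -
      have "i \<notin> kys m" "i \<notin> kys m'" using that m(1,2) B0(1) by blast+
      then show ?thesis by (simp add: in_keys_iff)
    qed
    moreover have "m \<in> ex" "m' \<in> ex" unfolding ex_def using m(1,2) B0N(1,2) by blast+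
    moreover have "lk m j \<noteq> lk m' j" using m(4) jm by (simp add: in_keys_iff)
    moreover have "j \<in> F \<longrightarrow> kys m \<subseteq> F \<and> kys m' \<subseteq> F" using m(1,2) B0(2) by blast
    ultimately show ?thesis using m(3) by (intro exI[of _ m] exI[of _ m']) simp
  qed
  define img where "img m = (\<Sum>i\<in>?N. replicate_mset (lk m i) (cycle_arcs i))" for m
  have img: "set_mset (img m) \<subseteq> cycs G" "m \<in> ex \<Longrightarrow> flow (img m) a = lk (deg m) a" for m a
  proof -
    have "set_mset (\<Sum>i\<in>A. replicate_mset (lk m i) (cycle_arcs i)) \<subseteq> cycle_arcs ` A" if "finite A" for A
      using that by (induction A) (auto split: if_splits)
    then show "set_mset (img m) \<subseteq> cycs G" unfolding img_def cycle_arcs_primitive[symmetric] using finite_N by simp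
    show "flow (img m) a = lk (deg m) a" if "m \<in> ex"
      using that by (simp add: img_def flow_sum flow_replicate lookup_deg)
  qed
  \<comment> \<open>The third clause of \<open>descends\<close>, translated from multisets to
    exponent vectors: equal degree on \<open>A'\<close> becomes equal degree after multiplication by
    units.\<close>
  have lift: "\<exists>x x'. kys x \<subseteq> F \<and> kys x' \<subseteq> F \<and> deg (x + m) = deg (x' + m')"
    if m: "m \<in> ex" "m' \<in> ex" "agree m m'" for m m'
  proof -
    have "\<forall>a\<in>A'. flow (img m) a = flow (img m') a" using m img(2) by (simp add: agree_def)
    from descendsD(4)[OF desc img(1) img(1) this]
    obtain x x' where x: "set_mset x \<subseteq> {d \<in> cycs G. d \<inter> A' = {}}" "set_mset x' \<subseteq> {d \<in> cycs G. d \<inter> A' = {}}"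
      "flow (img m + x) = flow (img m' + x')" by (elim exE conjE) (rule that)
    have k: "kys (exponent ix y) \<subseteq> F \<and> exponent ix y \<in> ex \<and> lk (deg (exponent ix y)) a = flow y a"
      if "set_mset y \<subseteq> {d \<in> cycs G. d \<inter> A' = {}}" for y a
    proof -
      have "ix ` set_mset y \<subseteq> F" using that ix unfolding F_def by auto
      then have "kys (exponent ix y) \<subseteq> F" by (rule exponent_keys)
      moreover have "lk (deg (exponent ix y)) a = flow y a" using that ix by (intro exponent_deg) auto
      ultimately show ?thesis using F_ex by blast
    qed
    have "deg (exponent ix x + m) = deg (exponent ix x' + m')"
    proof (rule poly_mapping_eqI)
      fix a
      show "lk (deg (exponent ix x + m)) a = lk (deg (exponent ix x' + m')) a"
        using fun_cong[OF x(3), of a] k[OF x(1), of a] k[OF x(2), of a] m img(2)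
        by (simp add: lookup_deg_add flow_union)
    qed
    then show ?thesis using k[OF x(1)] k[OF x(2)] by blast
  qed
  obtain lf where lf: "\<And>c. c \<in> C' \<Longrightarrow> lf c \<in> ?N \<and> cycle_arcs (lf c) \<inter> A' = c"
  proof -
    have "\<forall>c\<in>C'. \<exists>i. i \<in> ?N \<and> cycle_arcs i \<inter> A' = c"
    proof
      fix c assume "c \<in> C'"
      from descendsD(2)[OF desc this] obtain d where "d \<in> cycs G" "d \<inter> A' = c" by (elim exE conjE) (rule that)
      then show "\<exists>i. i \<in> ?N \<and> cycle_arcs i \<inter> A' = c" using ix[of d] by (intro exI[of _ "ix d"]) simp
    qed
    from bchoice[OF this] show thesis using that by blast
  qed
  \<comment> \<open>The traces on \<open>A'\<close> of the factors of a monomial, with the units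
    dropped.\<close>
  define dm where "dm m = (\<Sum>i\<in>?N - F. replicate_mset (lk m i) (cycle_arcs i \<inter> A'))" for m
  have dm_flow: "flow (dm m) a = (if a \<in> A' then lk (deg m) a else 0)" if "m \<in> ex" for m a
  proof -
    have "flow (dm m) a = (\<Sum>i\<in>?N - F. lk m i * of_bool (a \<in> cycle_arcs i \<inter> A'))"
      by (simp add: dm_def flow_sum flow_replicate)
    also have "\<dots> = (\<Sum>i\<in>?N. lk m i * of_bool (a \<in> cycle_arcs i \<inter> A'))"
      using finite_N by (intro sum.mono_neutral_left) (auto simp: F_def)
    finally show ?thesis using that by (simp add: lookup_deg)
  qed
  have dm_mem: "\<exists>i\<in>?N - F. d = cycle_arcs i \<inter> A'" if "d \<in># dm m" for m d
  proof -
    have "set_mset (\<Sum>i\<in>A. replicate_mset (lk m i) (cycle_arcs i \<inter> A')) \<subseteq> (\<lambda>i. cycle_arcs i \<inter> A') ` A" if "finite A" for A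
      using that by (induction A) (auto split: if_splits)
    from this[of "?N - F"] show ?thesis using that finite_N unfolding dm_def by auto
  qed
  \<comment> \<open>Members of \<open>C'\<close> are indecomposable even among traces: a nonempty
    trace inside \<open>c\<close> contains a member of \<open>C'\<close>, which equals
    \<open>c\<close> by the antichain property; the multiplicity is 1 by the flow.\<close>
  have prim: "R = {#c#}" if c: "c \<in> C'" and R: "\<And>d. d \<in># R \<Longrightarrow> \<exists>i\<in>?N - F. d = cycle_arcs i \<inter> A'"
    "\<And>a. flow R a = of_bool (a \<in> c)" for R c
  proof -
    have "d = c" if d: "d \<in># R" for d
    proof -
      obtain i where i: "i \<in> ?N - F" "d = cycle_arcs i \<inter> A'" using R(1)[OF d] by blast
      have "cycle_arcs i \<in> cycs G" using i(1) by (auto simp flip: cycle_arcs_primitive)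
      from descendsD(3)[OF desc this] obtain w where w: "set_mset w \<subseteq> C'" "\<And>a. flow w a = of_bool (a \<in> d)"
        unfolding i(2) by blast
      have "d \<subseteq> c"
      proof
        fix a assume "a \<in> d"
        then have "flow R a > 0" using d unfolding flow_pos_iff by blast
        then show "a \<in> c" using R(2)[of a] by simp
      qed
      obtain a where "a \<in> d" using i by (auto simp: F_def)
      then have "flow w a > 0" using w(2) by simp
      then obtain x where x: "x \<in># w" by (auto simp: flow_pos_iff)
      have "x \<subseteq> d"
      proof
        fix a assume "a \<in> x"
        then have "flow w a > 0" using x unfolding flow_pos_iff by blast
        then show "a \<in> d" using w(2)[of a] by simp
      qed
      then have "x = c" using anti[of x c] x w(1) c \<open>d \<subseteq> c\<close> by blast
      then show ?thesis using \<open>x \<subseteq> d\<close> \<open>d \<subseteq> c\<close> by blast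
    qed
    then have "set_mset R \<subseteq> {c}" by blast
    then have rep: "R = replicate_mset (size R) c" by (rule set_mset_subset_singletonD)
    have "c \<noteq> {}" using c ne by blast
    then obtain a where "a \<in> c" by blast
    moreover have "flow R a = size R * of_bool (a \<in> c)" by (subst rep) (rule flow_replicate)
    ultimately have "size R = 1" using R(2)[of a] by simp
    then show ?thesis using rep by simp
  qed
  show "rigid C'"
    unfolding rigid_def
  proof (intro ballI allI impI; elim conjE)
    fix c1 c2 v w1 w1' w2 w2'
    assume c: "c1 \<in> C'" "c2 \<in> C'"
      and s: "set_mset v \<subseteq> C'" "set_mset w1 \<subseteq> C'" "set_mset w1' \<subseteq> C'" "set_mset w2 \<subseteq> C'" "set_mset w2' \<subseteq> C'"
      and fl: "flow v = flow {#c1, c2#}" "flow w1 = flow w1'" "flow w2 = flow w2'"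
      and nle: "\<not> flow {#c1, c2#} \<le> flow w1" "\<not> flow {#c1, c2#} \<le> flow w2"
      and eq: "{#c1, c2#} + w1' + w2' = v + w1 + w2"
    let ?e = "exponent lf" and ?u = "{#c1, c2#}"
    have su: "set_mset ?u \<subseteq> C'" using c by simp
    have e: "?e w \<in> ex" if "set_mset w \<subseteq> C'" for w
      using exponent_keys[of lf w ?N] that lf by (auto simp: ex_def)
    have ed: "lk (deg (?e w)) a = flow w a" if "set_mset w \<subseteq> C'" "a \<in> A'" for w a
      using that lf by (intro exponent_deg) blast
    have ag: "agree (?e w) (?e w')" if "set_mset w \<subseteq> C'" "set_mset w' \<subseteq> C'" "flow w = flow w'" for w w'
      using that by (simp add: agree_def ed)
    have viol: "\<exists>a\<in>A'. lk (deg (?e w)) a < lk (deg (?e ?u)) a"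
      if wC: "set_mset w \<subseteq> C'" and wn: "\<not> flow ?u \<le> flow w" for w
    proof -
      obtain a where a: "flow w a < flow ?u a" using wn by (auto simp: le_fun_def not_le)
      then have "flow ?u a > 0" by (rule le_less_trans[OF zero_le])
      then obtain c where "c \<in># ?u" "a \<in> c" unfolding flow_pos_iff by (rule bexE)
      then have "a \<in> A'" using c descendsD(1)[OF desc] by auto
      then show ?thesis using a ed[OF wC] ed[OF su] by (intro bexI[of _ a]) simp_all
    qed
    obtain a1 a2 where a: "a1 \<in> A'" "lk (deg (?e w1)) a1 < lk (deg (?e ?u)) a1"
      "a2 \<in> A'" "lk (deg (?e w2)) a2 < lk (deg (?e ?u)) a2"
      using viol[OF s(2) nle(1)] viol[OF s(4) nle(2)] by blast
    have "?e ?u + ?e w1' + ?e w2' = ?e v + ?e w1 + ?e w2"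
      unfolding exponent_union[symmetric] eq ..
    from arg_cong[OF this, of lk]
    have le: "lk (?e ?u) i + lk (?e w1') i + lk (?e w2') i = lk (?e v) i + lk (?e w1) i + lk (?e w2) i" for i
      unfolding fun_eq_iff lookup_add by blast
    have "conn (?e ?u) (?e v)"
      by (rule conn_of_relation[OF S(1-3) lift BN card rel e[OF su] e[OF s(1)] e[OF s(2)] e[OF s(3)] e[OF s(4)] e[OF s(5)]
          ag[OF su s(1) fl(1)[symmetric]] ag[OF s(2,3) fl(2)] ag[OF s(4,5) fl(3)] a le])
    moreover have dme: "dm (?e w) = w" if "set_mset w \<subseteq> C'" for w
      using that
    proof (induction w)
      case empty
      show ?case by (simp add: dm_def)
    next
      case (add c w)
      have cC: "c \<in> C'" using add.prems by simp
      have lN: "lf c \<in> ?N - F" using lf[OF cC] ne cC by (auto simp: F_def)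
      have "dm (?e (add_mset c w)) = (\<Sum>i\<in>?N - F. replicate_mset (lk (Poly_Mapping.single (lf c) 1) i) (cycle_arcs i \<inter> A'))
          + dm (?e w)"
        unfolding dm_def exponent_simps lookup_add sum.distrib[symmetric] by (intro sum.cong refl multiset_eqI) simp
      also have "(\<Sum>i\<in>?N - F. replicate_mset (lk (Poly_Mapping.single (lf c) 1) i) (cycle_arcs i \<inter> A'))
          = (\<Sum>i\<in>{lf c}. replicate_mset (lk (Poly_Mapping.single (lf c) 1) i) (cycle_arcs i \<inter> A'))"
        using lN finite_N by (intro sum.mono_neutral_right) (auto simp: lookup_single when_def)
      also have "\<dots> = {#c#}" using lf[OF cC] by simp
      finally show ?case using add by simp
    qed
    \<comment> \<open>A step of the fibre graph keeps either all traces or one of the two factors.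
      In the second case what remains has the flow of the other factor, so it is that factor by
      \<open>prim\<close>.\<close>
    moreover have "dm m = ?u" if "conn (?e ?u) m" for m
      using that
    proof (induction rule: rtranclp_induct)
      case base
      show ?case by (rule dme[OF su])
    next
      case (step m m')
      have mm: "m \<in> ex" "m' \<in> ex" "agree m m'" using step.hyps(2) by (auto simp: adj_def)
      from step.hyps(2) consider "\<forall>i\<in>?N - F. lk m i = lk m' i" | i where "i \<in> ?N - F" "lk m i \<noteq> 0" "lk m' i \<noteq> 0"
        unfolding adj_def by blast
      then show ?case
      proof cases
        case 1
        then have "dm m = dm m'" unfolding dm_def by (intro sum.cong) auto
        then show ?thesis using step.IH by simp
      next
        case 2
        let ?d = "cycle_arcs i \<inter> A'"
        have mem: "?d \<in># dm x" if "lk x i \<noteq> 0" for x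
        proof -
          have "dm x = replicate_mset (lk x i) ?d + (\<Sum>j\<in>?N - F - {i}. replicate_mset (lk x j) (cycle_arcs j \<inter> A'))"
            unfolding dm_def using 2(1) finite_N by (intro sum.remove) auto
          then show ?thesis using that by simp
        qed
        have "?d = c1 \<or> ?d = c2" using mem[OF 2(2)] step.IH by auto
        then obtain c' where c': "c' \<in> C'" "?u = {#?d, c'#}" using c by (auto simp: add_mset_commute)
        obtain R where R: "dm m' = add_mset ?d R" using mem[OF 2(3)] by (metis multi_member_split)
        have "R = {#c'#}"
        proof (rule prim[OF c'(1)])
          show "\<exists>i\<in>?N - F. d = cycle_arcs i \<inter> A'" if "d \<in># R" for d using dm_mem[of d m'] that R by simp
          fix a
          have "flow (dm m') a = flow (dm m) a" using dm_flow[OF mm(1)] dm_flow[OF mm(2)] mm(3) by (simp add: agree_def)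
          then show "flow R a = of_bool (a \<in> c')" unfolding R step.IH c'(2) by simp
        qed
        then show ?thesis using R c'(2) by simp
      qed
    qed
    ultimately show "v = ?u" using dme[OF s(1)] by metis
  qed
qed

end

section \<open>Forbidden path configurations\<close>

lemma card_ge_2_obtain:
  assumes "2 \<le> card A" obtains y where "y \<in> A" "y \<noteq> x"
proof -
  have "\<not> A \<subseteq> {x}" using assms card_mono[of "{x}" A] by auto
  then show thesis using that by blast
qed

context wf_digraph
begin

lemma apath_verts: "apath u p v \<Longrightarrow> set (awalk_verts u p) = insert u (head G ` set p)"
  using awalk_verts_eq[OF awalkI_apath] by simp

lemma apath_tail_ne: "apath u p v \<Longrightarrow> x \<in> set p \<Longrightarrow> tail G x \<noteq> v"
proof -
  assume p: "apath u p v" and x: "x \<in> set p"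
  have "distinct (u # map (head G) p)" using p by (simp add: apath_iff)
  then have "distinct (map (tail G) p @ [v])" using awalk_tails_heads[OF awalkI_apath[OF p]] by simp
  then show ?thesis using x by auto
qed

lemma apath_arc_verts: "apath u p v \<Longrightarrow> x \<in> set p \<Longrightarrow> tail G x \<in> set (awalk_verts u p) \<and> head G x \<in> set (awalk_verts u p)"
  using awalk_verts_arc1 awalk_verts_arc2[OF awalkI_apath] by metis

lemma apath_suffix:
  assumes p: "apath u p v" and y: "y \<in> set (awalk_verts u p)" "y \<noteq> u"
  obtains q where "apath y q v" "set (awalk_verts y q) \<subseteq> set (awalk_verts u p) - {u}" "length q < length p" "set q \<subseteq> set p"
proof -
  obtain q r where q: "p = q @ r" "awalk u q y" "awalk y r v"
    using awalk_decomp[OF awalkI_apath[OF p] y(1)] by blast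
  have "awlast u q = y" using q(2) by (rule awalkE')
  with p have ap: "apath y r v" and dj: "set (awalk_verts u q) \<inter> set (tl (awalk_verts y r)) = {}"
    unfolding q(1) apath_append_iff by auto
  have "u \<in> set (awalk_verts u q)" using q(2) by (rule hd_in_awalk_verts)
  then have "u \<notin> set (awalk_verts y r)" using dj y(2) unfolding awalk_verts_eq[OF q(3)] by auto
  moreover have "set (awalk_verts y r) \<subseteq> set (awalk_verts u p)" using set_awalk_verts_append[OF q(2,3)] q(1) by auto
  moreover have "q \<noteq> []" using q(2) y(2) by (auto simp: awalk_Nil_iff)
  ultimately show thesis using that[OF ap] q(1) by auto
qed

lemma apath_append:
  assumes "apath u p v" "apath v q w" "set (awalk_verts u p) \<inter> set (awalk_verts v q) \<subseteq> {v}"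
  shows "apath u (p @ q) w" "set (awalk_verts u (p @ q)) = set (awalk_verts u p) \<union> set (awalk_verts v q)"
proof -
  have w: "awalk u p v" "awalk v q w" using assms by (auto intro: awalkI_apath)
  have "awalk u (p @ q) w" using w by (rule awalk_appendI)
  moreover have "distinct (u # map (head G) (p @ q))"
    using assms unfolding awalk_verts_eq[OF w(1)] awalk_verts_eq[OF w(2)] apath_iff by auto
  ultimately show "apath u (p @ q) w" by (simp add: apath_iff)
  show "set (awalk_verts u (p @ q)) = set (awalk_verts u p) \<union> set (awalk_verts v q)"
    using w by (rule set_awalk_verts_append)
qed

text \<open>A common arc would start at \<open>u\<close> or \<open>v\<close>, but neither path
  leaves its own end point.\<close>

lemma apath_disjoint:
  assumes p: "apath u p v" and q: "apath v q u" and i: "set (awalk_verts u p) \<inter> set (awalk_verts v q) \<subseteq> {u, v}"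
  shows "set p \<inter> set q = {}"
proof (rule ccontr)
  assume "set p \<inter> set q \<noteq> {}"
  then obtain x where x: "x \<in> set p" "x \<in> set q" by blast
  have "tail G x \<in> {u, v}" using apath_arc_verts[OF p x(1)] apath_arc_verts[OF q x(2)] i by blast
  then show False using apath_tail_ne[OF p x(1)] apath_tail_ne[OF q x(2)] by blast
qed

lemma apath_disjoint1:
  assumes p: "apath u p v" and q: "apath u' q v'" and i: "set (awalk_verts u p) \<inter> set (awalk_verts u' q) \<subseteq> {y}"
  shows "set p \<inter> set q = {}"
proof (rule ccontr)
  assume "set p \<inter> set q \<noteq> {}"
  then obtain x where x: "x \<in> set p" "x \<in> set q" by blast
  have "tail G x = head G x" using apath_arc_verts[OF p x(1)] apath_arc_verts[OF q x(2)] i by blast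
  then show False using no_loops_in_apath[OF p x(1)] by simp
qed

end

context fin_digraph
begin

lemma awalk_balance:
  assumes "awalk u p v" "distinct p"
  shows "(\<Sum>a\<in>in_arcs G w. of_bool (a \<in> set p)) + of_bool (w = u)
    = (\<Sum>a\<in>out_arcs G w. of_bool (a \<in> set p)) + (of_bool (w = v) :: nat)"
  using assms
proof (induction p arbitrary: u)
  case Nil
  then show ?case by (auto simp: awalk_Nil_iff)
next
  case (Cons e p)
  have e: "e \<in> arcs G" "u = tail G e" "awalk (head G e) p v" "e \<notin> set p" "distinct p"
    using Cons.prems by (auto simp: awalk_Cons_iff)
  have s: "(\<Sum>a\<in>A. of_bool (a \<in> set (e # p))) = (of_bool (e \<in> A) :: nat) + (\<Sum>a\<in>A. of_bool (a \<in> set p))"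
    if "finite A" for A
  proof -
    have "(\<Sum>a\<in>A. of_bool (a \<in> set (e # p))) = (\<Sum>a\<in>A. of_bool (a = e) + (of_bool (a \<in> set p) :: nat))"
      using e(4) by (intro sum.cong) auto
    also have "\<dots> = (\<Sum>a\<in>A. of_bool (a = e)) + (\<Sum>a\<in>A. of_bool (a \<in> set p))" by (rule sum.distrib)
    also have "(\<Sum>a\<in>A. of_bool (a = e)) = (of_bool (e \<in> A) :: nat)"
      using that by (simp add: of_bool_def sum.delta)
    finally show ?thesis .
  qed
  show ?case
    using Cons.IH[OF e(3,5)] e(1,2) s[OF finite_in_arcs, of w] s[OF finite_out_arcs, of w] by auto
qed

lemma apath_circulation:
  assumes p: "apath u p v" and q: "apath v q u"
  shows "circulation G (\<lambda>a. of_bool (a \<in> set p) + of_bool (a \<in> set q))"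
proof -
  have w: "awalk u p v" "distinct p" "awalk v q u" "distinct q"
    using p q by (auto simp: apath_iff distinct_map)
  have "set p \<subseteq> arcs G" "set q \<subseteq> arcs G" using w(1,3) by auto
  moreover have "(\<Sum>a\<in>in_arcs G x. of_bool (a \<in> set p) + of_bool (a \<in> set q) :: nat)
      = (\<Sum>a\<in>out_arcs G x. of_bool (a \<in> set p) + of_bool (a \<in> set q))" for x
    using awalk_balance[OF w(1,2), of x] awalk_balance[OF w(3,4), of x] by (simp add: sum.distrib)
  ultimately show ?thesis by (auto simp: circulation_def)
qed

text \<open>The 2 by 3 shape for paths. Only the pairs that have to close up to cycles must avoid
  each other; \<open>p\<close> may cross \<open>r1\<close> and \<open>r2\<close>, because a path and
  a return path always add up to a circulation.\<close>

lemma no_K23: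
  assumes R: "rigid (cycs G)" and st: "s \<noteq> t"
    and P: "apath t a s" "apath t p s" "apath s b t" "apath s r1 t" "apath s r2 t"
    and V: "set (awalk_verts t a) \<inter> set (awalk_verts s b) \<subseteq> {s, t}"
      "set (awalk_verts t a) \<inter> set (awalk_verts s r1) \<subseteq> {s, t}"
      "set (awalk_verts t a) \<inter> set (awalk_verts s r2) \<subseteq> {s, t}"
      "set (awalk_verts t p) \<inter> set (awalk_verts s b) \<subseteq> {s, t}"
    and ne: "set a \<noteq> set p" "set r1 \<noteq> set r2" and e: "e \<in> set b" "e \<notin> set r1" "e \<notin> set r2"
  shows False
proof -
  have cyc: "set x \<union> set y \<in> cycs G" "set x \<inter> set y = {}"
    if "apath t x s" "apath s y t" "set (awalk_verts t x) \<inter> set (awalk_verts s y) \<subseteq> {s, t}" for x y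
  proof -
    have "cycle (x @ y)" using that(3) st by (intro cycle_appendI[OF that(1,2)]) auto
    then have "set (x @ y) \<in> cycs G" unfolding cycs_def by blast
    then show "set x \<union> set y \<in> cycs G" by simp
    show "set x \<inter> set y = {}" using apath_disjoint[OF that(1,2)] that(3) by (simp add: insert_commute)
  qed
  obtain d1 where d1: "set_mset d1 \<subseteq> cycs G" "flow d1 = (\<lambda>x. of_bool (x \<in> set p) + of_bool (x \<in> set r1))"
    using circulation_decomp[OF apath_circulation[OF P(2,4)]] by metis
  obtain d2 where d2: "set_mset d2 \<subseteq> cycs G" "flow d2 = (\<lambda>x. of_bool (x \<in> set p) + of_bool (x \<in> set r2))"
    using circulation_decomp[OF apath_circulation[OF P(2,5)]] by metis
  show False
    by (rule rigid_no_K23[OF R cycs_antichain cyc(1)[OF P(1,3) V(1)] cyc(1)[OF P(2,3) V(4)] cyc(1)[OF P(1,4) V(2)]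
        cyc(1)[OF P(1,5) V(3)] cyc(2)[OF P(1,3) V(1)] cyc(2)[OF P(2,3) V(4)] cyc(2)[OF P(1,4) V(2)] cyc(2)[OF P(1,5) V(3)]
        ne e d1(1) d2(1)]) (simp_all add: d1(2) d2(2))
qed

text \<open>A triangle whose three sides are doubled. Here all eight combinations have to be cycles,
  so paths on different sides may meet only in their common corner.\<close>

lemma no_K222:
  assumes R: "rigid (cycs G)" and xyz: "x \<noteq> y" "y \<noteq> z" "z \<noteq> x"
    and P: "apath x p1 y" "apath x p2 y" and Q: "apath y q1 z" "apath y q2 z" and T: "apath z r1 x" "apath z r2 x"
    and V: "\<And>p q. p \<in> {p1, p2} \<Longrightarrow> q \<in> {q1, q2} \<Longrightarrow> set (awalk_verts x p) \<inter> set (awalk_verts y q) \<subseteq> {y}"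
      "\<And>q r. q \<in> {q1, q2} \<Longrightarrow> r \<in> {r1, r2} \<Longrightarrow> set (awalk_verts y q) \<inter> set (awalk_verts z r) \<subseteq> {z}"
      "\<And>r p. r \<in> {r1, r2} \<Longrightarrow> p \<in> {p1, p2} \<Longrightarrow> set (awalk_verts z r) \<inter> set (awalk_verts x p) \<subseteq> {x}"
    and ne: "set p1 \<noteq> set p2" "set q1 \<noteq> set q2" "set r1 \<noteq> set r2"
  shows False
proof (rule rigid_no_K222[OF R cycs_antichain, where ?p1.0 = "set p1" and ?p2.0 = "set p2" and ?q1.0 = "set q1"
      and ?q2.0 = "set q2" and ?r1.0 = "set r1" and ?r2.0 = "set r2"])
  have PQR: "p \<in> {p1, p2} \<Longrightarrow> apath x p y" "q \<in> {q1, q2} \<Longrightarrow> apath y q z" "r \<in> {r1, r2} \<Longrightarrow> apath z r x" for p q r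
    using P Q T by blast+
  have dj: "set p \<inter> set q = {}" "set q \<inter> set r = {}" "set r \<inter> set p = {}"
    if "p \<in> {p1, p2}" "q \<in> {q1, q2}" "r \<in> {r1, r2}" for p q r
    using apath_disjoint1[OF PQR(1)[OF that(1)] PQR(2)[OF that(2)] V(1)[OF that(1,2)]]
      apath_disjoint1[OF PQR(2)[OF that(2)] PQR(3)[OF that(3)] V(2)[OF that(2,3)]]
      apath_disjoint1[OF PQR(3)[OF that(3)] PQR(1)[OF that(1)] V(3)[OF that(3,1)]] by blast+
  show "(set p1 \<union> set p2) \<inter> (set q1 \<union> set q2) = {}" "(set p1 \<union> set p2) \<inter> (set r1 \<union> set r2) = {}"
    "(set q1 \<union> set q2) \<inter> (set r1 \<union> set r2) = {}"
    using dj[of p1 q1 r1] dj[of p1 q1 r2] dj[of p1 q2 r1] dj[of p1 q2 r2]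
      dj[of p2 q1 r1] dj[of p2 q1 r2] dj[of p2 q2 r1] dj[of p2 q2 r2] by auto
  fix p' q' r'
  assume "p' \<in> {set p1, set p2}" "q' \<in> {set q1, set q2}" "r' \<in> {set r1, set r2}"
  then obtain p q r where p: "p \<in> {p1, p2}" "p' = set p" and q: "q \<in> {q1, q2}" "q' = set q"
    and r: "r \<in> {r1, r2}" "r' = set r" by auto
  note ap = apath_append[OF PQR(1)[OF p(1)] PQR(2)[OF q(1)] V(1)[OF p(1) q(1)]]
  have "cycle ((p @ q) @ r)"
    using V(2)[OF q(1) r(1)] V(3)[OF r(1) p(1)] xyz
    by (intro cycle_appendI[OF ap(1) PQR(3)[OF r(1)]]) (auto simp: ap(2))
  then have "set ((p @ q) @ r) \<in> cycs G" unfolding cycs_def by blast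
  then show "p' \<union> q' \<union> r' \<in> cycs G" by (simp add: p q r Un_assoc)
qed (use ne in auto)

end

context wf_digraph
begin

lemma apath1:
  assumes "e \<in> arcs G" "tail G e = a" "head G e = b" "a \<noteq> b"
  shows "apath a [e] b" "awalk_verts a [e] = [a, b]"
  using assms head_in_verts[OF assms(1)] by (auto simp: apath_Cons_iff apath_Nil_iff)

lemma apath2:
  assumes "d \<in> arcs G" "f \<in> arcs G" "tail G d = a" "head G d = b" "tail G f = b" "head G f = c" "a \<noteq> b" "b \<noteq> c" "a \<noteq> c"
  shows "apath a [d, f] c" "awalk_verts a [d, f] = [a, b, c]"
proof -
  have f: "apath b [f] c" "awalk_verts b [f] = [b, c]" using apath1[OF assms(2,5,6,8)] .
  then show "awalk_verts a [d, f] = [a, b, c]" using assms(3,4) by simp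
  show "apath a [d, f] c" unfolding apath_Cons_iff[of a d] using assms(1,3,4,7,9) f by simp
qed

lemma apath3:
  assumes "d \<in> arcs G" "e \<in> arcs G" "f \<in> arcs G" "tail G d = a" "head G d = b" "tail G e = b" "head G e = c"
    "tail G f = c" "head G f = x" "a \<noteq> b" "a \<noteq> c" "a \<noteq> x" "b \<noteq> c" "b \<noteq> x" "c \<noteq> x"
  shows "apath a [d, e, f] x" "awalk_verts a [d, e, f] = [a, b, c, x]"
proof -
  have f: "apath b [e, f] x" "awalk_verts b [e, f] = [b, c, x]" using apath2[OF assms(2,3,6,7,8,9,13,15,14)] .
  then show "awalk_verts a [d, e, f] = [a, b, c, x]" using assms(4,5) by simp
  show "apath a [d, e, f] x" unfolding apath_Cons_iff[of a d] using assms(1,4,5,10,11,12) f by simp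
qed

end

section \<open>Shortest cycles meeting every arc\<close>

text \<open>The last case of the induction, in which contracting a shortest cycle has shown that it
  meets every arc. Without loops and 2-cycles, \<open>p\<close> has length at least three.\<close>

locale short_cycle = fin_digraph G for G :: "('v, 'b) pre_digraph" +
  fixes p :: "'b list" and K :: "'v set"
  assumes rig: "rigid (cycs G)" and p: "cycle p" and K: "K = tail G ` set p"
    and short: "\<And>q. cycle q \<Longrightarrow> length p \<le> length q"
    and meets: "\<And>a. a \<in> arcs G \<Longrightarrow> tail G a \<in> K \<or> head G a \<in> K"
    and loopless: "\<And>a. a \<in> arcs G \<Longrightarrow> tail G a \<noteq> head G a"
    and no2: "\<And>a b. a \<in> arcs G \<Longrightarrow> b \<in> arcs G \<Longrightarrow> tail G a = head G b \<Longrightarrow> head G a \<noteq> tail G b"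
    and deg: "\<And>v. v \<in> verts G \<Longrightarrow> 2 \<le> in_degree G v \<and> 2 \<le> out_degree G v"
begin

definition nxt :: "'v \<Rightarrow> 'b" where "nxt w = (SOME a. a \<in> set p \<and> tail G a = w)"

abbreviation suc :: "'v \<Rightarrow> 'v" where "suc w \<equiv> head G (nxt w)"

lemma nxt: "w \<in> K \<Longrightarrow> nxt w \<in> set p" "w \<in> K \<Longrightarrow> tail G (nxt w) = w" "w \<in> K \<Longrightarrow> nxt w \<in> arcs G"
proof -
  assume "w \<in> K"
  then have "\<exists>a. a \<in> set p \<and> tail G a = w" by (auto simp: K)
  from someI_ex[OF this] have "nxt w \<in> set p \<and> tail G (nxt w) = w" unfolding nxt_def .
  then show "nxt w \<in> set p" "tail G (nxt w) = w" "nxt w \<in> arcs G" using cycle_arcs_sub(1)[OF p] by auto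
qed

lemma nxt_unique: "a \<in> set p \<Longrightarrow> nxt (tail G a) = a"
proof -
  assume a: "a \<in> set p"
  then have t: "tail G a \<in> K" by (simp add: K)
  have "inj_on (tail G) (set p)" using cycle_distinct(3)[OF p] by (simp add: distinct_map)
  from inj_onD[OF this nxt(2)[OF t] nxt(1)[OF t] a] show ?thesis .
qed

lemma suc_K: "w \<in> K \<Longrightarrow> suc w \<in> K"
  using imageI[OF nxt(1), of w "head G"] cycle_heads[OF p] by (simp add: K)

lemma suc_inj: "w \<in> K \<Longrightarrow> w' \<in> K \<Longrightarrow> suc w = suc w' \<Longrightarrow> w = w'"
proof -
  assume w: "w \<in> K" "w' \<in> K" "suc w = suc w'"
  have "inj_on (head G) (set p)" using cycle_distinct(2)[OF p] by (simp add: distinct_map)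
  from inj_onD[OF this w(3) nxt(1)[OF w(1)] nxt(1)[OF w(2)]] have "tail G (nxt w) = tail G (nxt w')" by (rule arg_cong)
  then show "w = w'" unfolding nxt(2)[OF w(1)] nxt(2)[OF w(2)] .
qed

lemma K_verts: "w \<in> K \<Longrightarrow> w \<in> verts G"
  using nxt(2,3)[of w] tail_in_verts[of "nxt w"] by simp

lemma suc_ne: "w \<in> K \<Longrightarrow> suc w \<noteq> w" "w \<in> K \<Longrightarrow> suc (suc w) \<noteq> w"
proof -
  assume w: "w \<in> K"
  show "suc w \<noteq> w" using loopless[OF nxt(3)[OF w]] nxt(2)[OF w] by simp
  show "suc (suc w) \<noteq> w"
  proof
    assume "suc (suc w) = w"
    then have "tail G (nxt w) = head G (nxt (suc w))" using nxt(2)[OF w] by simp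
    from no2[OF nxt(3)[OF w] nxt(3)[OF suc_K[OF w]] this] nxt(2)[OF suc_K[OF w]] show False by simp
  qed
qed

lemma around:
  assumes w: "w \<in> K"
  obtains r where "apath (suc (suc w)) r w" "set (awalk_verts (suc (suc w)) r) = K - {suc w}"
    "length p = Suc (Suc (length r))" "set r \<subseteq> set p"
proof -
  obtain r where r: "apath (suc w) r w" "set p = insert (nxt w) (set r)" "length p = Suc (length r)"
    using cycle_split[OF p nxt(1)[OF w]] nxt(2)[OF w] by metis
  have "r \<noteq> []" using r(1) suc_ne(1)[OF w] by (auto simp: apath_Nil_iff)
  then obtain e r' where e: "r = e # r'" by (cases r) auto
  have te: "tail G e = suc w" using r(1) unfolding e apath_Cons_iff by blast
  have "e \<in> set p" using r(2) e by simp
  then have en: "e = nxt (suc w)" using nxt_unique te by metis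
  have ap: "apath (suc (suc w)) r' w" "suc w \<notin> set (awalk_verts (suc (suc w)) r')"
    using r(1) te en unfolding e apath_Cons_iff by auto
  have "K = insert (suc w) (head G ` set r)"
    using r(2) cycle_heads[OF p] unfolding K by auto
  also have "\<dots> = insert (suc w) (set (awalk_verts (suc (suc w)) r'))"
    using apath_verts[OF ap(1)] e en by auto
  finally have "set (awalk_verts (suc (suc w)) r') = K - {suc w}" using ap(2) by auto
  then show thesis using that[OF ap(1)] r(2,3) e by auto
qed

lemma around_from:
  assumes w: "w \<in> K" and y: "y \<in> K" "y \<noteq> suc w"
  obtains q where "apath y q w" "set (awalk_verts y q) \<subseteq> K" "Suc (length q) < length p"
    "y \<noteq> suc (suc w) \<Longrightarrow> Suc (Suc (length q)) < length p"
proof -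
  obtain r where r: "apath (suc (suc w)) r w" "set (awalk_verts (suc (suc w)) r) = K - {suc w}"
    "length p = Suc (Suc (length r))" using around[OF w] by metis
  show thesis
  proof (cases "y = suc (suc w)")
    case True
    then show ?thesis using that[of r] r by auto
  next
    case False
    have "y \<in> set (awalk_verts (suc (suc w)) r)" using r(2) y by simp
    from apath_suffix[OF r(1) this False] obtain q where q: "apath y q w"
      "set (awalk_verts y q) \<subseteq> set (awalk_verts (suc (suc w)) r) - {suc (suc w)}" "length q < length r" by metis
    show ?thesis using that[OF q(1)] q(2,3) r(2,3) by auto
  qed
qed

text \<open>A chord would close up with a stretch of \<open>p\<close> to a shorter cycle.\<close>

lemma arc_K:
  assumes a: "a \<in> arcs G" "tail G a \<in> K" "head G a \<in> K"
  shows "head G a = suc (tail G a)"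
proof (rule ccontr)
  assume "head G a \<noteq> suc (tail G a)"
  from around_from[OF a(2,3) this] obtain q where q: "apath (head G a) q (tail G a)" "Suc (length q) < length p" by metis
  have "cycle (a # q)" using a(1) q(1) by (rule cycle_ConsI)
  from short[OF this] q(2) show False by simp
qed

text \<open>Two arcs through an outside vertex can skip at most one vertex of \<open>p\<close>;
  skipping more would again give a shorter cycle.\<close>

lemma arc2_K:
  assumes d: "d \<in> arcs G" "tail G d \<in> K" "head G d \<notin> K" and f: "f \<in> arcs G" "tail G f = head G d" "head G f \<in> K"
  shows "head G f = suc (tail G d) \<or> head G f = suc (suc (tail G d))"
proof (rule ccontr)
  assume n: "\<not> ?thesis"
  then have "head G f \<noteq> suc (tail G d)" by blast
  from around_from[OF d(2) f(3) this] n obtain q where q: "apath (head G f) q (tail G d)"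
    "set (awalk_verts (head G f) q) \<subseteq> K" "Suc (Suc (length q)) < length p" by metis
  have "apath (head G d) (f # q) (tail G d)" using q(1,2) f d(3) by (auto simp: apath_Cons_iff)
  with d(1) have "cycle (d # f # q)" by (rule cycle_ConsI)
  from short[OF this] q(3) show False by simp
qed

definition side :: "'v \<Rightarrow> 'v set" where
  "side w = {u. u \<notin> K \<and> (\<exists>d\<in>arcs G. tail G d = w \<and> head G d = u) \<and> (\<exists>f\<in>arcs G. tail G f = u \<and> head G f = suc w)}"

text \<open>A second way from \<open>w\<close> to the next vertex of \<open>p\<close>. Confining its
  inner vertices to \<open>side w\<close> is what keeps detours at nearby vertices apart.\<close>

definition detour :: "'v \<Rightarrow> 'b list \<Rightarrow> bool" where
  "detour w R \<longleftrightarrow> apath w R (suc w) \<and> nxt w \<notin> set R \<and> set (awalk_verts w R) \<subseteq> {w, suc w} \<union> side w"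

lemma detour_parallel: "w \<in> K \<Longrightarrow> e \<in> arcs G \<Longrightarrow> tail G e = w \<Longrightarrow> head G e = suc w \<Longrightarrow> e \<noteq> nxt w \<Longrightarrow> detour w [e]"
  using loopless[of e] apath1[of e w "suc w"] by (simp add: detour_def)

lemma detour_outside:
  assumes "w \<in> K" "d \<in> arcs G" "tail G d = w" "head G d \<notin> K" "f \<in> arcs G" "tail G f = head G d" "head G f = suc w"
  shows "detour w [d, f]"
proof -
  have "head G d \<in> side w" using assms by (auto simp: side_def)
  moreover have "nxt w \<noteq> d" "nxt w \<noteq> f" using assms(4,6) suc_K[OF assms(1)] nxt(2)[OF assms(1)] assms(1) by auto
  moreover have "w \<noteq> head G d" "head G d \<noteq> suc w" "w \<noteq> suc w"
    using assms(1,4) suc_K[OF assms(1)] suc_ne(1)[OF assms(1)] by auto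
  note ap = apath2[OF assms(2,5,3) refl assms(6,7) this]
  ultimately show ?thesis unfolding detour_def ap(2) using ap(1) by simp
qed

lemma out_arc_K: "u \<notin> K \<Longrightarrow> f \<in> arcs G \<Longrightarrow> tail G f = u \<Longrightarrow> head G f \<in> K"
  and in_arc_K: "u \<notin> K \<Longrightarrow> f \<in> arcs G \<Longrightarrow> head G f = u \<Longrightarrow> tail G f \<in> K"
  using meets[of f] by auto

text \<open>Without a detour, a second arc out of \<open>w\<close> leaves \<open>p\<close>, and by
  \<open>arc2_K\<close> every arc from its head ends at the vertex after next. Outdegree two makes
  two of these parallel.\<close>

lemma no_detour_double:
  assumes w: "w \<in> K" and n: "\<And>R. \<not> detour w R"
  obtains d f1 f2 where "d \<in> arcs G" "tail G d = w" "head G d \<notin> K" "f1 \<in> arcs G" "f2 \<in> arcs G" "f1 \<noteq> f2"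
    "tail G f1 = head G d" "tail G f2 = head G d" "head G f1 = suc (suc w)" "head G f2 = suc (suc w)"
proof -
  have "2 \<le> card (out_arcs G w)" using deg[OF K_verts[OF w]] by (simp add: out_degree_def)
  then obtain d where d: "d \<in> out_arcs G w" "d \<noteq> nxt w" by (rule card_ge_2_obtain)
  have dK: "head G d \<notin> K" using arc_K[of d] d w detour_parallel[OF w, of d] n by auto
  have hf: "head G f = suc (suc w)" if "f \<in> out_arcs G (head G d)" for f
  proof -
    have f: "f \<in> arcs G" "tail G f = head G d" "head G f \<in> K" using that dK out_arc_K by auto
    have "head G f \<noteq> suc w" using detour_outside[OF w, of d f] n d dK f by auto
    then show ?thesis using arc2_K[of d f] d dK f w by auto
  qed
  have "2 \<le> card (out_arcs G (head G d))" using deg[of "head G d"] d by (simp add: out_degree_def)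
  note c = this
  obtain f1 where f1: "f1 \<in> out_arcs G (head G d)" by (rule card_ge_2_obtain[OF c, of undefined]) (rule that)
  obtain f2 where f2: "f2 \<in> out_arcs G (head G d)" "f2 \<noteq> f1" by (rule card_ge_2_obtain[OF c])
  show thesis using that[of d f1 f2] d dK f1 f2 hf by auto
qed

text \<open>The route along \<open>p\<close> and the two routes through \<open>head G d\<close> are
  three ways from \<open>w\<close> to \<open>suc (suc w)\<close>; two returns complete the 2 by 3
  shape.\<close>

lemma two_returns:
  assumes w: "w \<in> K" and n: "\<And>R. \<not> detour w R"
    and r: "apath (suc (suc w)) r w" "set (awalk_verts (suc (suc w)) r) = K - {suc w}"
    and q: "apath (suc (suc w)) q w" "suc w \<notin> set (awalk_verts (suc (suc w)) q)" "set r \<noteq> set q"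
  shows False
proof -
  obtain d f1 f2 where d: "d \<in> arcs G" "tail G d = w" "head G d \<notin> K" and f: "f1 \<in> arcs G" "f2 \<in> arcs G" "f1 \<noteq> f2"
    "tail G f1 = head G d" "tail G f2 = head G d" "head G f1 = suc (suc w)" "head G f2 = suc (suc w)"
    by (rule no_detour_double[OF w n])
  have s: "suc w \<in> K" "suc (suc w) \<in> K" using w suc_K by auto
  note ne = suc_ne[OF w] suc_ne(1)[OF s(1)]
  let ?b = "[nxt w, nxt (suc w)]"
  note b = apath2[OF nxt(3)[OF w] nxt(3)[OF s(1)] nxt(2)[OF w] refl nxt(2)[OF s(1)] refl
      ne(1)[symmetric] ne(3)[symmetric] ne(2)[symmetric]]
  have dn: "w \<noteq> head G d" "head G d \<noteq> suc (suc w)" using d(3) w s by auto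
  note R1 = apath2[OF d(1) f(1) d(2) refl f(4,6) dn ne(2)[symmetric]]
  note R2 = apath2[OF d(1) f(2) d(2) refl f(5,7) dn ne(2)[symmetric]]
  show False
  proof (rule no_K23[OF rig, of w "suc (suc w)" r q ?b "[d, f1]" "[d, f2]" "nxt w"])
    show "w \<noteq> suc (suc w)" using ne by simp
    show "apath w [d, f1] (suc (suc w))" "apath w [d, f2] (suc (suc w))" by (rule R1 R2)+
    show "set (awalk_verts (suc (suc w)) r) \<inter> set (awalk_verts w ?b) \<subseteq> {w, suc (suc w)}"
      "set (awalk_verts (suc (suc w)) q) \<inter> set (awalk_verts w ?b) \<subseteq> {w, suc (suc w)}"
      unfolding b(2) using r(2) q(2) by auto
    show "set (awalk_verts (suc (suc w)) r) \<inter> set (awalk_verts w [d, f1]) \<subseteq> {w, suc (suc w)}"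
      "set (awalk_verts (suc (suc w)) r) \<inter> set (awalk_verts w [d, f2]) \<subseteq> {w, suc (suc w)}"
      unfolding R1(2) R2(2) r(2) using d(3) by auto
    have "d \<noteq> f1" "d \<noteq> f2" using f(4,5) d(2,3) w by auto
    then show "set [d, f1] \<noteq> set [d, f2]" using f(3) by auto
    have "nxt w \<noteq> d" "nxt w \<noteq> f1" "nxt w \<noteq> f2" using d(3) f(4,5) s(1) nxt(2)[OF w] w by auto
    then show "nxt w \<notin> set [d, f1]" "nxt w \<notin> set [d, f2]" by auto
  qed (use r q b in auto)
qed

text \<open>By \<open>two_returns\<close> a second return from \<open>y\<close> to \<open>w\<close>
  that avoids \<open>suc w\<close> is enough. A detour at \<open>y\<close> provides one; if there is
  none, the arcs of \<open>no_detour_double\<close> at \<open>y\<close> bypass \<open>suc y\<close>.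
  The bypass is useless only if it lands on \<open>suc w\<close>, that is, if \<open>p\<close> is a
  triangle; then the 2x2x2 shape appears instead.\<close>

lemma detour_exists:
  assumes w: "w \<in> K"
  shows "\<exists>R. detour w R"
proof (rule ccontr)
  assume "\<not> ?thesis"
  then have n: "\<And>R. \<not> detour w R" by blast
  have s: "suc w \<in> K" "suc (suc w) \<in> K" using w suc_K by auto
  define y where "y = suc (suc w)"
  have y: "y \<in> K" "y \<noteq> w" "y \<noteq> suc w" using s suc_ne[OF w] suc_ne(1)[OF s(1)] by (auto simp: y_def)
  obtain r where r: "apath y r w" "set (awalk_verts y r) = K - {suc w}" "set r \<subseteq> set p"
    using around[OF w] unfolding y_def by metis
  have contra: False if "apath y q w" "suc w \<notin> set (awalk_verts y q)" "set r \<noteq> set q" for q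
    using two_returns[OF w n, of r q] r that unfolding y_def by blast
  show False
  proof (cases "\<exists>R. detour y R")
    case True
    then obtain R where R: "apath y R (suc y)" "nxt y \<notin> set R" "set (awalk_verts y R) \<subseteq> {y, suc y} \<union> side y"
      by (auto simp: detour_def)
    have "r \<noteq> []" using r(1) y(2) by (auto simp: apath_Nil_iff)
    then obtain e r' where e: "r = e # r'" by (cases r) auto
    have te: "tail G e = y" using r(1) unfolding e apath_Cons_iff by blast
    have "e \<in> set p" using r(3) e by simp
    then have en: "e = nxt y" using nxt_unique te by metis
    have r': "apath (suc y) r' w" "y \<notin> set (awalk_verts (suc y) r')"
      using r(1) te unfolding e en apath_Cons_iff by auto
    have vr': "set (awalk_verts (suc y) r') \<subseteq> K - {suc w, y}"
      using r(2) r'(2) unfolding e en by auto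
    have i: "set (awalk_verts y R) \<inter> set (awalk_verts (suc y) r') \<subseteq> {suc y}"
      using R(3) vr' by (auto simp: side_def)
    note ap = apath_append[OF R(1) r'(1) i]
    show False
    proof (rule contra[OF ap(1)])
      have "suc w \<noteq> suc y" using suc_inj[OF w y(1)] y(2) by auto
      then show "suc w \<notin> set (awalk_verts y (R @ r'))"
        unfolding ap(2) using R(3) vr' y(3) s(1) by (auto simp: side_def)
      have "nxt y \<notin> set r'" using r'(2) awalk_verts_arc1[of "nxt y" r'] nxt(2)[OF y(1)] by auto
      then show "set r \<noteq> set (R @ r')" using R(2) e en by auto
    qed
  next
    case False
    then have ny: "\<And>R. \<not> detour y R" by blast
    obtain d f1 f2 where d: "d \<in> arcs G" "tail G d = y" "head G d \<notin> K" and f: "f1 \<in> arcs G" "f2 \<in> arcs G" "f1 \<noteq> f2"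
      "tail G f1 = head G d" "tail G f2 = head G d" "head G f1 = suc (suc y)" "head G f2 = suc (suc y)"
      by (rule no_detour_double[OF y(1) ny])
    have sy: "suc y \<in> K" "suc (suc y) \<in> K" using y suc_K by auto
    show False
    proof (cases "suc (suc y) = suc w")
      case False
      then have "suc (suc y) \<in> set (awalk_verts y r)" using r(2) sy by simp
      from apath_suffix[OF r(1) this suc_ne(2)[OF y(1)]] obtain q where q: "apath (suc (suc y)) q w"
        "set (awalk_verts (suc (suc y)) q) \<subseteq> set (awalk_verts y r) - {y}" by metis
      have "apath y (d # f1 # q) w" using q r(2) d f y(1) by (auto simp: apath_Cons_iff)
      moreover have "suc w \<notin> set (awalk_verts y (d # f1 # q))" using q(2) r(2) d f y(3) s(1) by auto
      moreover have "d \<notin> set r" using r(3) cycle_heads[OF p] d(3) by (auto simp: K)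
      then have "set r \<noteq> set (d # f1 # q)" by auto
      ultimately show False by (rule contra)
    next
      case True
      have swy: "suc y = w" using suc_inj[OF sy(1) w True] .
      obtain d0 e1 e2 where d0: "d0 \<in> arcs G" "tail G d0 = w" "head G d0 \<notin> K" and e: "e1 \<in> arcs G" "e2 \<in> arcs G" "e1 \<noteq> e2"
        "tail G e1 = head G d0" "tail G e2 = head G d0" "head G e1 = y" "head G e2 = y"
        by (rule no_detour_double[OF w n, folded y_def])
      \<comment> \<open>In the triangle \<open>w\<close>, \<open>suc w\<close>, \<open>y\<close>,
        parallel arcs are known behind the outside neighbours of \<open>w\<close> and of
        \<open>y\<close>. The third pair is found backwards: a second arc \<open>a\<close> into
        \<open>w\<close> comes from outside, and all arcs into its tail start at
        \<open>suc w\<close>.\<close>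
      have "2 \<le> card (in_arcs G w)" using deg[OF K_verts[OF w]] by (simp add: in_degree_def)
      then obtain a where a: "a \<in> in_arcs G w" "a \<noteq> nxt y" by (rule card_ge_2_obtain)
      have aK: "tail G a \<notin> K"
      proof
        assume t: "tail G a \<in> K"
        then have "w = suc (tail G a)" using arc_K[of a] a w by auto
        then have "tail G a = y" using suc_inj[OF t y(1)] swy by simp
        then show False using detour_parallel[OF y(1), of a] a swy ny by auto
      qed
      have a': "a \<in> arcs G" "head G a = w" using a(1) by simp_all
      have tg: "tail G g = suc w" if gin: "g \<in> in_arcs G (tail G a)" for g
      proof -
        have g: "g \<in> arcs G" "head G g = tail G a" using gin by simp_all
        have gK: "head G g \<notin> K" using g(2) aK by simp
        have t: "tail G g \<in> K" by (rule in_arc_K[OF aK g])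
        have "tail G g \<noteq> y"
        proof
          assume "tail G g = y"
          from detour_outside[OF y(1) g(1) this gK a'(1) g(2)[symmetric]] swy a'(2) ny show False by simp
        qed
        then have n1: "w \<noteq> suc (tail G g)" using suc_inj[OF t y(1)] unfolding swy by metis
        have "head G a \<in> K" using a'(2) w by simp
        from arc2_K[OF g(1) t gK a'(1) g(2)[symmetric] this] n1 have "suc (suc (tail G g)) = suc y"
          unfolding a'(2) swy by simp
        from suc_inj[OF suc_K[OF t] y(1) this] have "suc (tail G g) = suc (suc w)" unfolding y_def .
        from suc_inj[OF t s(1) this] show ?thesis .
      qed
      have "tail G a \<in> verts G" using a by simp
      then have c: "2 \<le> card (in_arcs G (tail G a))" using deg by (simp add: in_degree_def)
      obtain g1 where g1: "g1 \<in> in_arcs G (tail G a)" by (rule card_ge_2_obtain[OF c, of undefined]) (rule that)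
      obtain g2 where g2: "g2 \<in> in_arcs G (tail G a)" "g2 \<noteq> g1" by (rule card_ge_2_obtain[OF c])
      have t: "tail G g1 = suc w" "tail G g2 = suc w" by (rule tg[OF g1], rule tg[OF g2(1)])
      have g: "g1 \<in> arcs G" "g2 \<in> arcs G" "head G g1 = tail G a" "head G g2 = tail G a" using g1 g2 by simp_all
      have u1: "head G d0 \<noteq> tail G a" using no2[OF d0(1) a'(1)] d0(2) a'(2) by auto
      have u2: "head G d \<noteq> tail G a"
      proof
        assume "head G d = tail G a"
        then have "tail G f1 = head G g1" using f(4) g(3) by simp
        from no2[OF f(1) g(1) this] show False using f(6) t(1) True by simp
      qed
      have u3: "head G d0 \<noteq> head G d"
      proof
        assume "head G d0 = head G d"
        then have "head G d = tail G e1" using e(4) by simp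
        moreover have "tail G d = head G e1" using d(2) e(6) by simp
        ultimately show False using no2[OF d(1) e(1)] by blast
      qed
      have ws: "w \<noteq> suc w" using suc_ne(1)[OF w] by simp
      have n1: "suc w \<noteq> tail G a" "suc w \<noteq> head G d0" "tail G a \<noteq> w" "w \<noteq> head G d0" "head G d0 \<noteq> y"
        "y \<noteq> head G d" "head G d \<noteq> suc w" using aK d0(3) d(3) s(1) w y(1) by auto
      note P1 = apath3[OF g(1) a'(1) d0(1) t(1) g(3) refl a'(2) d0(2) refl n1(1) ws[symmetric] n1(2,3) u1[symmetric] n1(4)]
      note P2 = apath3[OF g(2) a'(1) d0(1) t(2) g(4) refl a'(2) d0(2) refl n1(1) ws[symmetric] n1(2,3) u1[symmetric] n1(4)]
      note Q1 = apath1[OF e(1,4,6) n1(5)]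
      note Q2 = apath1[OF e(2,5,7) n1(5)]
      note R1 = apath2[OF d(1) f(1) d(2) refl f(4,6)[unfolded True] n1(6,7) y(3)]
      note R2 = apath2[OF d(1) f(2) d(2) refl f(5,7)[unfolded True] n1(6,7) y(3)]
      \<comment> \<open>The corners are \<open>suc w\<close>, \<open>head G d0\<close> and
        \<open>y\<close>. The first side runs through \<open>tail G a\<close> and \<open>w\<close>
        and is doubled by \<open>g1\<close>, \<open>g2\<close>; the second by \<open>e1\<close>,
        \<open>e2\<close>; the third runs through \<open>head G d\<close> and is doubled by
        \<open>f1\<close>, \<open>f2\<close>.\<close>
      show False
      proof (rule no_K222[OF rig, of "suc w" "head G d0" y "[g1, a, d0]" "[g2, a, d0]" "[e1]" "[e2]" "[d, f1]" "[d, f2]"])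
        show "suc w \<noteq> head G d0" "head G d0 \<noteq> y" "y \<noteq> suc w" by (rule n1 y)+
        have vP: "set (awalk_verts (suc w) p') = {suc w, tail G a, w, head G d0}" if "p' \<in> {[g1, a, d0], [g2, a, d0]}" for p'
          using that P1(2) P2(2) by (elim insertE emptyE) (simp_all only: list.set)
        have vQ: "set (awalk_verts (head G d0) q') = {head G d0, y}" if "q' \<in> {[e1], [e2]}" for q'
          using that Q1(2) Q2(2) by (elim insertE emptyE) (simp_all only: list.set)
        have vR: "set (awalk_verts y r') = {y, head G d, suc w}" if "r' \<in> {[d, f1], [d, f2]}" for r'
          using that R1(2) R2(2) by (elim insertE emptyE) (simp_all only: list.set)
        show "set (awalk_verts (suc w) p') \<inter> set (awalk_verts (head G d0) q') \<subseteq> {head G d0}"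
          if "p' \<in> {[g1, a, d0], [g2, a, d0]}" "q' \<in> {[e1], [e2]}" for p' q'
          unfolding vP[OF that(1)] vQ[OF that(2)] using y aK by auto
        show "set (awalk_verts (head G d0) q') \<inter> set (awalk_verts y r') \<subseteq> {y}"
          if "q' \<in> {[e1], [e2]}" "r' \<in> {[d, f1], [d, f2]}" for q' r'
          unfolding vR[OF that(2)] vQ[OF that(1)] using u3 n1 by auto
        show "set (awalk_verts y r') \<inter> set (awalk_verts (suc w) p') \<subseteq> {suc w}"
          if "r' \<in> {[d, f1], [d, f2]}" "p' \<in> {[g1, a, d0], [g2, a, d0]}" for r' p'
          unfolding vR[OF that(1)] vP[OF that(2)] using u2 u3 n1 y aK d(3) w by auto
        have "g1 \<noteq> a" "g1 \<noteq> d0" using t(1) aK d0(2) s(1) ws by auto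
        then show "set [g1, a, d0] \<noteq> set [g2, a, d0]" using g2(2) by auto
        show "set [e1] \<noteq> set [e2]" using e by auto
        have "f1 \<noteq> d" using f(4) d(2,3) y(1) by auto
        then show "set [d, f1] \<noteq> set [d, f2]" using f(3) by auto
      qed (rule P1 P2 Q1 Q2 R1 R2)+
    qed
  qed
qed

text \<open>A common vertex would form a 2-cycle with \<open>suc w\<close>.\<close>

lemma side_disjoint: "u \<in> side w \<Longrightarrow> u \<notin> side (suc w)"
proof
  assume u: "u \<in> side w" "u \<in> side (suc w)"
  obtain f where f: "f \<in> arcs G" "tail G f = u" "head G f = suc w" using u(1) by (auto simp: side_def)
  obtain d where d: "d \<in> arcs G" "tail G d = suc w" "head G d = u" using u(2) by (auto simp: side_def)
  have "tail G d = head G f" "head G d = tail G f" using d f by simp_all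
  with no2[OF d(1) f(1)] show False by blast
qed

text \<open>The corners \<open>w\<close>, \<open>y\<close>, \<open>z\<close> cut \<open>p\<close>
  into two single arcs and the return from \<open>z\<close>. Detours at \<open>w\<close> and
  \<open>y\<close> double the first two sides, and a detour at \<open>z\<close> doubles the first
  step of the return.\<close>

theorem contradiction: False
proof -
  have "p \<noteq> []" using cycle_arcs_sub[OF p] by simp
  then obtain w where w: "w \<in> K" by (cases p) (auto simp: K)
  define y where "y = suc w"
  define z where "z = suc y"
  have yz: "y \<in> K" "z \<in> K" using w suc_K by (auto simp: y_def z_def)
  have ne: "w \<noteq> y" "y \<noteq> z" "z \<noteq> w"
    using suc_ne[OF w] suc_ne(1)[OF yz(1)] by (auto simp: y_def z_def)
  obtain P where P: "apath w P y" "nxt w \<notin> set P" "set (awalk_verts w P) \<subseteq> {w, y} \<union> side w"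
    using detour_exists[OF w] by (auto simp: detour_def y_def)
  obtain Q where Q: "apath y Q z" "nxt y \<notin> set Q" "set (awalk_verts y Q) \<subseteq> {y, z} \<union> side y"
    using detour_exists[OF yz(1)] by (auto simp: detour_def z_def)
  obtain T where T: "apath z T (suc z)" "nxt z \<notin> set T" "set (awalk_verts z T) \<subseteq> {z, suc z} \<union> side z"
    using detour_exists[OF yz(2)] by (auto simp: detour_def)
  obtain r where r: "apath z r w" "set (awalk_verts z r) = K - {y}" "set r \<subseteq> set p"
    using around[OF w] unfolding z_def y_def by metis
  have "r \<noteq> []" using r(1) ne by (auto simp: apath_Nil_iff)
  then obtain e r' where e: "r = e # r'" by (cases r) auto
  have te: "tail G e = z" using r(1) unfolding e apath_Cons_iff by blast
  have "e \<in> set p" using r(3) e by simp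
  then have en: "e = nxt z" using nxt_unique te by metis
  have r': "apath (suc z) r' w" "z \<notin> set (awalk_verts (suc z) r')"
    using r(1) te unfolding e en apath_Cons_iff by auto
  have vr': "set (awalk_verts (suc z) r') \<subseteq> K - {y, z}"
    using r(2) r'(2) unfolding e en by auto
  have i: "set (awalk_verts z T) \<inter> set (awalk_verts (suc z) r') \<subseteq> {suc z}"
    using T(3) vr' by (auto simp: side_def)
  note ap = apath_append[OF T(1) r'(1) i]
  have szy: "suc z \<noteq> y" using suc_inj[OF yz(2) w] ne by (auto simp: y_def)
  note c = apath1[OF nxt(3)[OF w] nxt(2)[OF w] y_def[symmetric] ne(1)]
    apath1[OF nxt(3)[OF yz(1)] nxt(2)[OF yz(1)] z_def[symmetric] ne(2)]
  have vp: "set (awalk_verts w q) \<subseteq> {w, y} \<union> side w" if "q \<in> {[nxt w], P}" for q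
    using that c P by auto
  have vq: "set (awalk_verts y q) \<subseteq> {y, z} \<union> side y" if "q \<in> {[nxt y], Q}" for q
    using that c Q by auto
  have vt: "set (awalk_verts z q) \<subseteq> (K - {y}) \<union> side z" if "q \<in> {r, T @ r'}" for q
  proof -
    have "set (awalk_verts z (T @ r')) \<subseteq> (K - {y}) \<union> side z"
      unfolding ap(2) using T(3) vr' yz ne szy suc_K[OF yz(2)] by auto
    then show ?thesis using that r(2) by auto
  qed
  have sK: "u \<notin> K" if "u \<in> side v" for u v using that by (simp add: side_def)
  have s1: "side w \<inter> side y = {}" "side y \<inter> side z = {}" using side_disjoint by (auto simp: y_def z_def)
  \<comment> \<open>A vertex beside both \<open>w\<close> and \<open>z\<close> gives a way of two
    arcs from \<open>z\<close> to \<open>y\<close>; by \<open>arc2_K\<close> this makes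
    \<open>p\<close> a triangle, and then the vertex forms a 2-cycle with \<open>w\<close>.\<close>
  have s2: "side w \<inter> side z = {}"
  proof (rule ccontr)
    assume "side w \<inter> side z \<noteq> {}"
    then obtain u where u: "u \<in> side w" "u \<in> side z" by blast
    obtain d0 f0 where d0: "d0 \<in> arcs G" "tail G d0 = w" "head G d0 = u" "f0 \<in> arcs G" "tail G f0 = u" "head G f0 = y"
      using u(1) by (auto simp: side_def y_def)
    obtain d1 f1 where d1: "d1 \<in> arcs G" "tail G d1 = z" "head G d1 = u" "f1 \<in> arcs G" "tail G f1 = u" "head G f1 = suc z"
      using u(2) by (auto simp: side_def)
    have "y = suc z \<or> y = suc (suc z)" using arc2_K[of d1 f0] d0 d1 yz sK[OF u(1)] by auto
    then have "suc z = w" using szy suc_inj[OF w suc_K[OF yz(2)]] by (auto simp: y_def)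
    then show False using no2[of d0 f1] d0 d1 by auto
  qed
  show False
  proof (rule no_K222[OF rig ne, of "[nxt w]" P "[nxt y]" Q r "T @ r'"])
    show "set (awalk_verts w p') \<inter> set (awalk_verts y q') \<subseteq> {y}" if "p' \<in> {[nxt w], P}" "q' \<in> {[nxt y], Q}" for p' q'
      using vp[OF that(1)] vq[OF that(2)] sK w yz ne s1 by blast
    show "set (awalk_verts y q') \<inter> set (awalk_verts z t') \<subseteq> {z}" if "q' \<in> {[nxt y], Q}" "t' \<in> {r, T @ r'}" for q' t'
      using vq[OF that(1)] vt[OF that(2)] sK w yz ne s1 by blast
    show "set (awalk_verts z t') \<inter> set (awalk_verts w p') \<subseteq> {w}" if "t' \<in> {r, T @ r'}" "p' \<in> {[nxt w], P}" for t' p'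
      using vp[OF that(2)] vt[OF that(1)] sK w yz ne s2 by blast
    show "set [nxt w] \<noteq> set P" "set [nxt y] \<noteq> set Q" using P(2) Q(2) by auto
    have "nxt z \<notin> set r'" using r'(2) awalk_verts_arc1[of "nxt z" r'] nxt(2)[OF yz(2)] by auto
    then show "set r \<noteq> set (T @ r')" using T(2) e en by auto
  qed (use P Q r ap(1) c in auto)
qed

end

section \<open>Reduced complete intersections\<close>

context merging
begin

text \<open>Transfers the hypotheses of the star statement to the contraction, with \<open>k\<close>
  as the centre; conditions are asked off \<open>K\<close> because the centre absorbs
  \<open>K\<close>. The induction hypothesis appears as a premise since the induction runs outside
  this locale.\<close>

lemma merge_star:
  assumes IH: "\<And>(G' :: ('v, 'b) pre_digraph) h. card (verts G') < card (verts G) \<Longrightarrow> fin_digraph G' \<Longrightarrow>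
      descends C0 (arcs G') (cycs G') \<Longrightarrow> strongly_connected G' \<Longrightarrow> h \<in> verts G' \<Longrightarrow>
      (\<And>a. a \<in> arcs G' \<Longrightarrow> tail G' a \<noteq> head G' a) \<Longrightarrow>
      (\<And>v. v \<in> verts G' - {h} \<Longrightarrow> 2 \<le> in_degree G' v \<and> 2 \<le> out_degree G' v) \<Longrightarrow>
      (\<And>a b. a \<in> arcs G' \<Longrightarrow> b \<in> arcs G' \<Longrightarrow> tail G' a = head G' b \<Longrightarrow> head G' a = tail G' b \<Longrightarrow> h \<in> {tail G' a, head G' a}) \<Longrightarrow>
      \<forall>a\<in>arcs G'. tail G' a = h \<or> head G' a = h"
    and dG: "descends C0 (arcs G) (cycs G)" and sc: "strongly_connected G"
    and ll: "\<And>a. a \<in> arcs G \<Longrightarrow> tail G a \<noteq> head G a"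
    and deg: "\<And>v. v \<in> verts G - K \<Longrightarrow> 2 \<le> in_degree G v \<and> 2 \<le> out_degree G v"
    and no2: "\<And>a b. a \<in> arcs G \<Longrightarrow> b \<in> arcs G \<Longrightarrow> tail G a = head G b \<Longrightarrow> head G a = tail G b \<Longrightarrow> tail G a \<in> K \<or> head G a \<in> K"
    and dM: "descends (cycs G) (arcs M) (cycs M)" and K2: "x \<in> K" "x \<noteq> k"
    and a: "a \<in> arcs G"
  shows "tail G a \<in> K \<or> head G a \<in> K"
proof -
  have sub: "verts M \<subset> verts G"
  proof
    show "verts M \<subseteq> verts G" using K by auto
    have "x \<in> verts G" "x \<notin> verts M" using K K2 by auto
    then show "verts M \<noteq> verts G" by blast
  qed
  have "\<forall>a\<in>arcs M. tail M a = k \<or> head M a = k"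
  proof (rule IH)
    show "card (verts M) < card (verts G)" using sub by (intro psubset_card_mono) auto
    show "fin_digraph M" by (rule M.fin_digraph)
    show "descends C0 (arcs M) (cycs M)" by (rule descends_trans[OF dG dM]) auto
    show "strongly_connected M" by (rule merge_strongly_connected[OF sc])
    show "k \<in> verts M" by simp
    show "tail M a \<noteq> head M a" if "a \<in> arcs M" for a
      using that ll[of a] K(2) by auto
    show "2 \<le> in_degree M v \<and> 2 \<le> out_degree M v" if "v \<in> verts M - {k}" for v
    proof -
      have v: "v \<in> verts G - K" using that by auto
      then have "in_arcs M v = in_arcs G v" "out_arcs M v = out_arcs G v" using that by auto
      then show ?thesis using deg[OF v] by (simp add: in_degree_def out_degree_def)
    qed
    show "k \<in> {tail M a, head M a}"
      if ab: "a \<in> arcs M" "b \<in> arcs M" "tail M a = head M b" "head M a = tail M b" for a b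
    proof (rule ccontr)
      assume n: "k \<notin> {tail M a, head M a}"
      then have a: "tail G a \<notin> K" "head G a \<notin> K" by (auto split: if_splits)
      have "tail M b \<noteq> k" "head M b \<noteq> k" using n ab by auto
      then have b: "tail G b \<notin> K" "head G b \<notin> K" by (auto split: if_splits)
      have "tail G a = head G b" "head G a = tail G b" using ab(3,4) a b by simp_all
      then show False using no2[of a b] ab(1,2) a by simp
    qed
  qed
  note star = this
  show ?thesis
  proof (rule ccontr)
    assume n: "\<not> ?thesis"
    then have "a \<in> arcs M" using a by simp
    with star have "tail M a = k \<or> head M a = k" by blast
    then show False using n K(2) by (auto split: if_splits)
  qed
qed

end

text \<open>The centre \<open>h\<close> is exempt from the degree condition because contraction
  produces a vertex of uncontrolled degree. Rigidity is assumed for everything that descends from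
  the fixed family \<open>C0\<close>, so it is available for all later contractions at once.\<close>

lemma star_quiver:
  fixes G :: "('v, 'b) pre_digraph"
  assumes rig: "\<And>A' C'. descends C0 A' C' \<Longrightarrow> (\<And>c d. c \<in> C' \<Longrightarrow> d \<in> C' \<Longrightarrow> c \<subseteq> d \<Longrightarrow> c = d) \<Longrightarrow> {} \<notin> C' \<Longrightarrow> rigid C'"
    and "fin_digraph G" "descends C0 (arcs G) (cycs G)" "strongly_connected G" "h \<in> verts G"
    and "\<And>a. a \<in> arcs G \<Longrightarrow> tail G a \<noteq> head G a"
    and "\<And>v. v \<in> verts G - {h} \<Longrightarrow> 2 \<le> in_degree G v \<and> 2 \<le> out_degree G v"
    and "\<And>a b. a \<in> arcs G \<Longrightarrow> b \<in> arcs G \<Longrightarrow> tail G a = head G b \<Longrightarrow> head G a = tail G b \<Longrightarrow> h \<in> {tail G a, head G a}"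
  shows "\<forall>a\<in>arcs G. tail G a = h \<or> head G a = h"
  using assms(2-)
proof (induction "card (verts G)" arbitrary: G h rule: less_induct)
  case less
  interpret fin_digraph G by (rule less.prems(1))
  note dG = less.prems(2) and sc = less.prems(3) and h = less.prems(4) and ll = less.prems(5)
    and deg = less.prems(6) and no2 = less.prems(7)
  have rG: "rigid (cycs G)" using rig[OF dG] cycs_antichain cycs_sub(2) by blast
  have IH: "\<forall>a\<in>arcs G'. tail G' a = h \<or> head G' a = h"
    if "card (verts G') < card (verts G)" "fin_digraph G'"
      "descends C0 (arcs G') (cycs G')" "strongly_connected G'" "h \<in> verts G'"
      "\<And>a. a \<in> arcs G' \<Longrightarrow> tail G' a \<noteq> head G' a"
      "\<And>v. v \<in> verts G' - {h} \<Longrightarrow> 2 \<le> in_degree G' v \<and> 2 \<le> out_degree G' v"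
      "\<And>a b. a \<in> arcs G' \<Longrightarrow> b \<in> arcs G' \<Longrightarrow> tail G' a = head G' b \<Longrightarrow> head G' a = tail G' b \<Longrightarrow> h \<in> {tail G' a, head G' a}"
    for G' :: "('v, 'b) pre_digraph" and h
    using less.hyps[OF that] .
  have cycle_star: "tail G a \<in> tail G ` set p \<or> head G a \<in> tail G ` set p"
    if p: "cycle p" and deg': "\<And>v. v \<in> verts G - tail G ` set p \<Longrightarrow> 2 \<le> in_degree G v \<and> 2 \<le> out_degree G v"
      and no2': "\<And>a b. a \<in> arcs G \<Longrightarrow> b \<in> arcs G \<Longrightarrow> tail G a = head G b \<Longrightarrow> head G a = tail G b \<Longrightarrow>
        tail G a \<in> tail G ` set p \<or> head G a \<in> tail G ` set p" and a: "a \<in> arcs G" for p a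
  proof -
    have ps: "set p \<subseteq> arcs G" "p \<noteq> []" using cycle_arcs_sub[OF p] by auto
    obtain e where e: "e \<in> set p" using ps(2) by (cases p) auto
    interpret merging G "tail G ` set p" "tail G e"
      using ps e by unfold_locales auto
    have hd: "head G e \<in> tail G ` set p" "head G e \<noteq> tail G e"
      using cycle_heads[OF p] e ll[of e] ps(1) by (auto simp: set_eq_iff)
    show ?thesis
      by (rule merge_star[OF IH dG sc ll deg' no2' merge_cycle_descends[OF p refl] hd a])
  qed
  show ?case
  proof (cases "\<exists>e1\<in>arcs G. \<exists>e2\<in>arcs G. tail G e1 = h \<and> head G e2 = h \<and> head G e1 = tail G e2")
    case True
    then obtain e1 e2 where e: "e1 \<in> arcs G" "e2 \<in> arcs G" "tail G e1 = h" "head G e2 = h" "tail G e2 = head G e1" by metis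
    define w where "w = head G e1"
    have wh: "w \<noteq> h" using ll[OF e(1)] e(3) by (simp add: w_def)
    have wv: "w \<in> verts G" using e(1) by (simp add: w_def)
    note p1 = apath1[OF e(1) e(3) w_def[symmetric] wh[symmetric]]
    note p2 = apath1[OF e(2) e(5)[folded w_def] e(4) wh]
    have cyc: "cycle [e1, e2]"
      by (rule cycle_ConsI[OF e(1)]) (use p2 e(3) w_def in simp)
    have K: "tail G ` set [e1, e2] = {h, w}" using e by (simp add: w_def)
    have inc: "tail G a \<in> {h, w} \<or> head G a \<in> {h, w}" if "a \<in> arcs G" for a
      using cycle_star[OF cyc _ _ that] deg no2 unfolding K by auto
    show ?thesis
    proof (rule ccontr)
      assume "\<not> ?thesis"
      then obtain d where d: "d \<in> arcs G" "tail G d \<noteq> h" "head G d \<noteq> h" by blast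
      have degw: "2 \<le> card (in_arcs G w)" "2 \<le> card (out_arcs G w)"
        using deg[of w] wv wh by (simp_all add: in_degree_def out_degree_def)
      from inc[OF d(1)] d consider "head G d = w" | "tail G d = w" by blast
      then show False
      proof cases
        case 1
        \<comment> \<open>All arcs into \<open>x\<close> come from \<open>h\<close>, and there are
          at least two. Followed by \<open>d\<close> they give two ways from \<open>h\<close> to
          \<open>w\<close> besides \<open>e1\<close>; the outdegree of \<open>w\<close> yields a
          second way back to \<open>h\<close>, and the 2 by 3 shape is complete.\<close>
        define x where "x = tail G d"
        have x: "x \<noteq> h" "x \<noteq> w" "x \<in> verts G" using d ll[OF d(1)] 1 by (auto simp: x_def)
        have tx: "tail G f = h" if "f \<in> in_arcs G x" for f
        proof -
          have f: "f \<in> arcs G" "head G f = x" using that by simp_all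
          have "tail G f \<noteq> w" using no2[OF f(1) d(1)] f(2) 1 x wh by (auto simp: x_def)
          then show ?thesis using inc[OF f(1)] f(2) x by auto
        qed
        have c: "2 \<le> card (in_arcs G x)" using deg[of x] x by (simp add: in_degree_def)
        obtain f1 where f1: "f1 \<in> in_arcs G x" by (rule card_ge_2_obtain[OF c, of undefined]) (rule that)
        obtain f2 where f2: "f2 \<in> in_arcs G x" "f2 \<noteq> f1" by (rule card_ge_2_obtain[OF c])
        obtain q where q: "apath w q h" "x \<notin> set (awalk_verts w q)" "set [e2] \<noteq> set q"
        proof -
          obtain e3 where e3: "e3 \<in> out_arcs G w" "e3 \<noteq> e2" by (rule card_ge_2_obtain[OF degw(2)])
          have e3': "e3 \<in> arcs G" "tail G e3 = w" using e3(1) by simp_all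
          show thesis
          proof (cases "head G e3 = h")
            case True
            note p3 = apath1[OF e3' True wh]
            have "x \<notin> set (awalk_verts w [e3])" unfolding p3(2) using x by simp
            then show thesis using that[OF p3(1)] e3(2) by simp
          next
            case False
            define y where "y = head G e3"
            have y: "y \<noteq> h" "y \<noteq> w" "y \<in> verts G" using False ll[OF e3'(1)] e3' by (auto simp: y_def)
            have yx: "y \<noteq> x" using no2[OF e3'(1) d(1)] e3'(2) 1 x wh by (auto simp: x_def y_def)
            have "2 \<le> card (out_arcs G y)" using deg[of y] y by (simp add: out_degree_def)
            then obtain e4 where "e4 \<in> out_arcs G y" "e4 \<noteq> e2" by (rule card_ge_2_obtain)
            then have e4: "e4 \<in> arcs G" "tail G e4 = y" by simp_all
            have "head G e4 \<noteq> w" using no2[OF e4(1) e3'(1)] e4(2) e3'(2) y wh by (auto simp: y_def)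
            then have he4: "head G e4 = h" using inc[OF e4(1)] e4(2) y by auto
            note p3 = apath2[OF e3'(1) e4(1) e3'(2) y_def[symmetric] e4(2) he4 y(2)[symmetric] y(1) wh]
            have "x \<notin> set (awalk_verts w [e3, e4])" unfolding p3(2) using x yx by simp
            moreover have "set [e2] \<noteq> set [e3, e4]" using e3(2) by auto
            ultimately show thesis using that[OF p3(1)] by blast
          qed
        qed
        have f: "f1 \<in> arcs G" "head G f1 = x" "tail G f1 = h" "f2 \<in> arcs G" "head G f2 = x" "tail G f2 = h"
          using f1 f2 tx by simp_all
        note r1 = apath2[OF f(1) d(1) f(3,2) x_def[symmetric] 1 x(1)[symmetric] x(2) wh[symmetric]]
        note r2 = apath2[OF f(4) d(1) f(6,5) x_def[symmetric] 1 x(1)[symmetric] x(2) wh[symmetric]]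
        show False
        proof (rule no_K23[OF rG wh[symmetric] p2(1) q(1) p1(1) r1(1) r2(1)])
          show "set (awalk_verts w [e2]) \<inter> set (awalk_verts h [e1]) \<subseteq> {h, w}" unfolding p1(2) p2(2) by auto
          show "set (awalk_verts w [e2]) \<inter> set (awalk_verts h [f1, d]) \<subseteq> {h, w}" unfolding p2(2) by auto
          show "set (awalk_verts w [e2]) \<inter> set (awalk_verts h [f2, d]) \<subseteq> {h, w}" unfolding p2(2) by auto
          show "set (awalk_verts w q) \<inter> set (awalk_verts h [e1]) \<subseteq> {h, w}" unfolding p1(2) by auto
          show "set [e2] \<noteq> set q" by (rule q)
          have "f1 \<noteq> d" "f2 \<noteq> d" using f d by auto
          then show "set [f1, d] \<noteq> set [f2, d]" using f2(2) by auto
          show "e1 \<in> set [e1]" by simp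
          show "e1 \<notin> set [f1, d]" "e1 \<notin> set [f2, d]" using f d x wh e(3) by (auto simp: w_def)
        qed
      next
        case 2
        \<comment> \<open>The mirror image: all arcs out of \<open>x\<close> end at
          \<open>h\<close>, and the second way from \<open>h\<close> to \<open>w\<close> comes from
          the indegree of \<open>w\<close>.\<close>
        define x where "x = head G d"
        have x: "x \<noteq> h" "x \<noteq> w" "x \<in> verts G" using d ll[OF d(1)] 2 by (auto simp: x_def)
        have hx: "head G f = h" if "f \<in> out_arcs G x" for f
        proof -
          have f: "f \<in> arcs G" "tail G f = x" using that by simp_all
          have "head G f \<noteq> w" using no2[OF f(1) d(1)] f(2) 2 x wh by (auto simp: x_def)
          then show ?thesis using inc[OF f(1)] f(2) x by auto
        qed
        have c: "2 \<le> card (out_arcs G x)" using deg[of x] x by (simp add: out_degree_def)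
        obtain f1 where f1: "f1 \<in> out_arcs G x" by (rule card_ge_2_obtain[OF c, of undefined]) (rule that)
        obtain f2 where f2: "f2 \<in> out_arcs G x" "f2 \<noteq> f1" by (rule card_ge_2_obtain[OF c])
        obtain q where q: "apath h q w" "set [e1] \<noteq> set q"
        proof -
          obtain e3 where e3: "e3 \<in> in_arcs G w" "e3 \<noteq> e1" by (rule card_ge_2_obtain[OF degw(1)])
          have e3': "e3 \<in> arcs G" "head G e3 = w" using e3(1) by simp_all
          show thesis
          proof (cases "tail G e3 = h")
            case True
            show thesis using that[OF apath1(1)[OF e3'(1) True e3'(2) wh[symmetric]]] e3(2) by simp
          next
            case False
            define y where "y = tail G e3"
            have y: "y \<noteq> h" "y \<noteq> w" "y \<in> verts G" using False ll[OF e3'(1)] e3' by (auto simp: y_def)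
            have "2 \<le> card (in_arcs G y)" using deg[of y] y by (simp add: in_degree_def)
            then obtain e4 where "e4 \<in> in_arcs G y" "e4 \<noteq> e1" by (rule card_ge_2_obtain)
            then have e4: "e4 \<in> arcs G" "head G e4 = y" by simp_all
            have "tail G e4 \<noteq> w" using no2[OF e4(1) e3'(1)] e4(2) e3'(2) y wh by (auto simp: y_def)
            then have te4: "tail G e4 = h" using inc[OF e4(1)] e4(2) y by auto
            note p3 = apath2[OF e4(1) e3'(1) te4 e4(2) y_def[symmetric] e3'(2) y(1)[symmetric] y(2) wh[symmetric]]
            have "set [e1] \<noteq> set [e4, e3]" using e3(2) by auto
            then show thesis using that[OF p3(1)] by blast
          qed
        qed
        have f: "f1 \<in> arcs G" "tail G f1 = x" "head G f1 = h" "f2 \<in> arcs G" "tail G f2 = x" "head G f2 = h"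
          using f1 f2 hx by simp_all
        note r1 = apath2[OF d(1) f(1) 2 x_def[symmetric] f(2,3) x(2)[symmetric] x(1) wh]
        note r2 = apath2[OF d(1) f(4) 2 x_def[symmetric] f(5,6) x(2)[symmetric] x(1) wh]
        show False
        proof (rule no_K23[OF rG wh p1(1) q(1) p2(1) r1(1) r2(1)])
          show "set (awalk_verts h [e1]) \<inter> set (awalk_verts w [e2]) \<subseteq> {w, h}" unfolding p1(2) p2(2) by auto
          show "set (awalk_verts h [e1]) \<inter> set (awalk_verts w [d, f1]) \<subseteq> {w, h}" unfolding p1(2) by auto
          show "set (awalk_verts h [e1]) \<inter> set (awalk_verts w [d, f2]) \<subseteq> {w, h}" unfolding p1(2) by auto
          show "set (awalk_verts h q) \<inter> set (awalk_verts w [e2]) \<subseteq> {w, h}" unfolding p2(2) by auto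
          show "set [e1] \<noteq> set q" by (rule q)
          have "f1 \<noteq> d" "f2 \<noteq> d" using f d by auto
          then show "set [d, f1] \<noteq> set [d, f2]" using f2(2) by auto
          show "e2 \<in> set [e2]" by simp
          show "e2 \<notin> set [d, f1]" "e2 \<notin> set [d, f2]" using f d x wh e(4,5) by (auto simp: w_def)
        qed
      qed
    qed
  next
    case False
    then have noh: "head G e1 \<noteq> tail G e2" if "e1 \<in> arcs G" "e2 \<in> arcs G" "tail G e1 = h" "head G e2 = h" for e1 e2
      using that by blast
    have no2': "head G a \<noteq> tail G b" if "a \<in> arcs G" "b \<in> arcs G" "tail G a = head G b" for a b
    proof
      assume e: "head G a = tail G b"
      from no2[OF that e] consider "tail G a = h" | "head G a = h" by blast
      then show False using noh[of a b] noh[of b a] that e by cases auto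
    qed
    have outside: "\<exists>a\<in>arcs G. tail G a = h" "\<exists>a\<in>arcs G. head G a = h" if "v \<in> verts G" "v \<noteq> h" for v
    proof -
      have "h \<rightarrow>\<^sup>*\<^bsub>G\<^esub> v" "v \<rightarrow>\<^sup>*\<^bsub>G\<^esub> h" using sc h that(1) by auto
      then obtain q r where q: "awalk h q v" "awalk v r h" by (metis reachable_awalk)
      then have "q \<noteq> []" "r \<noteq> []" using that(2) by (auto simp: awalk_Nil_iff)
      then obtain a q' b r' where "q = a # q'" "r = r' @ [b]" by (metis list.exhaust rev_exhaust)
      then have "a \<in> arcs G" "tail G a = h" "b \<in> arcs G" "head G b = h"
        using q by (auto simp: awalk_Cons_iff awalk_Nil_iff)
      then show "\<exists>a\<in>arcs G. tail G a = h" "\<exists>a\<in>arcs G. head G a = h" by blast+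
    qed
    show ?thesis
    proof (cases "verts G = {h}")
      case True
      then show ?thesis using ll head_in_verts tail_in_verts by blast
    next
      case False
      then obtain v0 where v0: "v0 \<in> verts G" "v0 \<noteq> h" using h by blast
      obtain eo ei where eo: "eo \<in> arcs G" "tail G eo = h" and ei: "ei \<in> arcs G" "head G ei = h"
        using outside[OF v0] by blast
      \<comment> \<open>Contracting the only arc out of \<open>h\<close>, or into \<open>h\<close>,
        shows that every arc meets \<open>{h, x}\<close>. But two steps backwards from
        \<open>x\<close>, or forwards in the dual case, that avoid \<open>e\<close> lead to an arc
        missing both vertices, as there are no 2-cycles.\<close>
      have single: False if e: "e \<in> arcs G" "{tail G e, head G e} = {h, x}" "x \<noteq> h"
        and o: "out_arcs G h = {e} \<and> head G e = x \<or> in_arcs G h = {e} \<and> tail G e = x" for e x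
      proof -
        have x: "x \<in> verts G"
        proof -
          have "x = tail G e \<or> x = head G e" using e(2) by (auto simp: doubleton_eq_iff)
          then show ?thesis using tail_in_verts[OF e(1)] head_in_verts[OF e(1)] by auto
        qed
        interpret merging G "{h, x}" h using x h by unfold_locales auto
        have inner: "arcs G - arcs M = {e}"
        proof
          show "arcs G - arcs M \<subseteq> {e}"
          proof
            fix a assume "a \<in> arcs G - arcs M"
            then have a: "a \<in> arcs G" "tail G a \<in> {h, x}" "head G a \<in> {h, x}" by auto
            have "tail G a \<noteq> head G a" using ll[OF a(1)] .
            then consider "tail G a = h" "head G a = x" | "tail G a = x" "head G a = h" using a by auto
            then show "a \<in> {e}"
            proof cases
              case 1
              from o show ?thesis
              proof
                assume "out_arcs G h = {e} \<and> head G e = x"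
                moreover have "a \<in> out_arcs G h" using a 1 by simp
                ultimately show ?thesis by simp
              next
                assume i: "in_arcs G h = {e} \<and> tail G e = x"
                then have "head G e = h" by auto
                then show ?thesis using noh[OF a(1) e(1)] 1 i by simp
              qed
            next
              case 2
              from o show ?thesis
              proof
                assume i: "out_arcs G h = {e} \<and> head G e = x"
                then have "tail G e = h" by auto
                then show ?thesis using noh[OF e(1) a(1)] 2 i by simp
              next
                assume "in_arcs G h = {e} \<and> tail G e = x"
                moreover have "a \<in> in_arcs G h" using a 2 by simp
                ultimately show ?thesis by simp
              qed
            qed
          qed
          show "{e} \<subseteq> arcs G - arcs M" using e by auto
        qed
        have star: "tail G a \<in> {h, x} \<or> head G a \<in> {h, x}" if "a \<in> arcs G" for a
        proof (rule merge_star[OF IH dG sc ll _ _ merge_single_arc_descends[OF refl e(3)[symmetric] inner o] _ _ that])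
          show "2 \<le> in_degree G v \<and> 2 \<le> out_degree G v" if "v \<in> verts G - {h, x}" for v using deg that by simp
          show "x \<in> {h, x}" "x \<noteq> h" using e(3) by simp_all
          show "tail G a \<in> {h, x} \<or> head G a \<in> {h, x}" if "a \<in> arcs G" "b \<in> arcs G" "tail G a = head G b" "head G a = tail G b" for a b
            using no2'[OF that(1-3)] that(4) by simp
        qed
        have dx: "2 \<le> card (in_arcs G x)" "2 \<le> card (out_arcs G x)"
          using deg[of x] x e(3) by (simp_all add: in_degree_def out_degree_def)
        from o show False
        proof
          assume o: "out_arcs G h = {e} \<and> head G e = x"
          have oh: "b = e" if "b \<in> arcs G" "tail G b = h" for b
          proof -
            have "b \<in> out_arcs G h" using that by simp
            then show ?thesis using o by simp
          qed
          obtain a where a: "a \<in> in_arcs G x" "a \<noteq> e" by (rule card_ge_2_obtain[OF dx(1)])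
          define y where "y = tail G a"
          have a': "a \<in> arcs G" "head G a = x" "tail G a = y" using a(1) by (simp_all add: y_def)
          have y: "y \<noteq> h" "y \<noteq> x" "y \<in> verts G" using oh[of a] a(2) a' ll[OF a'(1)] by auto
          have "2 \<le> card (in_arcs G y)" using deg[of y] y by (simp add: in_degree_def)
          then obtain b where b: "b \<in> in_arcs G y" "b \<noteq> e" by (rule card_ge_2_obtain)
          have b': "b \<in> arcs G" "head G b = y" using b(1) by simp_all
          have "tail G b \<noteq> h" using oh[OF b'(1)] b(2) by blast
          moreover have "tail G b \<noteq> x" using no2'[OF a'(1) b'(1)] a' b' by auto
          ultimately show False using star[OF b'(1)] b'(2) y by simp
        next
          assume o: "in_arcs G h = {e} \<and> tail G e = x"
          have oh: "b = e" if "b \<in> arcs G" "head G b = h" for b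
          proof -
            have "b \<in> in_arcs G h" using that by simp
            then show ?thesis using o by simp
          qed
          obtain a where a: "a \<in> out_arcs G x" "a \<noteq> e" by (rule card_ge_2_obtain[OF dx(2)])
          define y where "y = head G a"
          have a': "a \<in> arcs G" "tail G a = x" "head G a = y" using a(1) by (simp_all add: y_def)
          have y: "y \<noteq> h" "y \<noteq> x" "y \<in> verts G" using oh[of a] a(2) a' ll[OF a'(1)] by auto
          have "2 \<le> card (out_arcs G y)" using deg[of y] y by (simp add: out_degree_def)
          then obtain b where b: "b \<in> out_arcs G y" "b \<noteq> e" by (rule card_ge_2_obtain)
          have b': "b \<in> arcs G" "tail G b = y" using b(1) by simp_all
          have "head G b \<noteq> h" using oh[OF b'(1)] b(2) by blast
          moreover have "head G b \<noteq> x" using no2'[OF b'(1) a'(1)] a' b' by auto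
          ultimately show False using star[OF b'(1)] b'(2) y by simp
        qed
      qed
      have "2 \<le> card (out_arcs G h)"
      proof (rule ccontr)
        assume "\<not> 2 \<le> card (out_arcs G h)"
        moreover have "eo \<in> out_arcs G h" using eo by simp
        then have "card (out_arcs G h) \<noteq> 0" by (auto simp: card_eq_0_iff)
        ultimately have "card (out_arcs G h) = 1" by linarith
        then have "out_arcs G h = {eo}" using eo by (metis card_1_singletonE in_out_arcs_conv singletonD)
        then show False using single[of eo "head G eo"] eo ll[OF eo(1)] by auto
      qed
      moreover have "2 \<le> card (in_arcs G h)"
      proof (rule ccontr)
        assume "\<not> 2 \<le> card (in_arcs G h)"
        moreover have "ei \<in> in_arcs G h" using ei by simp
        then have "card (in_arcs G h) \<noteq> 0" by (auto simp: card_eq_0_iff)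
        ultimately have "card (in_arcs G h) = 1" by linarith
        then have "in_arcs G h = {ei}" using ei by (metis card_1_singletonE in_in_arcs_conv singletonD)
        then show False using single[of ei "tail G ei"] ei ll[OF ei(1)] by auto
      qed
      ultimately have degs: "2 \<le> in_degree G v \<and> 2 \<le> out_degree G v" if "v \<in> verts G" for v
        using deg[of v] that by (cases "v = h") (simp_all add: in_degree_def out_degree_def)
      have "\<exists>b\<in>arcs G. tail G b = head G a" if "a \<in> arcs G" for a
      proof -
        have "2 \<le> card (out_arcs G (head G a))" using degs[of "head G a"] that by (simp add: out_degree_def)
        then obtain b where "b \<in> out_arcs G (head G a)" "b \<noteq> a" by (rule card_ge_2_obtain)
        then show ?thesis by auto
      qed
      note ex = this
      have ne: "arcs G \<noteq> {}" using eo(1) by blast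
      obtain p0 where "cycle p0" by (rule exists_cycle[OF finite_arcs order_refl ne ex])

      from ex_has_least_nat[of cycle p0 length, OF this]
      obtain p where p: "cycle p" "\<And>q. cycle q \<Longrightarrow> length p \<le> length q" by blast
      \<comment> \<open>All degrees, including those of \<open>h\<close>, are now at least two, and
        \<open>cycle_star\<close> shows that the shortest cycle meets every arc.\<close>
      have "short_cycle G p (tail G ` set p)"
      proof unfold_locales
        show "tail G a \<in> tail G ` set p \<or> head G a \<in> tail G ` set p" if "a \<in> arcs G" for a
          by (rule cycle_star[OF p(1) _ _ that]) (use degs no2' in auto)
      qed (use rG p ll no2' degs in auto)
      then show ?thesis using short_cycle.contradiction by blast
    qed
  qed
qed

text \<open>If RIV does not apply, one direction has at least two paths and the other at least
  three. The arcs of the pair play the roles of \<open>a\<close> and \<open>b\<close> in the 2 by 3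
  shape: having no inner vertices, they meet every other path at the ends only, and the other paths
  may cross freely.\<close>

lemma (in fin_digraph) RIV_of_connected_pair:
  assumes rG: "rigid (cycs G)" and uv: "connected_pair G u v"
  shows "RIV_applicable G u v"
proof (rule ccontr)
  assume n: "\<not> RIV_applicable G u v"
  obtain e1 where e1: "e1 \<in> arcs G" "tail G e1 = u" "head G e1 = v" using uv unfolding connected_pair_def by (meson reachableE)
  obtain e2 where e2: "e2 \<in> arcs G" "tail G e2 = v" "head G e2 = u" using uv unfolding connected_pair_def by (meson reachableE)
  have uv: "u \<noteq> v" using uv by (simp add: connected_pair_def)
  have main: False
    if ab: "a \<noteq> b" and ea: "ea \<in> arcs G" "tail G ea = a" "head G ea = b" and eb: "eb \<in> arcs G" "tail G eb = b" "head G eb = a"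
      and n2: "2 \<le> card {p. apath a p b}" and n3: "3 \<le> card {p. apath b p a}" for a b ea eb
  proof -
    note pa = apath1[OF ea ab] and pb = apath1[OF eb ab[symmetric]]
    \<comment> \<open>Vertices are not repeated, so nothing can precede or follow an arc that joins
      the two end points.\<close>
    have uniq: "p = [x]" if p: "apath s p t" "x \<in> set p" "tail G x = s" "head G x = t" for p x s t
    proof -
      obtain p1 p2 where pp: "p = p1 @ x # p2" using p(2) by (auto simp: in_set_conv_decomp)
      have d: "distinct (s # map (head G) p)" using p(1) by (simp add: apath_iff)
      have w: "awalk s p1 (tail G x)" "awalk (head G x) p2 t" using awalkI_apath[OF p(1)] unfolding pp by (auto simp: awalk_Cons_iff)
      have "p1 = []"
      proof (rule ccontr)
        assume "p1 \<noteq> []"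
        moreover have "last (s # map (head G) p1) = s"
          using w(1) awalk_verts_eq[OF w(1)] p(3) by (metis awlast_of_awalk awalkE')
        ultimately have "s \<in> set (map (head G) p1)" by (metis last_ConsR last_in_set list.map_disc_iff)
        then show False using d unfolding pp by auto
      qed
      moreover have "p2 = []"
      proof (rule ccontr)
        assume "p2 \<noteq> []"
        moreover have "last (t # map (head G) p2) = t"
          using w(2) awalk_verts_eq[OF w(2)] p(4) by (metis awlast_of_awalk awalkE')
        ultimately have "t \<in> set (map (head G) p2)" by (metis last_ConsR last_in_set list.map_disc_iff)
        then show False using d p(4) unfolding pp by auto
      qed
      ultimately show ?thesis using pp by simp
    qed
    obtain q where q: "apath a q b" "q \<noteq> [ea]" using card_ge_2_obtain[OF n2] by (metis mem_Collect_eq)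
    have c: "2 \<le> card ({p. apath b p a} - {[eb]})" using n3 pb(1) apaths_finite by simp
    obtain r1 where r1: "r1 \<in> {p. apath b p a} - {[eb]}" by (rule card_ge_2_obtain[OF c, of undefined]) (rule that)
    obtain r2 where r2: "r2 \<in> {p. apath b p a} - {[eb]}" "r2 \<noteq> r1" by (rule card_ge_2_obtain[OF c])
    have r: "apath b r1 a" "apath b r2 a" "r1 \<noteq> [eb]" "r2 \<noteq> [eb]" using r1 r2 by auto
    \<comment> \<open>A path is determined by its set of arcs: its first arc is the only one that
      starts at \<open>x\<close>.\<close>
    have inj: "s = t" if "apath x s y" "apath x t y" "set s = set t" for s t x y
      using that
    proof (induction s arbitrary: x t)
      case Nil
      then show ?case by simp
    next
      case (Cons e s)
      have "t \<noteq> []" using Cons.prems(3) by auto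
      then obtain e' t' where t: "t = e' # t'" by (cases t) auto
      have e: "tail G e = x" "apath (head G e) s y" "x \<notin> set (awalk_verts (head G e) s)"
        using Cons.prems(1) by (auto simp: apath_Cons_iff)
      have e': "tail G e' = x" "apath (head G e') t' y" "x \<notin> set (awalk_verts (head G e') t')"
        using Cons.prems(2) unfolding t by (auto simp: apath_Cons_iff)
      have n1: "e' \<notin> set s" using e(3) e'(1) awalk_verts_arc1[of e' s] by auto
      have n2: "e \<notin> set t'" using e'(3) e(1) awalk_verts_arc1[of e t'] by auto
      have n3: "e \<notin> set s" using e(1,3) awalk_verts_arc1[of e s] by auto
      have ee: "e = e'" using Cons.prems(3) n1 n2 unfolding t by auto
      then have "set s = set t'" using Cons.prems(3) n1 n2 n3 unfolding t by auto
      then show ?case using Cons.IH[OF e(2)] e'(2) ee t by simp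
    qed
    show False
    proof (rule no_K23[OF rG ab[symmetric] pa(1) q(1) pb(1) r(1,2)])
      show "set (awalk_verts a [ea]) \<inter> set (awalk_verts b [eb]) \<subseteq> {b, a}"
        "set (awalk_verts a [ea]) \<inter> set (awalk_verts b r1) \<subseteq> {b, a}"
        "set (awalk_verts a [ea]) \<inter> set (awalk_verts b r2) \<subseteq> {b, a}" unfolding pa(2) by auto
      show "set (awalk_verts a q) \<inter> set (awalk_verts b [eb]) \<subseteq> {b, a}" unfolding pb(2) by auto
      show "set [ea] \<noteq> set q" using inj[OF pa(1) q(1)] q(2) by blast
      show "set r1 \<noteq> set r2" using inj[OF r(1,2)] r2(2) by blast
      show "eb \<in> set [eb]" by simp
      show "eb \<notin> set r1" "eb \<notin> set r2" using uniq[OF r(1) _ eb(2,3)] uniq[OF r(2) _ eb(2,3)] r(3,4) by blast+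
    qed
  qed
  have pos: "card {p. apath u p v} \<noteq> 0" "card {p. apath v p u} \<noteq> 0"
    using apath1(1)[OF e1 uv] apath1(1)[OF e2 uv[symmetric]] apaths_finite by (auto simp: card_eq_0_iff)
  have c: "connected_pair G u v" using assms(2) .
  have "\<not> (num_paths G u v = 2 \<and> num_paths G v u = 2)" "num_paths G u v \<noteq> 1" "num_paths G v u \<noteq> 1"
    using n c by (auto simp: RIV_applicable_def)
  then have "2 \<le> card {p. apath u p v} \<and> 3 \<le> card {p. apath v p u} \<or> 2 \<le> card {p. apath v p u} \<and> 3 \<le> card {p. apath u p v}"
    using pos unfolding num_paths_def by arith
  then show False using main[OF uv e1 e2] main[OF uv[symmetric] e2 e1] by blast
qed

theorem theorem6p6:
  fixes Q :: "('v, 'b) pre_digraph"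
  assumes "fin_digraph Q"
    and "strongly_connected Q"
    and "prime_quiver Q"
    and "complete_intersection TYPE('k::{alg_closed_field, field_char_0}) Q"
    and "reduced Q"
  shows "\<exists>v. verts Q = {v} \<and> arcs Q = {}"
proof -
  interpret fin_digraph Q by (rule assms(1))
  note rig = rigid_of_complete_intersection[OF assms(4)]
  have dQ: "descends (cycs Q) (arcs Q) (cycs Q)" using cycs_sub(1) by (rule descends_refl)
  have rG: "rigid (cycs Q)" using rig[OF dQ] cycs_antichain cycs_sub(2) by blast
  have ll: "tail Q a \<noteq> head Q a" if "a \<in> arcs Q" for a
  proof
    assume "tail Q a = head Q a"
    then have "RII_applicable Q (head Q a)" using that by (auto simp: RII_applicable_def loops_at_def)
    then show False using assms(5) by (simp add: reduced_def)
  qed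
  have no2: "head Q a \<noteq> tail Q b" if "a \<in> arcs Q" "b \<in> arcs Q" "tail Q a = head Q b" for a b
  proof
    assume "head Q a = tail Q b"
    then have "connected_pair Q (tail Q a) (head Q a)"
      using ll[OF that(1)] in_arcs_imp_in_arcs_ends[OF that(1)] in_arcs_imp_in_arcs_ends[OF that(2)] that(3)
      by (simp add: connected_pair_def)
    then have "RIV_applicable Q (tail Q a) (head Q a)" by (rule RIV_of_connected_pair[OF rG])
    then show False using assms(5) by (simp add: reduced_def)
  qed
  obtain h where h: "h \<in> verts Q" using assms(2) by (auto simp: strongly_connected_def)
  show ?thesis
  proof (cases "verts Q = {h}")
    case True
    have "arcs Q = {}"
    proof (rule ccontr)
      assume "arcs Q \<noteq> {}"
      then obtain a where a: "a \<in> arcs Q" by blast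
      show False using ll[OF a] tail_in_verts[OF a] head_in_verts[OF a] True by simp
    qed
    then show ?thesis using True by blast
  next
    case False
    then obtain v where v: "v \<in> verts Q" "v \<noteq> h" using h by blast
    have "card {h, v} \<le> card (verts Q)" using h v by (intro card_mono) auto
    then have c: "2 \<le> card (verts Q)" using v(2) by simp
    have deg: "2 \<le> in_degree Q x \<and> 2 \<le> out_degree Q x" if "x \<in> verts Q" for x
    proof (rule ccontr)
      assume "\<not> ?thesis"
      then have "in_degree Q x \<le> 1 \<or> out_degree Q x \<le> 1" by linarith
      moreover have "loops_at Q x = {}"
      proof (rule equals0I)
        fix a assume "a \<in> loops_at Q x"
        then show False using ll[of a] by (simp add: loops_at_def)
      qed
      ultimately have "RI_applicable Q x" using c that by (simp add: RI_applicable_def)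
      then show False using assms(5) by (simp add: reduced_def)
    qed
    have star: "\<forall>a\<in>arcs Q. tail Q a = h \<or> head Q a = h"
      using deg no2 by (intro star_quiver[OF rig assms(1) dQ assms(2) h ll]) auto
    obtain a where "a \<in> in_arcs Q v" "a \<noteq> undefined"
      using card_ge_2_obtain deg[OF v(1)] unfolding in_degree_def by metis
    then have a: "a \<in> arcs Q" "head Q a = v" by simp_all
    obtain b where "b \<in> out_arcs Q v" "b \<noteq> undefined"
      using card_ge_2_obtain deg[OF v(1)] unfolding out_degree_def by metis
    then have b: "b \<in> arcs Q" "tail Q b = v" by simp_all
    have "tail Q a = h" "head Q b = h" using star a b v(2) by auto
    then show ?thesis using no2[OF b(1) a(1)] no2[OF a(1) b(1)] a(2) b(2) by simp
  qed
qed

end
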